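(* Let $K$ be a field of characteristic zero, let $A_1$ be the first Weyl algebra over $K$, and let $a \in A_1 \setminus K$. If the centralizer $C(a)$ of $a$ in $A_1$ has rank $1$, then $C(a)$ can be embedded (as a $K$-algebra) into a polynomial ring $K[z]$ in one variable.
   Context: The first Weyl algebra $A_1$ over a field $K$ is the associative $K$-algebra generated by two elements $x$ and $\partial$ subject to the relation $\partial x - x\partial = 1$. When $K$ has characteristic zero, $A_1$ acts on $K[x]$ with $x$ acting as multiplication by $x$ and $\partial$ as the derivative with respect to $x$; each element is written uniquely as a finite sum $\sum c_{i,j}x^i\partial^j$ with $c_{i,j}\in K$. The order of a nonzero element is its degree in $\partial$, i.e. the largest $j$ such that $c_{i,j}\neq 0$ for some $i$. The centralizer is $C(a)=\{b\in A_1 : ab=ba\}$. The rank of $C(a)$ is the greatest common divisor of the orders of the (nonzero) elements of $C(a)$. *)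

theory Defs
  imports "HOL-Computational_Algebra.Polynomial"
begin

section \<open>The first Weyl algebra by generators and relations\<close>

datatype 'a weyl_expr =
    Scal 'a | GenX | GenD
  | Add "'a weyl_expr" "'a weyl_expr"
  | Mult "'a weyl_expr" "'a weyl_expr"

text \<open>
  The smallest congruence on expressions that contains the axioms of an associative unital
  \<open>K\<close>-algebra and the defining relation. The quotient is therefore the
  \<open>K\<close>-algebra presented by two generators and the relation \<open>\<partial> x = x \<partial> + 1\<close>.
\<close>

inductive weyl_rel :: "'a::field weyl_expr \<Rightarrow> 'a weyl_expr \<Rightarrow> bool" where
  weyl_rel_refl: "weyl_rel e e"
| weyl_rel_sym: "weyl_rel e f \<Longrightarrow> weyl_rel f e"
| weyl_rel_trans: "weyl_rel e f \<Longrightarrow> weyl_rel f g \<Longrightarrow> weyl_rel e g"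
| weyl_rel_cong_Add: "weyl_rel e e' \<Longrightarrow> weyl_rel f f' \<Longrightarrow> weyl_rel (Add e f) (Add e' f')"
| weyl_rel_cong_Mult: "weyl_rel e e' \<Longrightarrow> weyl_rel f f' \<Longrightarrow> weyl_rel (Mult e f) (Mult e' f')"
| weyl_rel_add_assoc: "weyl_rel (Add (Add e f) g) (Add e (Add f g))"
| weyl_rel_add_commute: "weyl_rel (Add e f) (Add f e)"
| weyl_rel_add_zero: "weyl_rel (Add (Scal 0) e) e"
| weyl_rel_add_inv: "weyl_rel (Add (Mult (Scal (- 1)) e) e) (Scal 0)"
| weyl_rel_mult_assoc: "weyl_rel (Mult (Mult e f) g) (Mult e (Mult f g))"
| weyl_rel_mult_one_left: "weyl_rel (Mult (Scal 1) e) e"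
| weyl_rel_mult_one_right: "weyl_rel (Mult e (Scal 1)) e"
| weyl_rel_distrib_right: "weyl_rel (Mult (Add e f) g) (Add (Mult e g) (Mult f g))"
| weyl_rel_distrib_left: "weyl_rel (Mult e (Add f g)) (Add (Mult e f) (Mult e g))"
| weyl_rel_scal_add: "weyl_rel (Add (Scal c) (Scal d)) (Scal (c + d))"
| weyl_rel_scal_mult: "weyl_rel (Mult (Scal c) (Scal d)) (Scal (c * d))"
| weyl_rel_scal_central: "weyl_rel (Mult (Scal c) e) (Mult e (Scal c))"
| weyl_rel_DX: "weyl_rel (Mult GenD GenX) (Add (Mult GenX GenD) (Scal 1))"

quotient_type (overloaded) 'a weyl = "'a::field weyl_expr" / weyl_rel
  by (intro equivpI reflpI sympI transpI) (blast intro: weyl_rel.intros)+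

text \<open>
  The action on \<open>K[x]\<close>. It shows that the presented algebra is nontrivial and, in characteristic
  zero, that normal forms are unique.
\<close>

primrec expr_act :: "'a::field weyl_expr \<Rightarrow> 'a poly \<Rightarrow> 'a poly" where
  "expr_act (Scal c) p = smult c p"
| "expr_act GenX p = pCons 0 p"
| "expr_act GenD p = pderiv p"
| "expr_act (Add e f) p = expr_act e p + expr_act f p"
| "expr_act (Mult e f) p = expr_act e (expr_act f p)"

lemma expr_act_add: "expr_act e (p + q) = expr_act e p + expr_act e q"
  by (induction e arbitrary: p q) (simp_all add: smult_add_right pderiv_add algebra_simps)

lemma expr_act_smult: "expr_act e (smult c p) = smult c (expr_act e p)"
  by (induction e arbitrary: p) (simp_all add: pderiv_smult smult_add_right mult.commute)

lemma expr_act_rel: "weyl_rel e f \<Longrightarrow> expr_act e = expr_act f"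
  by (induction rule: weyl_rel.induct)
    (auto simp: fun_eq_iff expr_act_add expr_act_smult pderiv_pCons smult_add_left
      algebra_simps)

instantiation weyl :: (field) ring_1
begin

lift_definition zero_weyl :: "'a weyl" is "Scal 0" .
lift_definition one_weyl :: "'a weyl" is "Scal 1" .
lift_definition plus_weyl :: "'a weyl \<Rightarrow> 'a weyl \<Rightarrow> 'a weyl" is Add by (rule weyl_rel_cong_Add)
lift_definition times_weyl :: "'a weyl \<Rightarrow> 'a weyl \<Rightarrow> 'a weyl" is Mult by (rule weyl_rel_cong_Mult)
lift_definition uminus_weyl :: "'a weyl \<Rightarrow> 'a weyl" is "Mult (Scal (- 1))"
  by (intro weyl_rel_cong_Mult weyl_rel_refl)
definition minus_weyl :: "'a weyl \<Rightarrow> 'a weyl \<Rightarrow> 'a weyl" where "minus_weyl v w = v + (- w)"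

instance
proof
  fix u v w :: "'a weyl"
  show "u + v + w = u + (v + w)" by transfer (rule weyl_rel_add_assoc)
  show "u + v = v + u" by transfer (rule weyl_rel_add_commute)
  show "0 + u = u" by transfer (rule weyl_rel_add_zero)
  show "- u + u = 0" by transfer (rule weyl_rel_add_inv)
  show "u - v = u + - v" by (rule minus_weyl_def)
  show "u * v * w = u * (v * w)" by transfer (rule weyl_rel_mult_assoc)
  show "1 * u = u" by transfer (rule weyl_rel_mult_one_left)
  show "u * 1 = u" by transfer (rule weyl_rel_mult_one_right)
  show "(u + v) * w = u * w + v * w" by transfer (rule weyl_rel_distrib_right)
  show "u * (v + w) = u * v + u * w" by transfer (rule weyl_rel_distrib_left)
  show "(0::'a weyl) \<noteq> 1"
  proof (transfer, rule notI)
    assume "weyl_rel (Scal (0::'a)) (Scal 1)"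
    from expr_act_rel[OF this] have "expr_act (Scal (0::'a)) 1 = expr_act (Scal 1) 1" by simp
    then show False by simp
  qed
qed

end

lift_definition weyl_const :: "'a::field \<Rightarrow> 'a weyl" is Scal .
lift_definition weyl_X :: "'a::field weyl" is GenX .
lift_definition weyl_D :: "'a::field weyl" is GenD .

lift_definition weyl_act :: "'a::field weyl \<Rightarrow> 'a poly \<Rightarrow> 'a poly" is expr_act
  by (rule expr_act_rel)

lemma weyl_act_const [simp]: "weyl_act (weyl_const c) p = smult c p"
  by transfer simp
lemma weyl_act_X [simp]: "weyl_act weyl_X p = pCons 0 p"
  by transfer simp
lemma weyl_act_D [simp]: "weyl_act weyl_D p = pderiv p"
  by transfer simp
lemma weyl_act_0 [simp]: "weyl_act 0 p = 0"
  by transfer simp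
lemma weyl_act_1 [simp]: "weyl_act 1 p = p"
  by transfer simp
lemma weyl_act_add [simp]: "weyl_act (v + w) p = weyl_act v p + weyl_act w p"
  by transfer simp
lemma weyl_act_mult [simp]: "weyl_act (v * w) p = weyl_act v (weyl_act w p)"
  by transfer simp

lemma weyl_const_0 [simp]: "weyl_const 0 = 0" and weyl_const_1 [simp]: "weyl_const 1 = 1"
  by (transfer, rule weyl_rel_refl)+

lemma weyl_const_add: "weyl_const (c + d) = weyl_const c + weyl_const d"
  by transfer (rule weyl_rel_sym[OF weyl_rel_scal_add])

lemma weyl_const_mult: "weyl_const (c * d) = weyl_const c * weyl_const d"
  by transfer (rule weyl_rel_sym[OF weyl_rel_scal_mult])

lemma weyl_const_commute: "weyl_const c * w = w * weyl_const c"
  by transfer (rule weyl_rel_scal_central)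

lemma weyl_relation: "weyl_D * weyl_X - weyl_X * weyl_D = (1 :: 'a::field weyl)"
proof -
  have "weyl_D * weyl_X = weyl_X * weyl_D + (1 :: 'a weyl)"
    by transfer (rule weyl_rel_DX)
  then show ?thesis by simp
qed

lemma weyl_induct [case_names const X D add mult]:
  assumes "\<And>c. P (weyl_const c)" "P weyl_X" "P weyl_D"
    and "\<And>v w. P v \<Longrightarrow> P w \<Longrightarrow> P (v + w)" "\<And>v w. P v \<Longrightarrow> P w \<Longrightarrow> P (v * w)"
  shows "P (w :: 'a::field weyl)"
proof (induction w rule: weyl.abs_induct)
  case (1 e)
  show ?case
    by (induction e)
      (use assms in \<open>simp_all flip: weyl_const.abs_eq weyl_X.abs_eq weyl_D.abs_eq
        plus_weyl.abs_eq times_weyl.abs_eq\<close>)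
qed

section \<open>Normal forms and the order\<close>

definition weyl_supp :: "(nat \<Rightarrow> nat \<Rightarrow> 'a::field) \<Rightarrow> (nat \<times> nat) set" where
  "weyl_supp c = {(i, j). c i j \<noteq> 0}"

definition is_normal_form :: "'a::field weyl \<Rightarrow> (nat \<Rightarrow> nat \<Rightarrow> 'a) \<Rightarrow> bool" where
  "is_normal_form w c \<longleftrightarrow> finite (weyl_supp c) \<and>
     w = (\<Sum>(i, j)\<in>weyl_supp c. weyl_const (c i j) * weyl_X ^ i * weyl_D ^ j)"

definition weyl_coeff :: "'a::field weyl \<Rightarrow> nat \<Rightarrow> nat \<Rightarrow> 'a" where
  "weyl_coeff w = (THE c. is_normal_form w c)"

text \<open>
  Over a field of characteristic zero the normal form exists and is unique; see
  \<open>is_normal_form_weyl_coeff\<close> below. The order is meaningful for nonzero elements only.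
\<close>

definition weyl_order :: "'a::field weyl \<Rightarrow> nat" where
  "weyl_order w = Max {j. \<exists>i. weyl_coeff w i j \<noteq> 0}"

lemma is_normal_form_superset:
  assumes "finite A" "weyl_supp c \<subseteq> A"
  shows "is_normal_form w c \<longleftrightarrow>
    w = (\<Sum>(i, j)\<in>A. weyl_const (c i j) * weyl_X ^ i * weyl_D ^ j)"
proof -
  have "(\<Sum>(i, j)\<in>weyl_supp c. weyl_const (c i j) * weyl_X ^ i * weyl_D ^ j) =
        (\<Sum>(i, j)\<in>A. weyl_const (c i j) * weyl_X ^ i * weyl_D ^ j)"
    using assms by (intro sum.mono_neutral_left) (auto simp: weyl_supp_def)
  then show ?thesis
    using assms by (auto simp: is_normal_form_def intro: finite_subset)
qed

lemma is_normal_form_add: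
  assumes "is_normal_form v c" "is_normal_form w d"
  shows "is_normal_form (v + w) (\<lambda>i j. c i j + d i j)"
proof -
  let ?A = "weyl_supp c \<union> weyl_supp d"
  have fin: "finite ?A" using assms by (simp add: is_normal_form_def)
  have "v = (\<Sum>(i, j)\<in>?A. weyl_const (c i j) * weyl_X ^ i * weyl_D ^ j)"
    "w = (\<Sum>(i, j)\<in>?A. weyl_const (d i j) * weyl_X ^ i * weyl_D ^ j)"
    using assms is_normal_form_superset[OF fin] by blast+
  then have "v + w =
      (\<Sum>(i, j)\<in>?A. weyl_const (c i j + d i j) * weyl_X ^ i * weyl_D ^ j)"
    by (simp add: weyl_const_add distrib_right sum.distrib case_prod_unfold)
  moreover have "weyl_supp (\<lambda>i j. c i j + d i j) \<subseteq> ?A" by (auto simp: weyl_supp_def)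
  ultimately show ?thesis using is_normal_form_superset[OF fin] by blast
qed

lemma is_normal_form_monom:
  "is_normal_form (weyl_const k * weyl_X ^ m * weyl_D ^ n)
     (\<lambda>i j. if i = m \<and> j = n then k else 0)"
  by (subst is_normal_form_superset[of "{(m, n)}"]) (auto simp: weyl_supp_def split: if_splits)

lemma is_normal_form_0: "is_normal_form 0 (\<lambda>i j. 0)"
  by (simp add: is_normal_form_def weyl_supp_def)

lemma is_normal_form_sum:
  "(\<And>t. t \<in> T \<Longrightarrow> \<exists>c. is_normal_form (f t) c) \<Longrightarrow> \<exists>c. is_normal_form (sum f T) c"
proof (induction T rule: infinite_finite_induct)
  case (insert t T)
  then obtain c d where "is_normal_form (f t) c" "is_normal_form (sum f T) d" by blast
  from is_normal_form_add[OF this] insert.hyps show ?case by (metis sum.insert)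
qed (auto intro: is_normal_form_0)

lemma D_X_power: "weyl_D * weyl_X ^ m =
  weyl_X ^ m * weyl_D + weyl_const (of_nat m) * (weyl_X ^ (m - 1) :: 'a::field weyl)"
proof (induction m)
  case (Suc m)
  have DX: "weyl_D * weyl_X = weyl_X * weyl_D + (1 :: 'a weyl)"
    using weyl_relation by (simp add: algebra_simps)
  have "weyl_D * weyl_X ^ Suc m = (weyl_X * weyl_D + 1) * (weyl_X ^ m :: 'a weyl)"
    by (simp add: DX flip: mult.assoc)
  also have "\<dots> = weyl_X * (weyl_D * weyl_X ^ m) + weyl_X ^ m"
    by (simp add: distrib_right mult.assoc)
  also have "\<dots> = weyl_X ^ Suc m * weyl_D +
      (weyl_X * (weyl_const (of_nat m) * weyl_X ^ (m - 1)) + weyl_X ^ m)"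
    by (simp add: Suc.IH distrib_left mult.assoc)
  also have "weyl_X * (weyl_const (of_nat m) * weyl_X ^ (m - 1)) =
      weyl_const (of_nat m) * (weyl_X * weyl_X ^ (m - 1) :: 'a weyl)"
    by (metis mult.assoc weyl_const_commute)
  also have "\<dots> = weyl_const (of_nat m) * weyl_X ^ m"
    by (cases m) simp_all
  finally show ?case by (simp add: weyl_const_add distrib_right add_ac)
qed simp

theorem normal_form_exists: "\<exists>c. is_normal_form (w :: 'a::field weyl) c"
proof -
  have step: "\<exists>c. is_normal_form (u * v) c"
    if mono: "\<And>k m n. \<exists>c. is_normal_form (u * (weyl_const k * weyl_X ^ m * weyl_D ^ n)) c"
      and v: "\<exists>c. is_normal_form v c" for u v :: "'a weyl"
  proof -
    obtain c where c: "is_normal_form v c" using v by blast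
    have "u * v = (\<Sum>(i, j)\<in>weyl_supp c. u * (weyl_const (c i j) * weyl_X ^ i * weyl_D ^ j))"
      using c by (simp add: is_normal_form_def sum_distrib_left case_prod_unfold)
    with is_normal_form_sum[of "weyl_supp c"
        "\<lambda>(i, j). u * (weyl_const (c i j) * weyl_X ^ i * weyl_D ^ j)"]
    show ?thesis using mono by auto
  qed
  have "\<forall>v. (\<exists>c. is_normal_form v c) \<longrightarrow> (\<exists>c. is_normal_form (w * v) c)"
  proof (induction w rule: weyl_induct)
    case (const d)
    have "weyl_const d * (weyl_const k * weyl_X ^ m * weyl_D ^ n) =
        weyl_const (d * k) * weyl_X ^ m * weyl_D ^ n" for k m n
      by (simp add: weyl_const_mult mult.assoc)
    then have "\<exists>c. is_normal_form (weyl_const d * (weyl_const k * weyl_X ^ m * weyl_D ^ n)) c"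
      for k m n
      using is_normal_form_monom by metis
    then show ?case using step by blast
  next
    case X
    have "weyl_X * (weyl_const k * weyl_X ^ m * weyl_D ^ n) =
        weyl_const k * weyl_X ^ Suc m * weyl_D ^ n" for k :: 'a and m n
      by (metis mult.assoc power_Suc weyl_const_commute)
    then have "\<exists>c. is_normal_form (weyl_X * (weyl_const (k :: 'a) * weyl_X ^ m * weyl_D ^ n)) c"
      for k m n
      using is_normal_form_monom by metis
    then show ?case using step by blast
  next
    case D
    have eq: "weyl_D * (weyl_const k * weyl_X ^ m * weyl_D ^ n) =
        weyl_const k * weyl_X ^ m * weyl_D ^ Suc n +
        weyl_const (k * of_nat m) * weyl_X ^ (m - 1) * weyl_D ^ n" for k :: 'a and m n
    proof -
      have "weyl_D * (weyl_const k * weyl_X ^ m * weyl_D ^ n) =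
          weyl_const k * (weyl_D * weyl_X ^ m) * weyl_D ^ n"
        by (metis mult.assoc weyl_const_commute)
      then show ?thesis
        by (simp add: D_X_power weyl_const_mult distrib_left distrib_right mult.assoc)
    qed
    have "\<exists>c. is_normal_form (weyl_D * (weyl_const (k :: 'a) * weyl_X ^ m * weyl_D ^ n)) c"
      for k m n
      unfolding eq
      by (intro exI, rule is_normal_form_add[OF is_normal_form_monom is_normal_form_monom])
    then show ?case using step by blast
  next
    case (add v w)
    show ?case
    proof (intro allI impI)
      fix u :: "'a weyl"
      assume "\<exists>c. is_normal_form u c"
      with add obtain c d where "is_normal_form (v * u) c" "is_normal_form (w * u) d" by blast
      from is_normal_form_add[OF this] show "\<exists>c. is_normal_form ((v + w) * u) c"
        by (auto simp: distrib_right)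
    qed
  next
    case (mult v w)
    then show ?case by (simp add: mult.assoc)
  qed
  moreover have "\<exists>c. is_normal_form (1 :: 'a weyl) c"
    using is_normal_form_monom[of 1 0 0] by auto
  ultimately have "\<exists>c. is_normal_form (w * 1) c" by blast
  then show ?thesis by simp
qed

lemma weyl_act_sum: "weyl_act (sum f T) p = (\<Sum>t\<in>T. weyl_act (f t) p)"
  by (induction T rule: infinite_finite_induct) auto

lemma weyl_act_monom:
  "weyl_act (weyl_const k * weyl_X ^ m * weyl_D ^ n) p =
     smult k (monom 1 m * (pderiv ^^ n) p)"
proof -
  have "weyl_act (weyl_X ^ m) q = monom 1 m * q" for q :: "'a poly"
    by (induction m arbitrary: q) (simp_all add: monom_Suc)
  moreover have "weyl_act (weyl_D ^ n) p = (pderiv ^^ n) p"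
    by (induction n) simp_all
  ultimately show ?thesis by simp
qed

lemma pderiv_power_monom:
  "(pderiv ^^ n) (monom (1 :: 'a::field_char_0) m) =
     (if n \<le> m then monom (fact m / fact (m - n)) (m - n) else 0)"
proof (induction n)
  case (Suc n)
  show ?case
  proof (cases "Suc n \<le> m")
    case True
    define l where "l = m - Suc n"
    have l: "m - n = Suc l" "m - Suc n = l" using True by (auto simp: l_def)
    have "of_nat (Suc l) * (fact m / fact (Suc l)) = (fact m / fact l :: 'a)"
      by (simp del: of_nat_Suc)
    then show ?thesis using True Suc by (simp add: pderiv_monom l del: of_nat_Suc fact_Suc)
  next
    case False
    then show ?thesis using Suc by (cases "n = m") (auto simp: pderiv_monom)
  qed
qed simp

lemma normal_form_0_unique:
  assumes "is_normal_form (0 :: 'a::field_char_0 weyl) c"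
  shows "c i j = 0"
proof (induction j arbitrary: i rule: less_induct)
  case (less n)
  let ?t = "\<lambda>(k, l). smult (c k l) (monom 1 k * (pderiv ^^ l) (monom 1 n)) :: 'a poly"
  let ?A = "weyl_supp c" let ?B = "{(k, l) \<in> weyl_supp c. l = n}"
  have fin: "finite ?A" using assms by (simp add: is_normal_form_def)
  have zero: "0 = (\<Sum>(k, l)\<in>?A. weyl_const (c k l) * weyl_X ^ k * weyl_D ^ l)"
    by (rule is_normal_form_def[THEN iffD1, OF assms, THEN conjunct2])
  have "0 = weyl_act 0 (monom (1 :: 'a) n)" by simp
  also have "\<dots> =
      weyl_act (\<Sum>(k, l)\<in>?A. weyl_const (c k l) * weyl_X ^ k * weyl_D ^ l) (monom 1 n)"
    by (rule arg_cong[OF zero])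
  also have "\<dots> = sum ?t ?A"
    by (simp only: weyl_act_sum weyl_act_monom case_prod_unfold)
  also have "\<dots> = sum ?t ?B"
  proof (rule sum.mono_neutral_right[OF fin])
    show "\<forall>t\<in>?A - ?B. ?t t = 0"
    proof
      fix t assume t: "t \<in> ?A - ?B"
      obtain k l where kl: "t = (k, l)" by (cases t)
      with t have "c k l \<noteq> 0" "l \<noteq> n" by (auto simp: weyl_supp_def)
      with less have "n < l" by (metis linorder_neqE_nat)
      then show "?t t = 0" by (simp add: kl pderiv_power_monom)
    qed
  qed auto
  finally have "0 = coeff (sum ?t ?B) i" by (metis coeff_0)
  also have "\<dots> = (\<Sum>t\<in>?B. if t = (i, n) then c i n * fact n else 0)"
    unfolding coeff_sum
    by (intro sum.cong) (auto simp: pderiv_power_monom mult_monom split: if_splits)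
  also have "\<dots> = c i n * fact n"
  proof -
    have "finite ?B" using fin by (rule rev_finite_subset) auto
    then show ?thesis by (simp add: sum.delta weyl_supp_def)
  qed
  finally show "c i n = 0" by simp
qed

theorem normal_form_unique:
  assumes "is_normal_form (w :: 'a::field_char_0 weyl) c" "is_normal_form w d"
  shows "c = d"
proof (intro ext)
  fix i j
  have m1: "weyl_const (- k) = - weyl_const k" for k :: 'a
    using weyl_const_add[of k "- k"] by (simp add: eq_neg_iff_add_eq_0 add.commute)
  have "is_normal_form (- w) (\<lambda>i j. - d i j)"
    using assms(2)
    by (simp add: is_normal_form_def weyl_supp_def m1 sum_negf case_prod_unfold)
  from is_normal_form_add[OF assms(1) this]
  have "is_normal_form 0 (\<lambda>i j. c i j - d i j)" by simp
  from normal_form_0_unique[OF this, of i j] show "c i j = d i j" by simp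
qed

lemma is_normal_form_weyl_coeff: "is_normal_form (w :: 'a::field_char_0 weyl) (weyl_coeff w)"
  unfolding weyl_coeff_def
  using normal_form_exists[of w] normal_form_unique by (metis theI)

section \<open>Centralizers\<close>

definition centralizer :: "'a::field weyl \<Rightarrow> 'a weyl set" where
  "centralizer a = {b. a * b = b * a}"

definition centralizer_rank :: "'a::field weyl \<Rightarrow> nat" where
  "centralizer_rank a = Gcd (weyl_order ` (centralizer a - {0}))"

text \<open>
  An injective homomorphism of unital \<open>K\<close>-algebras from a subalgebra \<open>S\<close> of the Weyl algebra to
  \<open>K[z]\<close>; nothing is required of the values outside \<open>S\<close>.
\<close>

definition is_K_algebra_embedding :: "'a::field weyl set \<Rightarrow> ('a weyl \<Rightarrow> 'a poly) \<Rightarrow> bool" where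
  "is_K_algebra_embedding S \<phi> \<longleftrightarrow>
     inj_on \<phi> S \<and> \<phi> 1 = 1 \<and>
     (\<forall>v\<in>S. \<forall>w\<in>S. \<phi> (v + w) = \<phi> v + \<phi> w) \<and>
     (\<forall>v\<in>S. \<forall>w\<in>S. \<phi> (v * w) = \<phi> v * \<phi> w) \<and>
     (\<forall>c. \<forall>v\<in>S. \<phi> (weyl_const c * v) = smult c (\<phi> v))"

lemma centralizer_subalgebra:
  "weyl_const c \<in> centralizer a"
  "v \<in> centralizer a \<Longrightarrow> w \<in> centralizer a \<Longrightarrow> v + w \<in> centralizer a"
  "v \<in> centralizer a \<Longrightarrow> w \<in> centralizer a \<Longrightarrow> v * w \<in> centralizer a"
  by (simp_all add: centralizer_def weyl_const_commute distrib_left distrib_right)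
     (metis mult.assoc)

end

theory Submission
  imports Defs
    "HOL-Computational_Algebra.Formal_Laurent_Series"
    "HOL-Algebra.Algebraic_Closure_Type"
begin

text \<open>
  Rank one is first turned into a statement about leading coefficients. If \<open>b\<close> of order \<open>m\<close> commutes
  with \<open>a\<close> of order \<open>n\<close>, the top coefficient of \<open>ab - ba\<close> gives a differential equation between the
  leading coefficients which says that \<open>lead b ^ n\<close> and \<open>lead a ^ m\<close> are proportional. As \<open>C(a)\<close>
  has elements of two consecutive orders, this forces \<open>lead b = c f\<^sup>m\<close> for a single polynomial \<open>f\<close> and
  constants \<open>c\<close> (\<open>rank_one_leading_coeffs\<close>). So the elements of \<open>C(a)\<close> are operators with constant
  leading coefficient in the vector field \<open>\<delta> = f \<partial>\<close>.

  Choose a point of the projective line at which \<open>\<delta>\<close> vanishes, with local parameter \<open>t\<close>: a root of \<open>f\<close>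
  in an algebraic closure, or the point at infinity if \<open>f\<close> is constant (there \<open>\<partial> = -t\<^sup>2 d/dt\<close>). Over the Laurent
  series field, replace \<open>\<delta>\<close> by \<open>\<delta> + h\<close> such that the subleading coefficient of \<open>a\<close> vanishes. Then all
  coefficients of all elements of \<open>C(a)\<close> are regular at \<open>t = 0\<close> (\<open>regular_if_normalised\<close>,
  \<open>commuting_inherits_weight\<close>). The reason is a Newton polygon argument: at a positive slope the leading
  form \<open>A\<close> of \<open>a\<close> would again be an \<open>n\<close>-th power up to a constant, by the same use of consecutive
  orders; so \<open>A = c (X + s)\<^sup>n\<close>, where \<open>s = 0\<close> by the normalisation, and the Newton polygon has no such edge.

  Since \<open>\<delta>\<close> maps power series into \<open>(t)\<close>, putting \<open>t = 0\<close> in the coefficients is multiplicative on regular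
  operators. It preserves orders, and leading coefficients up to the power of \<open>f\<close>, hence is an
  embedding of \<open>C(a)\<close> into \<open>M[z]\<close> (\<open>local_embedding\<close>), where \<open>M\<close> is \<open>K\<close> for the point at infinity
  and the algebraic closure of \<open>K\<close> for a root \<open>x\<close> of \<open>f\<close>.

  In the second case the coefficients of the image lie in \<open>K(x)\<close>, and conjugating \<open>x\<close> gives another
  embedding with the same degrees and leading coefficients. Two such embeddings differ by a
  translation of \<open>z\<close> (\<open>translation_exists\<close>): the \<open>M\<close>-span of the image has finite codimension in
  \<open>M[z]\<close>, so it contains a nonzero ideal of \<open>M[z]\<close>, and the isomorphism between the two images extends to
  \<open>M[z]\<close>. The vanishing subleading coefficient of \<open>a\<close> excludes a proper translation. The
  embedding is therefore invariant under conjugation, and its image lies in \<open>K[z]\<close>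
  (\<open>rational_coefficients\<close>).
\<close>

hide_const (open) up_ring.coeff up_ring.monom module.smult Polynomials.degree Polynomials.lead_coeff

section \<open>Symbols of differential operators\<close>

text \<open>
  Operators \<open>\<Sum> c\<^sub>j \<delta>\<^sup>j\<close> over a differential ring are represented by their symbols \<open>\<Sum> c\<^sub>j X\<^sup>j\<close>. Left
  multiplication by \<open>\<delta>\<close> acts on symbols as \<open>D P = X P + \<delta> P\<close>, so \<open>star\<close> below is the symbol of the
  composition of two operators.
\<close>

locale derivation =
  fixes \<delta> :: "'b::idom \<Rightarrow> 'b"
  assumes delta_add: "\<delta> (a + b) = \<delta> a + \<delta> b"
    and delta_mult: "\<delta> (a * b) = \<delta> a * b + a * \<delta> b"
begin

lemma delta_0 [simp]: "\<delta> 0 = 0"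
  using delta_add[of 0 0] by (metis add_0 add_left_imp_eq add.right_neutral)

lemma delta_1 [simp]: "\<delta> 1 = 0"
  using delta_mult[of 1 1] by (metis add_left_imp_eq add.right_neutral mult.left_neutral mult.right_neutral)

lemma delta_sum: "\<delta> (sum f A) = (\<Sum>x\<in>A. \<delta> (f x))"
  by (induction A rule: infinite_finite_induct) (auto simp: delta_add)

abbreviation deltas :: "'b poly \<Rightarrow> 'b poly" where
  "deltas \<equiv> map_poly \<delta>"

lemma coeff_deltas [simp]: "coeff (deltas P) i = \<delta> (coeff P i)"
  by (simp add: coeff_map_poly)

lemma deltas_pCons [simp]: "deltas (pCons c P) = pCons (\<delta> c) (deltas P)"
  by (rule poly_eqI) (simp add: coeff_pCons split: nat.splits)

lemma deltas_add: "deltas (P + Q) = deltas P + deltas Q"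
  by (rule poly_eqI) (simp add: delta_add)

lemma deltas_smult: "deltas (smult c P) = smult (\<delta> c) P + smult c (deltas P)"
  by (rule poly_eqI) (simp add: delta_mult)

lemma deltas_mult: "deltas (P * Q) = deltas P * Q + P * deltas Q"
  by (rule poly_eqI) (simp add: coeff_mult delta_sum delta_mult sum.distrib)

definition D :: "'b poly \<Rightarrow> 'b poly" where
  "D P = pCons 0 P + deltas P"

lemma D_add: "D (P + Q) = D P + D Q"
  by (simp add: D_def deltas_add)

lemma D_smult: "D (smult c P) = smult (\<delta> c) P + smult c (D P)"
  by (simp add: D_def deltas_smult smult_add_right)

lemma D_0 [simp]: "D 0 = 0"
  by (simp add: D_def)

lemma D_1 [simp]: "D 1 = [:0, 1:]"
  by (simp add: D_def one_pCons)

lemma D_power_1: "(D ^^ i) 1 = monom 1 i"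
  by (induction i) (auto simp: D_def monom_Suc map_poly_monom)

definition star :: "'b poly \<Rightarrow> 'b poly \<Rightarrow> 'b poly" where
  "star P Q = (\<Sum>i\<le>degree P. smult (coeff P i) ((D ^^ i) Q))"

lemma star_eq_sum:
  assumes "degree P \<le> N"
  shows "star P Q = (\<Sum>i\<le>N. smult (coeff P i) ((D ^^ i) Q))"
  unfolding star_def using assms
  by (intro sum.mono_neutral_left) (auto simp: coeff_eq_0)

lemma star_0_left [simp]: "star 0 Q = 0"
  by (simp add: star_def)

lemma star_pCons: "star (pCons c P) Q = smult c Q + star P (D Q)"
proof -
  have "star (pCons c P) Q = (\<Sum>i\<le>Suc (degree P). smult (coeff (pCons c P) i) ((D ^^ i) Q))"
    by (rule star_eq_sum) (simp add: degree_pCons_le)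
  also have "\<dots> = smult c Q + (\<Sum>i\<le>degree P. smult (coeff P i) ((D ^^ Suc i) Q))"
    by (subst sum.atMost_Suc_shift) (simp del: funpow.simps)
  finally show ?thesis by (simp add: star_def funpow_swap1)
qed

lemma star_add_left: "star (P + P') Q = star P Q + star P' Q"
proof -
  let ?N = "max (degree P) (degree P')"
  have "degree (P + P') \<le> ?N" by (rule degree_add_le_max)
  then show ?thesis
    by (simp add: star_eq_sum[of _ ?N] smult_add_left sum.distrib)
qed

lemma star_smult_left: "star (smult c P) Q = smult c (star P Q)"
  by (induction P arbitrary: Q) (simp_all add: star_pCons smult_add_right)

lemma star_const_left [simp]: "star [:c:] Q = smult c Q"
  by (simp add: star_pCons)

lemma star_1_left [simp]: "star 1 Q = Q"
  by (simp add: one_pCons)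

lemma star_1_right [simp]: "star P 1 = P"
  by (simp add: star_def D_power_1 smult_monom poly_as_sum_of_monoms)

text \<open>
  This is associativity of composition for the left factor \<open>\<delta>\<close>; all multiplicativity of symbols
  is derived from it.
\<close>

lemma D_star: "D (star P Q) = star (D P) Q"
proof (induction P arbitrary: Q)
  case (pCons c P)
  have "star (D P) (D Q) = star P (D (D Q)) + star (deltas P) (D Q)"
    unfolding D_def[of P] by (simp add: star_add_left star_pCons)
  then show ?case
    by (simp add: star_pCons D_add D_smult pCons.IH D_def[of "pCons c P"] star_add_left)
qed simp

end

text \<open>
  The substitution \<open>x \<mapsto> \<xi>\<close>, \<open>\<partial> \<mapsto> g \<delta> + h\<close>. The condition \<open>g \<delta>(\<xi>) = 1\<close> is the defining relation of the
  Weyl algebra, and \<open>h\<close> is the freedom of conjugating by an exponential.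
\<close>

locale weyl_symbol = derivation \<delta> for \<delta> :: "'b::idom \<Rightarrow> 'b" +
  fixes \<iota> :: "'a::field \<Rightarrow> 'b" and \<xi> g h :: 'b
  assumes iota_add: "\<iota> (c + d) = \<iota> c + \<iota> d"
    and iota_mult: "\<iota> (c * d) = \<iota> c * \<iota> d"
    and iota_1 [simp]: "\<iota> 1 = 1"
    and delta_iota [simp]: "\<delta> (\<iota> c) = 0"
    and delta_xi: "g * \<delta> \<xi> = 1"
begin

lemma iota_0 [simp]: "\<iota> 0 = 0"
  using iota_add[of 0 0] by (metis add_0 add_left_imp_eq add.right_neutral)

lemma iota_minus: "\<iota> (- c) = - \<iota> c"
  using iota_add[of c "- c"] by (simp add: eq_neg_iff_add_eq_0 add.commute)

definition G :: "'b poly \<Rightarrow> 'b poly" where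
  "G P = smult g (D P) + smult h P"

lemma G_add: "G (P + Q) = G P + G Q"
  by (simp add: G_def D_add smult_add_right)

lemma G_smult: "G (smult c P) = smult (g * \<delta> c) P + smult c (G P)"
  by (simp add: G_def D_smult smult_add_right mult.commute)

text \<open>
  The action on the module of symbols replaces a map into an algebra of operators: the action on
  \<open>1\<close> recovers the symbol, and the algebra never has to be built.
\<close>

primrec expr_sym :: "'a weyl_expr \<Rightarrow> 'b poly \<Rightarrow> 'b poly" where
  "expr_sym (Scal c) P = smult (\<iota> c) P"
| "expr_sym GenX P = smult \<xi> P"
| "expr_sym GenD P = G P"
| "expr_sym (Add e f) P = expr_sym e P + expr_sym f P"
| "expr_sym (Mult e f) P = expr_sym e (expr_sym f P)"

lemma expr_sym_star: "expr_sym e (star P Q) = star (expr_sym e P) Q"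
  by (induction e arbitrary: P Q)
    (simp_all add: star_smult_left star_add_left G_def D_star)

lemma expr_sym_add: "expr_sym e (P + Q) = expr_sym e P + expr_sym e Q"
  by (induction e arbitrary: P Q) (simp_all add: smult_add_right G_add algebra_simps)

lemma expr_sym_const: "expr_sym e (smult (\<iota> c) P) = smult (\<iota> c) (expr_sym e P)"
  by (induction e arbitrary: P) (simp_all add: smult_add_right G_smult mult.commute)

lemma expr_sym_rel: "weyl_rel e f \<Longrightarrow> expr_sym e = expr_sym f"
  by (induction rule: weyl_rel.induct)
    (auto simp: fun_eq_iff expr_sym_add expr_sym_const iota_add iota_mult iota_minus
      smult_add_left G_smult delta_xi algebra_simps)

definition sym :: "'a weyl \<Rightarrow> 'b poly" where
  "sym w = expr_sym (rep_weyl w) 1"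

lemma sym_abs: "sym (abs_weyl e) = expr_sym e 1"
proof -
  have "weyl_rel (rep_weyl (abs_weyl e)) e"
    by (rule Quotient3_rep_abs[OF Quotient3_weyl]) (rule weyl_rel_refl)
  from expr_sym_rel[OF this] show ?thesis by (simp add: sym_def)
qed

lemma sym_add: "sym (v + w) = sym v + sym w"
  by (induction v rule: weyl.abs_induct, induction w rule: weyl.abs_induct)
     (simp add: plus_weyl.abs_eq sym_abs)

lemma sym_mult: "sym (v * w) = star (sym v) (sym w)"
  by (induction v rule: weyl.abs_induct, induction w rule: weyl.abs_induct)
     (simp add: times_weyl.abs_eq sym_abs flip: expr_sym_star)

lemma sym_const: "sym (weyl_const c) = [:\<iota> c:]"
  by (simp add: weyl_const.abs_eq sym_abs one_pCons)

lemma sym_X: "sym weyl_X = [:\<xi>:]"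
  by (simp add: weyl_X.abs_eq sym_abs one_pCons)

lemma sym_D: "sym weyl_D = [:h, g:]"
  by (simp add: weyl_D.abs_eq sym_abs G_def one_pCons[symmetric])

lemma sym_0 [simp]: "sym 0 = 0"
  using sym_const[of 0] by simp

lemma sym_1 [simp]: "sym 1 = 1"
  using sym_const[of 1] by (simp add: one_pCons)

lemma sym_const_mult: "sym (weyl_const c * w) = smult (\<iota> c) (sym w)"
  by (simp add: sym_mult sym_const)

lemma sym_X_power_mult: "sym (weyl_X ^ i * w) = smult (\<xi> ^ i) (sym w)"
  by (induction i) (simp_all add: sym_mult sym_X mult.assoc)

lemma sym_D_mult: "sym (weyl_D * w) = G (sym w)"
  by (simp add: sym_mult sym_D star_pCons G_def)

lemma sym_sum: "sym (sum f A) = (\<Sum>x\<in>A. sym (f x))"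
  by (induction A rule: infinite_finite_induct) (auto simp: sym_add)

lemma sym_expand:
  assumes "is_normal_form w c"
  shows "sym w = (\<Sum>(i, j)\<in>weyl_supp c. smult (\<iota> (c i j) * \<xi> ^ i) (sym (weyl_D ^ j)))"
proof -
  have "w = (\<Sum>(i, j)\<in>weyl_supp c. weyl_const (c i j) * weyl_X ^ i * weyl_D ^ j)"
    using assms by (simp add: is_normal_form_def)
  then have "sym w = sym (\<Sum>(i, j)\<in>weyl_supp c. weyl_const (c i j) * weyl_X ^ i * weyl_D ^ j)"
    by simp
  also have "\<dots> = (\<Sum>(i, j)\<in>weyl_supp c. smult (\<iota> (c i j) * \<xi> ^ i) (sym (weyl_D ^ j)))"
    by (simp add: sym_sum case_prod_unfold mult.assoc sym_const_mult sym_X_power_mult)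
  finally show ?thesis .
qed

lemma coeff_sym_D_Suc: "coeff (sym (weyl_D * weyl_D ^ j)) i =
    g * ((case i of 0 \<Rightarrow> 0 | Suc i' \<Rightarrow> coeff (sym (weyl_D ^ j)) i') + \<delta> (coeff (sym (weyl_D ^ j)) i))
      + h * coeff (sym (weyl_D ^ j)) i"
  by (simp add: sym_D_mult G_def D_def coeff_pCons)

lemma degree_sym_D_power: "degree (sym (weyl_D ^ j)) \<le> j"
proof (induction j)
  case (Suc j)
  then have "coeff (sym (weyl_D ^ j)) i = 0" if "i > j" for i
    using that by (intro coeff_eq_0) auto
  then show ?case
    by (intro degree_le) (auto simp: coeff_sym_D_Suc split: nat.splits)
qed simp

lemma coeff_sym_D_power_0: "j < i \<Longrightarrow> coeff (sym (weyl_D ^ j)) i = 0"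
  by (rule coeff_eq_0) (rule le_less_trans[OF degree_sym_D_power])

lemma coeff_sym_D_power_self: "coeff (sym (weyl_D ^ j)) j = g ^ j"
proof (induction j)
  case (Suc j)
  have "coeff (sym (weyl_D ^ j)) (Suc j) = 0"
    using degree_sym_D_power[of j] by (intro coeff_eq_0) auto
  with Suc show ?case by (simp add: coeff_sym_D_Suc)
qed simp

text \<open>
  The part of the subleading coefficient of \<open>(g \<delta> + h)\<^sup>j\<close> that does not depend on \<open>h\<close>.
\<close>

primrec subleading :: "nat \<Rightarrow> 'b" where
  "subleading 0 = 0"
| "subleading (Suc j) = g * (subleading j + \<delta> (g ^ j))"

lemma coeff_sym_D_power_pred:
  "coeff (sym (weyl_D ^ Suc j)) j = subleading (Suc j) + of_nat (Suc j) * g ^ j * h"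
proof (induction j)
  case (Suc j)
  have "coeff (sym (weyl_D ^ Suc (Suc j))) (Suc j) =
      g * (coeff (sym (weyl_D ^ Suc j)) j + \<delta> (g ^ Suc j)) + h * g ^ Suc j"
    using coeff_sym_D_Suc[of "Suc j" "Suc j"] coeff_sym_D_power_self[of "Suc j"] by simp
  also have "\<dots> = subleading (Suc (Suc j)) + of_nat (Suc (Suc j)) * g ^ Suc j * h"
    unfolding Suc.IH by (simp add: algebra_simps)
  finally show ?case .
qed (simp add: sym_D)

definition ev :: "'a poly \<Rightarrow> 'b" where
  "ev p = poly (map_poly \<iota> p) \<xi>"

lemma ev_0 [simp]: "ev 0 = 0"
  by (simp add: ev_def)

lemma ev_pCons [simp]: "ev (pCons c p) = \<iota> c + \<xi> * ev p"
  by (simp add: ev_def map_poly_pCons)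

lemma ev_1 [simp]: "ev 1 = 1"
  by (simp add: one_pCons)

lemma ev_add: "ev (p + q) = ev p + ev q"
proof (induction p arbitrary: q)
  case (pCons c p)
  then show ?case by (cases q) (simp add: iota_add algebra_simps)
qed simp

lemma ev_smult: "ev (smult c p) = \<iota> c * ev p"
  by (induction p) (simp_all add: iota_mult algebra_simps)

lemma ev_mult: "ev (p * q) = ev p * ev q"
  by (induction p) (simp_all add: ev_add ev_smult algebra_simps)

lemma ev_power: "ev (p ^ n) = ev p ^ n"
  by (induction n) (simp_all add: ev_mult)

lemma ev_sum: "ev (sum f A) = (\<Sum>x\<in>A. ev (f x))"
  by (induction A rule: infinite_finite_induct) (auto simp: ev_add)

lemma ev_monom: "ev (monom c i) = \<iota> c * \<xi> ^ i"
  by (induction i) (simp_all add: monom_0 monom_Suc algebra_simps)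

end

text \<open>
  Over \<open>K[x]\<close> with the usual derivative the symbol of \<open>\<Sum> c\<^sub>i\<^sub>j x\<^sup>i \<partial>\<^sup>j\<close> is the normal form itself. It
  carries the order and the leading coefficient of an element.
\<close>

global_interpretation std: weyl_symbol pderiv "\<lambda>c :: 'a::field. [:c:]" "pCons 0 1" 1 0
  defines std_sym = std.sym
  by unfold_locales (simp_all add: pderiv_add pderiv_mult one_pCons pderiv_pCons)

lemma std_sym_D_power: "std_sym (weyl_D ^ j :: 'a::field weyl) = monom 1 j"
  by (induction j) (simp_all add: std.sym_D_mult std.G_def std.D_def monom_Suc map_poly_monom)

lemma coeff_std_sym:
  assumes "is_normal_form (w :: 'a::field weyl) c"
  shows "coeff (std_sym w) k = (\<Sum>(i, j)\<in>weyl_supp c. if j = k then monom (c i j) i else 0)"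
proof -
  have X: "pCons 0 1 ^ i = monom (1 :: 'a) i" for i
    by (simp add: monom_altdef)
  show ?thesis
    by (simp add: std.sym_expand[OF assms] std_sym_D_power coeff_sum case_prod_unfold X
        smult_monom cong: if_cong)
qed

lemma coeff_coeff_std_sym:
  "coeff (coeff (std_sym w) j) i = weyl_coeff (w :: 'a::field_char_0 weyl) i j"
proof -
  let ?c = "weyl_coeff w"
  have nf: "is_normal_form w ?c" by (rule is_normal_form_weyl_coeff)
  then have fin: "finite (weyl_supp ?c)" by (simp add: is_normal_form_def)
  have "coeff (coeff (std_sym w) j) i = (\<Sum>t\<in>weyl_supp ?c. if t = (i, j) then ?c i j else 0)"
    unfolding coeff_std_sym[OF nf] coeff_sum by (intro sum.cong) (auto split: if_splits)
  also have "\<dots> = ?c i j"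
    using fin by (simp add: weyl_supp_def)
  finally show ?thesis .
qed

lemma std_sym_eq_0_iff: "std_sym (w :: 'a::field_char_0 weyl) = 0 \<longleftrightarrow> w = 0"
proof
  assume "std_sym w = 0"
  then have "weyl_coeff w i j = 0" for i j
    using coeff_coeff_std_sym[of w j i] by simp
  then have "weyl_supp (weyl_coeff w) = {}" by (auto simp: weyl_supp_def)
  then show "w = 0"
    using is_normal_form_weyl_coeff[of w] by (simp add: is_normal_form_def)
qed simp

lemma weyl_order_eq_degree:
  assumes "w \<noteq> (0 :: 'a::field_char_0 weyl)"
  shows "weyl_order w = degree (std_sym w)"
proof -
  let ?J = "{j. \<exists>i. weyl_coeff w i j \<noteq> 0}"
  have J: "?J = {j. coeff (std_sym w) j \<noteq> 0}"
    by (auto simp: poly_eq_iff simp flip: coeff_coeff_std_sym)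
  have "finite ?J"
    unfolding J by (rule finite_subset[of _ "{..degree (std_sym w)}"]) (auto intro: le_degree)
  moreover have "degree (std_sym w) \<in> ?J"
    unfolding J using assms by (simp add: std_sym_eq_0_iff)
  ultimately show ?thesis
    unfolding weyl_order_def J by (intro Max_eqI) (auto intro: le_degree)
qed

context weyl_symbol
begin

text \<open>
  Every symbol is a linear substitution into the normal form, so its top two coefficients can be read
  off from those of the normal form.
\<close>

lemma sym_conv_std:
  assumes "degree (std_sym w) \<le> N"
  shows "sym w = (\<Sum>k\<le>N. smult (ev (coeff (std_sym w) k)) (sym (weyl_D ^ k)))"
proof -
  obtain c where nf: "is_normal_form w c" using normal_form_exists by blast
  let ?S = "weyl_supp c"
  have fin: "finite ?S" using nf by (simp add: is_normal_form_def)
  have ev: "ev (coeff (std_sym w) k) =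
      (\<Sum>t\<in>?S. if snd t = k then \<iota> (c (fst t) (snd t)) * \<xi> ^ fst t else 0)" for k
  proof -
    have "ev (coeff (std_sym w) k) =
        (\<Sum>t\<in>?S. ev (if snd t = k then monom (c (fst t) (snd t)) (fst t) else 0))"
      by (subst coeff_std_sym[OF nf]) (simp only: ev_sum case_prod_unfold)
    then show ?thesis by (simp add: if_distrib[of ev] ev_monom cong: if_cong)
  qed
  have "sym w = (\<Sum>(i, j)\<in>?S. smult (\<iota> (c i j) * \<xi> ^ i) (sym (weyl_D ^ j)))"
    by (rule sym_expand[OF nf])
  also obtain M where M: "N \<le> M" "\<And>i j. (i, j) \<in> ?S \<Longrightarrow> j \<le> M"
  proof
    show "N \<le> Max (insert N (snd ` ?S))" using fin by simp
    show "\<And>i j. (i, j) \<in> ?S \<Longrightarrow> j \<le> Max (insert N (snd ` ?S))"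
      using fin by (intro Max_ge) force+
  qed
  have "(\<Sum>(i, j)\<in>?S. smult (\<iota> (c i j) * \<xi> ^ i) (sym (weyl_D ^ j))) =
      (\<Sum>t\<in>?S. \<Sum>k\<le>M. if k = snd t
        then smult (\<iota> (c (fst t) (snd t)) * \<xi> ^ fst t) (sym (weyl_D ^ k)) else 0)"
    using M(2) by (intro sum.cong) (auto simp: sum.delta)
  also have "\<dots> = (\<Sum>k\<le>M. \<Sum>t\<in>?S. if k = snd t
        then smult (\<iota> (c (fst t) (snd t)) * \<xi> ^ fst t) (sym (weyl_D ^ k)) else 0)"
    by (rule sum.swap)
  also have "\<dots> = (\<Sum>k\<le>M. smult (ev (coeff (std_sym w) k)) (sym (weyl_D ^ k)))"
    by (simp only: ev smult_sum) (auto intro!: sum.cong)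
  also have "\<dots> = (\<Sum>k\<le>N. smult (ev (coeff (std_sym w) k)) (sym (weyl_D ^ k)))"
    using M(1) assms by (intro sum.mono_neutral_right) (auto simp: coeff_eq_0)
  finally show ?thesis .
qed

lemma degree_sym_le: "degree (sym w) \<le> degree (std_sym w)"
  by (subst sym_conv_std[OF order_refl], intro degree_sum_le)
    (auto intro: order_trans[OF degree_smult_le] order_trans[OF degree_sym_D_power])

lemma coeff_sym_top:
  assumes "degree (std_sym w) \<le> n"
  shows "coeff (sym w) n = ev (coeff (std_sym w) n) * g ^ n"
proof -
  have "coeff (sym w) n = (\<Sum>k\<le>n. if k = n then ev (coeff (std_sym w) n) * g ^ n else 0)"
    by (subst sym_conv_std[OF assms], unfold coeff_sum, intro sum.cong refl)
      (auto simp: coeff_sym_D_power_self coeff_sym_D_power_0)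
  then show ?thesis by simp
qed

lemma coeff_sym_pred:
  assumes "degree (std_sym w) \<le> Suc n"
  shows "coeff (sym w) n = ev (coeff (std_sym w) n) * g ^ n
    + ev (coeff (std_sym w) (Suc n)) * (subleading (Suc n) + of_nat (Suc n) * g ^ n * h)"
proof -
  have "coeff (sym w) n = (\<Sum>k\<le>Suc n. ev (coeff (std_sym w) k) * coeff (sym (weyl_D ^ k)) n)"
    by (subst sym_conv_std[OF assms]) (simp add: coeff_sum del: sum.atMost_Suc)
  also have "\<dots> = (\<Sum>k\<in>{n, Suc n}. ev (coeff (std_sym w) k) * coeff (sym (weyl_D ^ k)) n)"
    by (intro sum.mono_neutral_right)
      (auto simp: coeff_sym_D_power_0)
  finally show ?thesis
    using coeff_sym_D_power_pred[of n] coeff_sym_D_power_self[of n] by simp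
qed

end

section \<open>Polynomials over a field\<close>

lemma degree_eq_if_coeff:
  "degree P \<le> n \<Longrightarrow> coeff P n \<noteq> 0 \<Longrightarrow> degree P = n"
  by (simp add: le_antisym le_degree)

text \<open>
  A nonzero combination of \<open>p\<close> and \<open>q\<close> of least degree divides every combination, by division with
  remainder.
\<close>

lemma field_poly_bezout:
  fixes p q :: "'a::field poly"
  assumes "p \<noteq> 0 \<or> q \<noteq> 0"
  obtains d u v r s where "p = d * u" "q = d * v" "d = r * p + s * q" "r * u + s * v = 1"
proof -
  let ?Q = "\<lambda>d. d \<noteq> 0 \<and> (\<exists>r s. d = r * p + s * q)"
  have "?Q p \<or> ?Q q"
    using assms by (metis add.left_neutral add.right_neutral mult_1 mult_zero_left)
  then obtain d where d: "?Q d" and min: "\<And>e. ?Q e \<Longrightarrow> degree d \<le> degree e"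
    using ex_has_least_nat[of ?Q _ degree] by blast
  from d obtain r s where rs: "d = r * p + s * q" by blast
  have *: "d dvd r' * p + s' * q" for r' s'
  proof (rule ccontr)
    let ?e = "r' * p + s' * q"
    assume "\<not> d dvd ?e"
    then have "?e mod d \<noteq> 0" by (simp add: dvd_eq_mod_eq_0)
    moreover have "?e mod d = (r' - ?e div d * r) * p + (s' - ?e div d * s) * q"
      unfolding minus_div_mult_eq_mod[symmetric] by (subst (2) rs) (simp add: algebra_simps)
    ultimately have "degree d \<le> degree (?e mod d)" using min by blast
    with \<open>?e mod d \<noteq> 0\<close> d show False using degree_mod_less[of d ?e] by auto
  qed
  from *[of 1 0] *[of 0 1] obtain u v where uv: "p = d * u" "q = d * v" by (auto elim!: dvdE)
  have "d * (r * u + s * v) = d * 1"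
    using rs by (simp add: uv algebra_simps)
  with d have "r * u + s * v = 1" by (metis mult_left_cancel)
  with uv rs that show ?thesis by blast
qed

text \<open>
  After division by the common divisor the two polynomials \<open>u\<close> and \<open>v\<close> are comaximal, and then
  \<open>u\<close> divides a power of \<open>v\<close> only if it is a unit.
\<close>

lemma field_poly_power_dvd_imp_dvd:
  fixes p q :: "'a::field poly"
  assumes "p ^ n dvd q ^ n" "n > 0"
  shows "p dvd q"
proof (cases "p = 0")
  case True
  with assms show ?thesis by (simp add: zero_power)
next
  case False
  then obtain d u v r s where *: "p = d * u" "q = d * v" "r * u + s * v = 1"
    using field_poly_bezout[of p q] by metis
  have "u ^ n dvd v ^ n"
    using assms(1) False by (simp add: * power_mult_distrib)
  then have "u dvd v ^ n" using assms(2) by (meson dvd_power dvd_trans)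
  moreover have "u dvd x" if "u dvd x * v ^ k" for x k
    using that
  proof (induction k)
    case (Suc k)
    have "x * v ^ k = (x * v ^ k) * (r * u + s * v)" using * by simp
    also have "\<dots> = u * (x * v ^ k * r) + s * (x * v ^ Suc k)" by (simp add: algebra_simps)
    finally have "u dvd x * v ^ k" using Suc.prems by (metis dvd_add dvd_mult dvd_triv_left)
    then show ?case by (rule Suc.IH)
  qed simp
  ultimately have "u dvd 1" by (metis mult_1)
  then show ?thesis using * by (simp add: mult_dvd_mono unit_imp_dvd)
qed

text \<open>
  The powers of \<open>q/p\<close> have the common denominator \<open>p\<close>, so \<open>q/p\<close> is integral. In coprime terms \<open>u\<close>,
  \<open>v\<close> of the fraction, every power of \<open>u\<close> would divide the fixed common divisor \<open>d\<close>, so \<open>u\<close> is constant.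
\<close>

lemma field_poly_dvd_if_powers_dvd:
  fixes p q :: "'a::field poly"
  assumes "p \<noteq> 0" and dvd: "\<And>k. p ^ k dvd q ^ Suc k"
  shows "p dvd q"
proof -
  obtain d u v r s where *: "p = d * u" "q = d * v" "r * u + s * v = 1"
    using field_poly_bezout[of p q] assms(1) by metis
  have cancel: "u ^ j dvd x" if "u ^ j dvd x * v ^ k" for x j k
  proof -
    have step: "u ^ j dvd x" if "u ^ j dvd x * v" for x j
      using that
    proof (induction j arbitrary: x)
      case (Suc j)
      have "u dvd x * v" using Suc.prems by (metis dvd_mult_left power_Suc)
      moreover have "x = u * (r * x) + s * (x * v)"
      proof -
        have "x = x * (r * u + s * v)" unfolding *(3) by (rule mult_1_right[symmetric])
        also have "\<dots> = u * (r * x) + s * (x * v)"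
          by (simp only: distrib_left mult.commute mult.left_commute mult.assoc)
        finally show ?thesis .
      qed
      ultimately have "u dvd x" by (metis dvd_add dvd_mult dvd_triv_left)
      then obtain y where y: "x = u * y" ..
      show ?case
      proof (cases "u = 0")
        case False
        with Suc.prems have "u ^ j dvd y * v" by (simp add: y mult.assoc)
        then have "u ^ j dvd y" by (rule Suc.IH)
        then show ?thesis by (simp add: y mult_dvd_mono)
      qed (simp add: y)
    qed simp
    show ?thesis using that
    proof (induction k)
      case (Suc k)
      then have "u ^ j dvd (x * v ^ k) * v" by (simp add: ac_simps)
      then show ?case using step Suc.IH by blast
    qed simp
  qed
  have d: "d \<noteq> 0" and u: "u \<noteq> 0" using assms(1) * by auto
  have "u ^ k dvd d" for k
  proof -
    have "d ^ k * u ^ k dvd d ^ k * (d * v ^ Suc k)"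
      using dvd[of k] by (simp add: * power_mult_distrib ac_simps)
    then have "u ^ k dvd d * v ^ Suc k" using d by (metis dvd_mult_cancel_left power_not_zero)
    then show ?thesis by (rule cancel)
  qed
  then have "degree (u ^ Suc (degree d)) \<le> degree d" using d by (intro dvd_imp_degree_le)
  then have "Suc (degree d) * degree u < Suc (degree d) * 1"
    using u by (simp add: degree_power_eq del: power_Suc)
  then have "degree u = 0" by (metis less_one mult_less_cancel1)
  then have "is_unit u" using u by (simp add: is_unit_iff_degree)
  then show ?thesis using * by (simp add: mult_dvd_mono unit_imp_dvd)
qed

text \<open>
  Compare top coefficients: they are multiples of \<open>degree p\<close> and \<open>degree q\<close> by the same nonzero
  factor.
\<close>

lemma wronskian_eq_0_degree:
  fixes p q :: "'a::field_char_0 poly"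
  assumes "p \<noteq> 0" "q \<noteq> 0" "pderiv p * q = p * pderiv q"
  shows "degree p = degree q"
proof -
  have top: "coeff (pderiv p * q) (degree p + degree q - 1) =
      of_nat (degree p) * lead_coeff p * lead_coeff q"
    if "p \<noteq> 0" "q \<noteq> 0" for p q :: "'a poly"
  proof (cases "degree p = 0")
    case True
    then have "pderiv p = 0" by (simp add: pderiv_eq_0_iff)
    with True show ?thesis by simp
  next
    case False
    then have "degree p + degree q - 1 = degree (pderiv p) + degree q"
      by (simp add: degree_pderiv)
    moreover have "lead_coeff (pderiv p) = of_nat (degree p) * lead_coeff p"
      using False by (simp add: degree_pderiv coeff_pderiv del: of_nat_Suc)
    ultimately show ?thesis by (simp add: coeff_mult_degree_sum)
  qed
  have "of_nat (degree p) * lead_coeff p * lead_coeff q =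
      of_nat (degree q) * lead_coeff q * lead_coeff p"
    using top[OF assms(1,2)] top[OF assms(2,1)] assms(3) by (simp only: mult.commute add.commute)
  then have "of_nat (degree p) * (lead_coeff p * lead_coeff q) =
      of_nat (degree q) * (lead_coeff p * lead_coeff q)"
    by (simp add: ac_simps)
  then show ?thesis using assms(1,2) by simp
qed

text \<open>
  Subtracting a multiple of \<open>q\<close> from \<open>p\<close> keeps the Wronskian zero but can be used to kill the top
  coefficient, which contradicts equality of degrees unless the difference is zero.
\<close>

lemma wronskian_eq_0_imp_proportional:
  fixes p q :: "'a::field_char_0 poly"
  assumes "p \<noteq> 0" "q \<noteq> 0" "pderiv p * q = p * pderiv q"
  obtains c where "c \<noteq> 0" "p = smult c q"
proof -
  define c where "c = lead_coeff p / lead_coeff q"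
  define w where "w = p - smult c q"
  have deg: "degree p = degree q" by (rule wronskian_eq_0_degree[OF assms])
  have c: "c \<noteq> 0" using assms by (simp add: c_def)
  have "pderiv w * q = w * pderiv q"
    using assms(3) by (simp add: w_def pderiv_diff pderiv_smult algebra_simps)
  then have "w \<noteq> 0 \<Longrightarrow> degree w = degree q"
    using wronskian_eq_0_degree assms(2) by blast
  moreover have "coeff w (degree q) = 0"
    using assms(2) deg by (simp add: w_def c_def)
  ultimately have "w = 0" by (metis leading_coeff_0_iff)
  then show ?thesis using c that by (simp add: w_def)
qed

lemma pderiv_power_mult_self:
  "pderiv (p ^ k) * p = of_nat k * p ^ k * pderiv (p :: 'a::{idom, semiring_char_0} poly)"
  by (cases k) (simp_all add: pderiv_power_Suc of_nat_poly del: power_Suc, simp add: algebra_simps)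

text \<open>
  The hypothesis is the equation \<open>m A'/A = n B'/B\<close> between logarithmic derivatives. It occurs twice below,
  for leading coefficients and for leading forms at a slope.
\<close>

lemma powers_proportional:
  fixes A B :: "'a::field_char_0 poly"
  assumes "A \<noteq> 0" "B \<noteq> 0" "of_nat m * pderiv A * B = of_nat n * A * pderiv B"
  obtains c where "c \<noteq> 0" "A ^ m = smult c (B ^ n)"
proof -
  have "(pderiv (A ^ m) * B ^ n - A ^ m * pderiv (B ^ n)) * (A * B) =
      (pderiv (A ^ m) * A) * B ^ n * B - A ^ m * A * (pderiv (B ^ n) * B)"
    by (simp add: algebra_simps)
  also have "\<dots> = A ^ m * B ^ n * (of_nat m * pderiv A * B - of_nat n * A * pderiv B)"
    unfolding pderiv_power_mult_self by (simp add: algebra_simps)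
  also have "\<dots> = 0" using assms(3) by simp
  finally have "pderiv (A ^ m) * B ^ n = A ^ m * pderiv (B ^ n)" using assms(1,2) by simp
  from wronskian_eq_0_imp_proportional[OF _ _ this] assms that show ?thesis by auto
qed

lemma proportional_if_powers_proportional:
  fixes A B :: "'a::field_char_0 poly"
  assumes "A \<noteq> 0" "B \<noteq> 0" "n > 0" "A ^ n = smult c (B ^ n)"
  obtains c' where "c' \<noteq> 0" "A = smult c' B"
proof -
  have "of_nat n * A ^ n * (pderiv A * B) = (pderiv (A ^ n) * A) * B"
    unfolding pderiv_power_mult_self by (simp add: algebra_simps)
  also have "\<dots> = smult c (pderiv (B ^ n) * B * A)"
    unfolding assms(4) by (simp add: pderiv_smult algebra_simps)
  also have "\<dots> = of_nat n * smult c (B ^ n) * (A * pderiv B)"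
    unfolding pderiv_power_mult_self by (simp add: algebra_simps)
  finally have "of_nat n * A ^ n * (pderiv A * B - A * pderiv B) = 0"
    unfolding assms(4)[symmetric] by (simp add: algebra_simps)
  then have "pderiv A * B = A * pderiv B" using assms(1,3) by simp
  from wronskian_eq_0_imp_proportional[OF assms(1,2) this] that show ?thesis by blast
qed

text \<open>
  \<open>A\<^bsup>k+1\<^esup>\<close> and \<open>A\<^sup>k\<close> are proportional to \<open>P\<^sup>n\<close> and \<open>Q\<^sup>n\<close>; hence \<open>A\<close> is proportional to \<open>(P/Q)\<^sup>n\<close>, and
  \<open>P/Q\<close> is a polynomial. This is where consecutive orders enter.
\<close>

lemma common_root_extraction:
  fixes A P Q :: "'a::field_char_0 poly"
  assumes "A \<noteq> 0" "P \<noteq> 0" "Q \<noteq> 0" "n > 0"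
    and P: "of_nat (Suc k) * pderiv A * P = of_nat n * A * pderiv P"
    and Q: "of_nat k * pderiv A * Q = of_nat n * A * pderiv Q"
  obtains c R where "c \<noteq> 0" "A = smult c (R ^ n)"
proof -
  obtain c where c: "c \<noteq> 0" "A ^ Suc k = smult c (P ^ n)"
    using powers_proportional[OF assms(1,2) P] by blast
  obtain d where d: "d \<noteq> 0" "A ^ k = smult d (Q ^ n)"
    using powers_proportional[OF assms(1,3) Q] by blast
  have *: "smult c (P ^ n) = A * smult d (Q ^ n)" using c(2) d(2) by simp
  then have "P ^ n = Q ^ n * smult (d / c) A"
    using c(1) by (metis (no_types, lifting) divide_inverse_commute left_inverse mult.commute
        mult_smult_left mult_smult_right smult_1_left smult_smult)
  then have "Q ^ n dvd P ^ n" by (metis dvd_triv_left)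
  then have "Q dvd P" using \<open>n > 0\<close> by (rule field_poly_power_dvd_imp_dvd)
  then obtain R where R: "P = Q * R" ..
  have "Q ^ n * smult c (R ^ n) = Q ^ n * smult d A"
    using * by (simp add: R power_mult_distrib ac_simps)
  then have "smult c (R ^ n) = smult d A" using assms(3) by (metis mult_left_cancel power_not_zero)
  then have "A = smult (c / d) (R ^ n)" using d(1)
    by (metis divide_inverse_commute left_inverse smult_1_left smult_smult)
  with that[of "c / d" R] c(1) d(1) show ?thesis by simp
qed

lemma coeff_mult_add:
  assumes "degree A \<le> i" "degree B \<le> j"
  shows "coeff (A * B) (i + j) = coeff A i * (coeff B j :: 'a::comm_semiring_0)"
proof -
  have "coeff (A * B) (i + j) = (\<Sum>l\<le>i + j. coeff A l * coeff B (i + j - l))"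
    by (rule coeff_mult)
  also have "\<dots> = (\<Sum>l\<le>i + j. if l = i then coeff A i * coeff B j else 0)"
  proof (intro sum.cong refl)
    fix l assume "l \<in> {..i + j}"
    show "coeff A l * coeff B (i + j - l) = (if l = i then coeff A i * coeff B j else 0)"
    proof (cases l i rule: linorder_cases)
      case less
      then have "coeff B (i + j - l) = 0" using assms by (intro coeff_eq_0) auto
      with less show ?thesis by simp
    next
      case greater
      then have "coeff A l = 0" using assms by (intro coeff_eq_0) auto
      with greater show ?thesis by simp
    qed simp
  qed
  finally show ?thesis by simp
qed

lemma coeff_linear_power_pred:
  "coeff ([:a, 1:] ^ Suc n) n = of_nat (Suc n) * (a :: 'a::comm_ring_1)"
proof (induction n)
  case (Suc n)
  have top: "coeff ([:a, 1:] ^ n) n = 1" for n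
    by (induction n) (simp_all add: coeff_eq_0 degree_linear_power)
  have "coeff ([:a, 1:] ^ Suc (Suc n)) (Suc n) =
      a * coeff ([:a, 1:] ^ Suc n) (Suc n) + coeff ([:a, 1:] ^ Suc n) n"
    by (subst power_Suc) (simp del: power_Suc)
  then show ?case unfolding Suc.IH top by (simp add: algebra_simps)
qed simp

section \<open>Commutators in a filtered algebra\<close>

context derivation
begin

lemma star_top:
  assumes P: "degree P \<le> n" and Q: "degree Q \<le> m"
  shows "degree (star P Q) \<le> n + m" "coeff (star P Q) (n + m) = coeff P n * coeff Q m"
proof -
  have D: "degree ((D ^^ j) Q) \<le> j + m \<and> coeff ((D ^^ j) Q) (j + m) = coeff Q m" for j
  proof (induction j)
    case (Suc j)
    then have z: "coeff ((D ^^ j) Q) i = 0" if "i > j + m" for i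
      using that by (intro coeff_eq_0) auto
    have "degree (D ((D ^^ j) Q)) \<le> Suc j + m"
      by (intro degree_le) (auto simp: D_def coeff_pCons z split: nat.splits)
    moreover have "coeff (D ((D ^^ j) Q)) (Suc j + m) = coeff Q m"
      using Suc by (subst D_def) (simp add: z)
    ultimately show ?case by simp
  qed (use Q in simp)
  have z: "coeff ((D ^^ j) Q) i = 0" if "i > j + m" for i j
    using that D[of j] by (intro coeff_eq_0) auto
  note star = star_eq_sum[OF P, of Q]
  show "degree (star P Q) \<le> n + m"
    unfolding star by (intro degree_le allI impI) (simp add: coeff_sum z)
  have "coeff (star P Q) (n + m) = (\<Sum>j\<le>n. if j = n then coeff P n * coeff Q m else 0)"
    unfolding star coeff_sum by (intro sum.cong refl) (use D in \<open>auto simp: z\<close>)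
  then show "coeff (star P Q) (n + m) = coeff P n * coeff Q m" by simp
qed

text \<open>
  \<open>V w\<close> is a decreasing filtration for which multiplication by \<open>X\<close> lowers weights by \<open>r\<close> and \<open>\<delta>\<close> raises
  them by \<open>s\<close>. Each application of \<open>\<delta>\<close> in place of a multiplication by \<open>X\<close> gains the weight \<open>r + s\<close>,
  so only terms with at most one \<open>\<delta>\<close> matter modulo \<open>2 (r + s)\<close>.
\<close>

lemma D_power_expand:
  fixes V :: "int \<Rightarrow> 'b poly \<Rightarrow> bool"
  assumes V0: "\<And>w. V w 0" and Vadd: "\<And>w P Q. V w P \<Longrightarrow> V w Q \<Longrightarrow> V w (P + Q)"
    and Vmono: "\<And>w w' P. V w P \<Longrightarrow> w' \<le> w \<Longrightarrow> V w' P"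
    and VX: "\<And>w P. V w P \<Longrightarrow> V (w - r) (pCons 0 P)"
    and Vd: "\<And>w P. V w P \<Longrightarrow> V (w + s) (deltas P)"
    and rs: "r + s \<ge> 0" and Q: "V w Q"
  shows "\<exists>R. V (w - r * int j + 2 * (r + s)) R \<and>
    (D ^^ j) Q = monom 1 j * Q + of_nat j * (monom 1 (j - 1) * deltas Q) + R"
proof (induction j)
  case 0
  show ?case by (intro exI[of _ 0]) (simp add: V0)
next
  case (Suc j)
  then obtain R where R: "V (w - r * int j + 2 * (r + s)) R"
    and D: "(D ^^ j) Q = monom 1 j * Q + of_nat j * (monom 1 (j - 1) * deltas Q) + R" by blast
  let ?T = "of_nat j * (monom 1 (j - 1) * deltas (deltas Q))"
  let ?R = "pCons 0 R + deltas R + ?T"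
  have Vmon: "V (u - r * int i) (monom 1 i * P)" if "V u P" for u P i
  proof (induction i)
    case (Suc i)
    from VX[OF this] show ?case by (simp add: monom_Suc algebra_simps)
  qed (simp add: that)
  have Vnat: "V u (of_nat i * P)" if "V u P" for u P i
    by (induction i) (simp_all add: V0 that Vadd algebra_simps)
  have "V (w - r * int (Suc j) + 2 * (r + s)) (pCons 0 R)"
    using VX[OF R] by (simp add: algebra_simps)
  moreover have "V (w - r * int (Suc j) + 2 * (r + s)) (deltas R)"
    by (rule Vmono[OF Vd[OF R]]) (use rs in \<open>simp add: algebra_simps\<close>)
  moreover have "V (w - r * int (Suc j) + 2 * (r + s)) ?T"
  proof (cases j)
    case (Suc i)
    have e: "w - r * int (Suc j) + 2 * (r + s) = w + s + s - r * int i"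
      by (simp add: Suc algebra_simps)
    show ?thesis
      unfolding e using Vnat[OF Vmon[OF Vd[OF Vd[OF Q]], of i], of j] by (simp add: Suc)
  qed (simp add: V0)
  ultimately have "V (w - r * int (Suc j) + 2 * (r + s)) ?R"
    by (intro Vadd)
  moreover have "(D ^^ Suc j) Q =
      monom 1 (Suc j) * Q + of_nat (Suc j) * (monom 1 (Suc j - 1) * deltas Q) + ?R"
  proof -
    have dm: "deltas (monom 1 i * P) = monom 1 i * deltas P" for i P
      by (simp add: deltas_mult map_poly_monom)
    have dn: "deltas (of_nat i * P) = of_nat i * deltas P" for i P
      by (induction i) (simp_all add: deltas_add algebra_simps)
    have p0: "pCons 0 P = monom 1 1 * P" for P :: "'b poly"
      by (simp add: monom_Suc)
    have X: "pCons 0 (of_nat j * (monom 1 (j - 1) * P)) = of_nat j * (monom 1 j * P)" for P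
      by (cases j) (simp_all add: monom_Suc del: of_nat_Suc)
    have "(D ^^ Suc j) Q = D ((D ^^ j) Q)" by simp
    also have "\<dots> = pCons 0 (monom 1 j * Q) + pCons 0 (of_nat j * (monom 1 (j - 1) * deltas Q)) + pCons 0 R
        + (monom 1 j * deltas Q + ?T + deltas R)"
      unfolding D by (simp add: D_def deltas_add dm dn)
    also have "\<dots> = monom 1 (Suc j) * Q + of_nat (Suc j) * (monom 1 (Suc j - 1) * deltas Q) + ?R"
      unfolding X by (simp add: monom_Suc algebra_simps)
    finally show ?thesis .
  qed
  ultimately show ?case by blast
qed

lemma star_expand:
  fixes V :: "int \<Rightarrow> 'b poly \<Rightarrow> bool"
  assumes V0: "\<And>w. V w 0" and Vadd: "\<And>w P Q. V w P \<Longrightarrow> V w Q \<Longrightarrow> V w (P + Q)"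
    and Vmono: "\<And>w w' P. V w P \<Longrightarrow> w' \<le> w \<Longrightarrow> V w' P"
    and VX: "\<And>w P. V w P \<Longrightarrow> V (w - r) (pCons 0 P)"
    and Vd: "\<And>w P. V w P \<Longrightarrow> V (w + s) (deltas P)"
    and Vc: "\<And>j w R. V w R \<Longrightarrow> V (w + wP + r * int j) (smult (coeff P j) R)"
    and rs: "r + s \<ge> 0" and Q: "V wQ Q"
  shows "V (wP + wQ + 2 * (r + s)) (star P Q - P * Q - pderiv P * deltas Q)"
proof -
  have "\<forall>j. \<exists>R. V (wQ - r * int j + 2 * (r + s)) R \<and>
    (D ^^ j) Q = monom 1 j * Q + of_nat j * (monom 1 (j - 1) * deltas Q) + R"
    using D_power_expand[of V r s wQ Q] V0 Vadd Vmono VX Vd rs Q by blast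
  then obtain R where VR: "\<And>j. V (wQ - r * int j + 2 * (r + s)) (R j)"
    and D: "\<And>j. (D ^^ j) Q = monom 1 j * Q + of_nat j * (monom 1 (j - 1) * deltas Q) + R j"
    by metis
  let ?S = "\<lambda>f. \<Sum>j\<le>degree P. smult (coeff P j) (f j)"
  have P: "P = ?S (monom 1)" by (simp add: smult_monom poly_as_sum_of_monoms)
  have "pderiv P = pderiv (?S (monom 1))" using P by simp
  also have "\<dots> = ?S (\<lambda>j. of_nat j * monom 1 (j - 1))"
    by (simp add: higher_pderiv_sum[of 1, simplified] pderiv_smult pderiv_monom of_nat_poly smult_monom mult.commute)
  finally have P': "pderiv P = \<dots>" .
  have "star P Q = ?S (\<lambda>j. monom 1 j * Q) + ?S (\<lambda>j. of_nat j * monom 1 (j - 1) * deltas Q) + ?S R"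
    unfolding star_def D by (simp add: smult_add_right sum.distrib mult.assoc)
  also have "?S (\<lambda>j. monom 1 j * Q) = P * Q"
    by (subst (3) P) (simp add: sum_distrib_right)
  also have "?S (\<lambda>j. of_nat j * monom 1 (j - 1) * deltas Q) = pderiv P * deltas Q"
    by (simp add: P' sum_distrib_right)
  finally have "star P Q - P * Q - pderiv P * deltas Q = ?S R" by simp
  moreover have "V (wP + wQ + 2 * (r + s)) (?S R)"
  proof -
    have "V (wP + wQ + 2 * (r + s)) (smult (coeff P j) (R j))" for j
      using Vc[OF VR[of j], of j] by (simp add: algebra_simps)
    then show ?thesis
      by (induction rule: infinite_finite_induct[of _ "{..degree P}"])
        (simp_all add: V0 Vadd)
  qed
  ultimately show ?thesis by simp
qed

text \<open>
  The first two orders of the composition formula \<open>P \<star> Q = \<Sum> P\<^bsup>(k)\<^esup> \<delta>\<^sup>k Q / k!\<close>: commuting operators have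
  Poisson bracket zero up to higher weight. The filtration by degree and the slope filtrations
  are both instances.
\<close>

lemma commutator_expand:
  fixes V :: "int \<Rightarrow> 'b poly \<Rightarrow> bool"
  assumes V0: "\<And>w. V w 0" and Vadd: "\<And>w P Q. V w P \<Longrightarrow> V w Q \<Longrightarrow> V w (P + Q)"
    and Vminus: "\<And>w P. V w P \<Longrightarrow> V w (- P)"
    and Vmono: "\<And>w w' P. V w P \<Longrightarrow> w' \<le> w \<Longrightarrow> V w' P"
    and VX: "\<And>w P. V w P \<Longrightarrow> V (w - r) (pCons 0 P)"
    and Vd: "\<And>w P. V w P \<Longrightarrow> V (w + s) (deltas P)"
    and Vc: "\<And>u w P R j. V u P \<Longrightarrow> V w R \<Longrightarrow> V (w + u + r * int j) (smult (coeff P j) R)"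
    and rs: "r + s \<ge> 0" and P: "V wP P" and Q: "V wQ Q" and comm: "star P Q = star Q P"
  shows "V (wP + wQ + 2 * (r + s)) (pderiv Q * deltas P - pderiv P * deltas Q)"
proof -
  let ?w = "wP + wQ + 2 * (r + s)"
  have "V ?w (star P Q - P * Q - pderiv P * deltas Q)"
    by (rule star_expand[where V = V and r = r and s = s, OF V0 Vadd Vmono VX Vd Vc[OF P] rs Q])
  moreover have "V (wQ + wP + 2 * (r + s)) (star Q P - Q * P - pderiv Q * deltas P)"
    by (rule star_expand[where V = V and r = r and s = s, OF V0 Vadd Vmono VX Vd Vc[OF Q] rs P])
  then have "V ?w (- (star Q P - Q * P - pderiv Q * deltas P))"
    by (intro Vminus) (simp add: add.commute)
  ultimately have "V ?w ((star P Q - P * Q - pderiv P * deltas Q)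
      + - (star Q P - Q * P - pderiv Q * deltas P))"
    by (rule Vadd)
  moreover have "(star P Q - P * Q - pderiv P * deltas Q) + - (star Q P - Q * P - pderiv Q * deltas P)
      = pderiv Q * deltas P - pderiv P * deltas Q"
    unfolding comm mult.commute[of Q P] by simp
  ultimately show ?thesis by simp
qed

text \<open>
  The instance of the expansion in which the weight is the negated degree, so that \<open>r = 1\<close> and \<open>s = 0\<close>.
\<close>

lemma commuting_lead_coeffs:
  assumes comm: "star P Q = star Q P" and P: "degree P \<le> n" and Q: "degree Q \<le> m"
  shows "of_nat m * coeff Q m * \<delta> (coeff P n) = of_nat n * coeff P n * \<delta> (coeff Q m)"
proof -
  define V :: "int \<Rightarrow> 'b poly \<Rightarrow> bool" where "V w P \<longleftrightarrow> (\<forall>j. int j > - w \<longrightarrow> coeff P j = 0)" for w P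
  have "V (- int n + - int m + 2 * (1 + 0)) (pderiv Q * deltas P - pderiv P * deltas Q)"
  proof (rule commutator_expand)
    show "V (- int n) P" "V (- int m) Q"
      using P Q by (auto simp: V_def intro: coeff_eq_0)
    show "V (w - 1) (pCons 0 P)" if "V w P" for w P
      using that by (auto simp: V_def coeff_pCons split: nat.splits)
    show "V (w + u + 1 * int j) (smult (coeff P j) R)" if "V u P" "V w R" for u w P R j
    proof (cases "int j > - u")
      case False
      then show ?thesis using that by (auto simp: V_def)
    qed (use that in \<open>auto simp: V_def\<close>)
  qed (use comm in \<open>auto simp: V_def\<close>)
  then have top: "coeff (pderiv Q * deltas P - pderiv P * deltas Q) l = 0" if "l + 1 = n + m" for l
    using that by (auto simp: V_def)
  have prod: "coeff (pderiv P * deltas Q) l = of_nat n * coeff P n * \<delta> (coeff Q m)"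
    if "l + 1 = n + m" "degree P \<le> n" "degree Q \<le> m" for P Q n m l
  proof (cases n)
    case 0
    then have "pderiv P = 0" using that(2) by (auto elim: degree_eq_zeroE simp: pderiv_pCons)
    then show ?thesis using 0 by simp
  next
    case (Suc n')
    have "degree (pderiv P) \<le> n'"
      using that(2) Suc by (intro degree_le) (auto simp: coeff_pderiv coeff_eq_0)
    moreover have "degree (deltas Q) \<le> m"
      using that(3) by (intro degree_le) (auto simp: coeff_eq_0)
    ultimately have "coeff (pderiv P * deltas Q) (n' + m) = coeff (pderiv P) n' * coeff (deltas Q) m"
      by (rule coeff_mult_add)
    then show ?thesis using that(1) Suc by (simp add: coeff_pderiv)
  qed
  show ?thesis
  proof (cases "n + m")
    case (Suc l)
    then show ?thesis using top[of l] prod[of l n m P Q] prod[of l m n Q P] P Q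
      by (simp add: add.commute)
  qed auto
qed

end

section \<open>Orders and leading coefficients in a centralizer of rank one\<close>

text \<open>
  The least positive difference \<open>g\<close> of two elements divides every element: a remainder modulo \<open>g\<close>
  would be a smaller difference.
\<close>

lemma consecutive_elements_if_Gcd_eq_1:
  fixes S :: "nat set"
  assumes 0: "0 \<in> S" and add: "\<And>x y. x \<in> S \<Longrightarrow> y \<in> S \<Longrightarrow> x + y \<in> S" and "Gcd S = 1"
  shows "\<exists>k. k \<in> S \<and> Suc k \<in> S"
proof -
  have mul: "n * x \<in> S" if "x \<in> S" for n x
    by (induction n) (auto simp: 0 intro: add that)
  have "\<exists>z\<in>S. z > 0"
  proof (rule ccontr)
    assume "\<not> ?thesis"
    then have "S = {0}" using 0 by auto
    with assms(3) show False by simp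
  qed
  then have ex: "\<exists>g. g > 0 \<and> (\<exists>x\<in>S. x + g \<in> S)" using 0 by (metis add_0)
  define g where "g = (LEAST g. g > 0 \<and> (\<exists>x\<in>S. x + g \<in> S))"
  from LeastI_ex[OF ex] obtain x where x: "g > 0" "x \<in> S" "x + g \<in> S" by (auto simp: g_def)
  have min: "g \<le> g'" if "g' > 0" "y \<in> S" "y + g' \<in> S" for g' y
    unfolding g_def by (rule Least_le) (use that in blast)
  have "g dvd z" if z: "z \<in> S" for z
  proof (rule ccontr)
    assume "\<not> g dvd z"
    then have r: "z mod g > 0" by (simp add: mod_greater_zero_iff_not_dvd)
    have "(z div g) * (x + g) \<in> S" "z + (z div g) * x \<in> S" using z x by (auto intro: mul add)
    moreover have "(z div g) * (x + g) + z mod g = z + (z div g) * x"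
      using div_mult_mod_eq[of z g] by (simp add: distrib_left)
    ultimately have "g \<le> z mod g" using min[OF r] by metis
    with mod_less_divisor[OF x(1), of z] show False by simp
  qed
  then have "g dvd Gcd S" by (rule Gcd_greatest)
  with assms(3) have "g = 1" by simp
  with x show ?thesis by auto
qed

text \<open>
  For \<open>d = u k + r\<close> with \<open>r < k \<le> u\<close> one has \<open>d = r (k + 1) + (u - r) k\<close>.
\<close>

lemma contains_large_if_consecutive:
  fixes S :: "nat set"
  assumes 0: "0 \<in> S" and add: "\<And>x y. x \<in> S \<Longrightarrow> y \<in> S \<Longrightarrow> x + y \<in> S"
    and k: "k \<in> S" "Suc k \<in> S" and d: "k * k \<le> d"
  shows "d \<in> S"
proof -
  have mul: "n * x \<in> S" if "x \<in> S" for n x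
    by (induction n) (auto simp: 0 intro: add that)
  have "(d mod k) * Suc k + (d div k - d mod k) * k = d"
  proof (cases "k = 0")
    case False
    then have "d mod k \<le> k" by simp
    also have "k \<le> d div k" using div_le_mono[OF d, of k] False by simp
    finally have "d mod k * k \<le> d div k * k" by simp
    then show ?thesis using div_mult_mod_eq[of d k] by (simp add: diff_mult_distrib)
  qed simp
  moreover have "(d mod k) * Suc k + (d div k - d mod k) * k \<in> S"
    using k by (intro add mul)
  ultimately show ?thesis by simp
qed

lemma std_sym_commute:
  assumes "b \<in> centralizer a"
  shows "std.star (std_sym a) (std_sym b) = std.star (std_sym b) (std_sym a)"
  using assms by (simp add: centralizer_def flip: std.sym_mult)

lemma std_sym_lead_commute:
  fixes a :: "'a::field_char_0 weyl"
  assumes "b \<in> centralizer a" "degree (std_sym b) = m" "degree (std_sym a) = n"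
  shows "of_nat m * pderiv (lead_coeff (std_sym a)) * lead_coeff (std_sym b) =
    of_nat n * lead_coeff (std_sym a) * pderiv (lead_coeff (std_sym b))"
  using std.commuting_lead_coeffs[OF std_sym_commute[OF assms(1)] order_refl order_refl]
  unfolding assms(2,3) by (simp only: mult.commute mult.left_commute mult.assoc)

text \<open>
  What the hypothesis on the rank is used for: one polynomial \<open>f\<close> governs all leading coefficients, and
  \<open>p\<close>, \<open>q\<close> are elements of consecutive orders.
\<close>

locale rank_one_centralizer =
  fixes a :: "'a::field_char_0 weyl" and f :: "'a poly" and n k :: nat and p q :: "'a weyl"
  assumes f: "f \<noteq> 0"
    and lead: "b \<in> centralizer a \<Longrightarrow> \<exists>c. lead_coeff (std_sym b) = smult c (f ^ degree (std_sym b))"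
    and n: "degree (std_sym a) = Suc n"
    and p: "p \<in> centralizer a" "p \<noteq> 0" "degree (std_sym p) = Suc k"
    and q: "q \<in> centralizer a" "q \<noteq> 0" "degree (std_sym q) = k"
begin

lemma lead_nonzero:
  assumes "b \<in> centralizer a" "b \<noteq> 0"
  shows "\<exists>c. c \<noteq> 0 \<and> lead_coeff (std_sym b) = smult c (f ^ degree (std_sym b))"
  using lead[OF assms(1)] assms(2) by (metis leading_coeff_0_iff smult_0_left std_sym_eq_0_iff)

end

text \<open>
  The orders form a semigroup with greatest common divisor \<open>1\<close>, so consecutive orders exist. An element
  \<open>a\<close> of order \<open>0\<close> would be a polynomial with zero derivative, because it commutes with an element of
  positive order. Then \<open>f\<close> is the \<open>n\<close>-th root of the leading coefficient of \<open>a\<close>.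
\<close>

lemma rank_one_leading_coeffs:
  fixes a :: "'a::field_char_0 weyl"
  assumes a: "a \<notin> range weyl_const" and rank: "centralizer_rank a = 1"
  shows "\<exists>f n k p q. rank_one_centralizer a f n k p q"
proof -
  let ?C = "centralizer a" and ?deg = "\<lambda>b. degree (std_sym b)" and ?lc = "\<lambda>b. lead_coeff (std_sym b)"
  define S where "S = ?deg ` (?C - {0})"
  have lc0: "?lc b \<noteq> 0" if "b \<noteq> 0" for b :: "'a weyl" using that by (simp add: std_sym_eq_0_iff)
  have deg_mult: "?deg (v * w) = ?deg v + ?deg w \<and> v * w \<noteq> 0" if "v \<noteq> 0" "w \<noteq> 0" for v w :: "'a weyl"
  proof -
    note star = std.star_top[OF order_refl order_refl, of "std_sym v" "std_sym w"]
    have "coeff (std_sym (v * w)) (?deg v + ?deg w) \<noteq> 0"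
      using star(2) lc0 that by (simp add: std.sym_mult)
    moreover have "degree (std_sym (v * w)) \<le> ?deg v + ?deg w"
      using star(1) by (simp add: std.sym_mult)
    ultimately show ?thesis using degree_eq_if_coeff[of "std_sym (v * w)"] by force
  qed
  have "S = weyl_order ` (?C - {0})"
    unfolding S_def by (intro image_cong) (auto simp: weyl_order_eq_degree)
  then have "Gcd S = 1" using rank by (simp add: centralizer_rank_def)
  moreover have "0 \<in> S" unfolding S_def
    by (rule image_eqI[of _ _ 1]) (use centralizer_subalgebra(1)[of 1 a] in auto)
  moreover have "x + y \<in> S" if xy: "x \<in> S" "y \<in> S" for x y
  proof -
    obtain v w where "v \<in> ?C" "v \<noteq> 0" "x = ?deg v" "w \<in> ?C" "w \<noteq> 0" "y = ?deg w"
      using xy by (auto simp: S_def)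
    then show ?thesis using deg_mult[of v w] centralizer_subalgebra(3)[of v a w]
      by (auto simp: S_def intro!: image_eqI[of _ _ "v * w"])
  qed
  ultimately obtain k where k: "k \<in> S" "Suc k \<in> S" using consecutive_elements_if_Gcd_eq_1[of S] by blast
  from k(2) obtain p where "Suc k = ?deg p" "p \<in> ?C - {0}" unfolding S_def by (rule imageE)
  then have p: "p \<in> ?C" "p \<noteq> 0" "?deg p = Suc k" by auto
  from k(1) obtain q where "k = ?deg q" "q \<in> ?C - {0}" unfolding S_def by (rule imageE)
  then have q: "q \<in> ?C" "q \<noteq> 0" "?deg q = k" by auto
  have "?deg a \<noteq> 0"
  proof
    assume deg: "?deg a = 0"
    then obtain u where u: "std_sym a = [:u:]" by (rule degree_eq_zeroE)
    from std_sym_lead_commute[OF p(1,3) deg] lc0[OF p(2)] have "pderiv u = 0"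
      by (simp add: u del: of_nat_Suc)
    then obtain c where "u = [:c:]" by (auto simp: pderiv_eq_0_iff elim: degree_eq_zeroE)
    then have "std_sym (a + weyl_const (- c)) = 0" by (simp add: std.sym_add std.sym_const u)
    then have "a + weyl_const (- c) = 0" by (simp add: std_sym_eq_0_iff)
    moreover have "weyl_const c + weyl_const (- c) = (0 :: 'a weyl)" by (simp flip: weyl_const_add)
    ultimately have "a = weyl_const c" by (metis add_right_imp_eq)
    with a show False by blast
  qed
  then obtain n where n: "?deg a = Suc n" by (metis not0_implies_Suc)
  have a0: "a \<noteq> 0" using a by (metis rangeI weyl_const_0)
  obtain c f where c: "c \<noteq> 0" "?lc a = smult c (f ^ Suc n)"
    by (rule common_root_extraction[OF lc0[OF a0] lc0[OF p(2)] lc0[OF q(2)] zero_less_Suc,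
        OF std_sym_lead_commute[OF p(1,3) n] std_sym_lead_commute[OF q(1,3) n]])
  have f0: "f \<noteq> 0" using c lc0[OF a0] by auto
  have "\<exists>c. ?lc b = smult c (f ^ ?deg b)" if b: "b \<in> ?C" for b
  proof (cases "b = 0")
    case False
    let ?m = "?deg b"
    obtain d where d: "d \<noteq> 0" "?lc a ^ ?m = smult d (?lc b ^ Suc n)"
      using powers_proportional[OF lc0[OF a0] lc0[OF False] std_sym_lead_commute[OF b refl n]] by blast
    have "?lc b ^ Suc n = smult (inverse d) (?lc a ^ ?m)"
      using d by simp
    also have "\<dots> = smult (inverse d * c ^ ?m) ((f ^ ?m) ^ Suc n)"
      by (simp only: c(2) smult_power smult_smult power_mult[symmetric] mult.commute)
    finally obtain c' where "?lc b = smult c' (f ^ ?m)"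
      using proportional_if_powers_proportional[of "?lc b" "f ^ ?m" "Suc n"] lc0[OF False] f0 by auto
    then show ?thesis by blast
  qed (simp add: exI[of _ 0])
  with f0 n p q have "rank_one_centralizer a f n k p q" by unfold_locales
  then show ?thesis by blast
qed

notation fls_nth (infixl "$$" 75)

section \<open>Slope filtrations over Laurent series\<close>

text \<open>
  Coefficients and lower bounds of Laurent series in units of \<open>1/s\<close>, so that rational slopes can be
  treated with integers; the coefficient at a fractional exponent is \<open>0\<close>.
\<close>

definition frac_nth :: "int \<Rightarrow> 'a::zero fls \<Rightarrow> int \<Rightarrow> 'a" where
  "frac_nth s f a = (if s dvd a then f $$ (a div s) else 0)"

definition frac_ge :: "int \<Rightarrow> int \<Rightarrow> 'a::zero fls \<Rightarrow> bool" where
  "frac_ge s a f \<longleftrightarrow> (\<forall>i. s * i < a \<longrightarrow> f $$ i = 0)"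

lemma frac_ge_subdegree: "frac_ge s a f \<Longrightarrow> f \<noteq> 0 \<Longrightarrow> a \<le> s * fls_subdegree f"
  unfolding frac_ge_def by (metis linorder_not_less nth_fls_subdegree_nonzero)

lemma frac_ge_mult:
  fixes f g :: "'a::idom fls"
  assumes "s > 0" "frac_ge s a f" "frac_ge s b g"
  shows "frac_ge s (a + b) (f * g)"
proof (cases "f = 0 \<or> g = 0")
  case False
  show ?thesis unfolding frac_ge_def
  proof (intro allI impI)
    fix i assume i: "s * i < a + b"
    have "a \<le> s * fls_subdegree f" "b \<le> s * fls_subdegree g"
      using False frac_ge_subdegree assms by blast+
    with i have "s * i < s * (fls_subdegree f + fls_subdegree g)" by (simp add: distrib_left)
    then have "i < fls_subdegree f + fls_subdegree g" using assms(1) by simp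
    then show "(f * g) $$ i = 0" by (rule fls_times_nth_eq0)
  qed
qed (auto simp: frac_ge_def)

lemma frac_nth_mult:
  fixes f g :: "'a::idom fls"
  assumes "s > 0" "frac_ge s a f" "frac_ge s b g"
  shows "frac_nth s (f * g) (a + b) = frac_nth s f a * frac_nth s g b"
proof (cases "f = 0 \<or> g = 0")
  case False
  let ?df = "fls_subdegree f" and ?dg = "fls_subdegree g"
  have le: "a \<le> s * ?df" "b \<le> s * ?dg"
    using False frac_ge_subdegree assms by blast+
  show ?thesis
  proof (cases "a = s * ?df \<and> b = s * ?dg")
    case True
    then have ab: "a + b = s * (?df + ?dg)" by (simp add: distrib_left)
    have "frac_nth s (f * g) (a + b) = (f * g) $$ (?df + ?dg)"
      unfolding ab frac_nth_def using assms(1) by simp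
    moreover have "frac_nth s f a = f $$ ?df" "frac_nth s g b = g $$ ?dg"
      using True assms(1) by (simp_all add: frac_nth_def)
    ultimately show ?thesis by (simp add: fls_times_base)
  next
    case neq: False
    have z: "frac_nth s f a = 0" if "a < s * fls_subdegree f" for f :: "'a fls" and a
      using that assms(1) by (auto simp: frac_nth_def elim!: dvdE)
    have "frac_nth s (f * g) (a + b) = 0"
    proof (rule z)
      have "fls_subdegree (f * g) = ?df + ?dg" using False by (simp add: fls_subdegree_mult)
      then show "a + b < s * fls_subdegree (f * g)"
        using neq le by (auto simp: distrib_left)
    qed
    moreover have "frac_nth s f a = 0 \<or> frac_nth s g b = 0"
      using neq le z[of a f] z[of b g] by (meson order_le_imp_less_or_eq)
    ultimately show ?thesis by auto
  qed
qed (auto simp: frac_nth_def)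

lemma frac_ge_deriv:
  fixes f :: "'a::idom fls"
  assumes "frac_ge s a f"
  shows "frac_ge s (a - s) (fls_deriv f)"
  using assms by (auto simp: frac_ge_def algebra_simps)

lemma frac_nth_deriv:
  fixes f :: "'a::idom fls"
  assumes "s > 0"
  shows "of_int s * frac_nth s (fls_deriv f) (a - s) = of_int a * frac_nth s f a"
proof (cases "s dvd a")
  case True
  then obtain k where k: "a = s * k" ..
  then have "a - s = s * (k - 1)" by (simp add: algebra_simps)
  with k assms show ?thesis by (simp add: frac_nth_def)
next
  case False
  then have "\<not> s dvd a - s" by (metis dvd_diff_commute dvd_refl dvd_diffD zdvd_zdiffD)
  with False show ?thesis by (simp add: frac_nth_def)
qed

text \<open>
  The weight of \<open>t\<^sup>i X\<^sup>j\<close> is \<open>s i - r j\<close>, which corresponds to the slope \<open>r/s\<close> of a Newton polygon.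
  \<open>weighted r s w P\<close> bounds all weights of \<open>P\<close> from below by \<open>w\<close>, and \<open>wsymbol r s w P\<close> is the part
  of weight \<open>w\<close> at \<open>t = 1\<close>.
\<close>

definition weighted :: "int \<Rightarrow> int \<Rightarrow> int \<Rightarrow> 'a::zero fls poly \<Rightarrow> bool" where
  "weighted r s w P \<longleftrightarrow> (\<forall>j. frac_ge s (w + r * int j) (coeff P j))"

definition wsymbol :: "int \<Rightarrow> int \<Rightarrow> int \<Rightarrow> 'a::comm_monoid_add fls poly \<Rightarrow> 'a poly" where
  "wsymbol r s w P = (\<Sum>j\<le>degree P. monom (frac_nth s (coeff P j) (w + r * int j)) j)"

lemma frac_nth_0 [simp]: "frac_nth s 0 a = 0"
  by (simp add: frac_nth_def)

lemma coeff_wsymbol [simp]: "coeff (wsymbol r s w P) j = frac_nth s (coeff P j) (w + r * int j)"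
proof (cases "j \<le> degree P")
  case False
  then show ?thesis by (auto simp: wsymbol_def coeff_sum coeff_eq_0 intro!: sum.neutral)
qed (simp add: wsymbol_def coeff_sum)

lemma weighted_0 [simp]: "weighted r s w 0"
  by (simp add: weighted_def frac_ge_def)

lemma weighted_add: "weighted r s w P \<Longrightarrow> weighted r s w Q \<Longrightarrow> weighted r s w (P + Q)"
  for P :: "'a::idom fls poly"
  by (simp add: weighted_def frac_ge_def)

lemma weighted_minus: "weighted r s w P \<Longrightarrow> weighted r s w (- P)"
  for P :: "'a::idom fls poly"
  by (simp add: weighted_def frac_ge_def)

lemma weighted_mono: "weighted r s w P \<Longrightarrow> w' \<le> w \<Longrightarrow> weighted r s w' P"
  by (auto simp: weighted_def frac_ge_def)

lemma weighted_pCons: "weighted r s w P \<Longrightarrow> weighted r s (w - r) (pCons 0 P)"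
  for P :: "'a::idom fls poly"
  by (auto simp: weighted_def frac_ge_def coeff_pCons algebra_simps split: nat.splits)

lemma weighted_pderiv: "weighted r s w P \<Longrightarrow> weighted r s (w + r) (pderiv P)"
  for P :: "'a::idom fls poly"
  by (auto simp: weighted_def frac_ge_def coeff_pderiv algebra_simps fls_of_nat)

lemma wsymbol_pderiv: "wsymbol r s (w + r) (pderiv P) = pderiv (wsymbol r s w P)"
  for P :: "'a::idom fls poly"
  by (rule poly_eqI) (simp add: frac_nth_def coeff_pderiv fls_of_nat algebra_simps)

lemma wsymbol_diff: "wsymbol r s w (P - Q) = wsymbol r s w P - wsymbol r s w Q"
  for P :: "'a::idom fls poly"
  by (rule poly_eqI) (simp add: frac_nth_def)

lemma wsymbol_add: "wsymbol r s w (P + Q) = wsymbol r s w P + wsymbol r s w Q"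
  for P :: "'a::idom fls poly"
  by (rule poly_eqI) (simp add: frac_nth_def)

lemma wsymbol_eq_0: "s > 0 \<Longrightarrow> weighted r s w' P \<Longrightarrow> w < w' \<Longrightarrow> wsymbol r s w P = 0"
  for P :: "'a::idom fls poly"
  by (rule poly_eqI) (auto simp: frac_nth_def weighted_def frac_ge_def elim!: dvdE)

lemma frac_ge_sum:
  fixes f :: "'b \<Rightarrow> 'a::idom fls"
  assumes "\<And>x. x \<in> A \<Longrightarrow> frac_ge s a (f x)"
  shows "frac_ge s a (sum f A)"
  using assms by (induction A rule: infinite_finite_induct) (auto simp: frac_ge_def)

lemma frac_nth_sum: "frac_nth s (sum f A) a = (\<Sum>x\<in>A. frac_nth s (f x) a)"
  for f :: "'b \<Rightarrow> 'a::idom fls"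
  by (induction A rule: infinite_finite_induct) (auto simp: frac_nth_def)

lemma weighted_mult:
  fixes P Q :: "'a::idom fls poly"
  assumes "s > 0" "weighted r s w P" "weighted r s w' Q"
  shows "weighted r s (w + w') (P * Q)"
    and "wsymbol r s (w + w') (P * Q) = wsymbol r s w P * wsymbol r s w' Q"
proof -
  have split: "w + w' + r * int j = (w + r * int i) + (w' + r * int (j - i))" if "i \<le> j" for i j
    using that by (simp add: of_nat_diff algebra_simps)
  have PQ: "frac_ge s (w + r * int i) (coeff P i)" "frac_ge s (w' + r * int i) (coeff Q i)" for i
    using assms by (auto simp: weighted_def)
  show "weighted r s (w + w') (P * Q)"
    unfolding weighted_def coeff_mult
  proof (intro allI frac_ge_sum)
    fix j i :: nat assume "i \<in> {..j}"
    then have "i \<le> j" by simp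
    then show "frac_ge s (w + w' + r * int j) (coeff P i * coeff Q (j - i))"
      unfolding split[OF \<open>i \<le> j\<close>] by (intro frac_ge_mult assms(1) PQ)
  qed
  show "wsymbol r s (w + w') (P * Q) = wsymbol r s w P * wsymbol r s w' Q"
  proof (rule poly_eqI)
    fix j
    have "frac_nth s (coeff P i * coeff Q (j - i)) (w + w' + r * int j) =
        frac_nth s (coeff P i) (w + r * int i) * frac_nth s (coeff Q (j - i)) (w' + r * int (j - i))"
      if "i \<le> j" for i
      unfolding split[OF that] by (rule frac_nth_mult[OF assms(1) PQ])
    then show "coeff (wsymbol r s (w + w') (P * Q)) j = coeff (wsymbol r s w P * wsymbol r s w' Q) j"
      by (simp add: coeff_mult frac_nth_sum)
  qed
qed

lemma weighted_smult_coeff: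
  fixes P R :: "'a::idom fls poly"
  assumes "s > 0" "weighted r s u P" "weighted r s w R"
  shows "weighted r s (w + u + r * int j) (smult (coeff P j) R)"
  unfolding weighted_def
proof
  fix l
  have "frac_ge s ((u + r * int j) + (w + r * int l)) (coeff P j * coeff R l)"
    using assms by (intro frac_ge_mult) (auto simp: weighted_def)
  then show "frac_ge s (w + u + r * int j + r * int l) (coeff (smult (coeff P j) R) l)"
    by (simp add: algebra_simps)
qed

text \<open>
  The vector field \<open>E d/dt\<close> has a zero of order \<open>e\<close> at \<open>t = 0\<close>.
\<close>

locale laurent_derivation =
  fixes E :: "'b::field_char_0 fls" and e :: int
  assumes E_lower: "\<And>i. i < e \<Longrightarrow> E $$ i = 0" and E_e: "E $$ e \<noteq> 0" and e: "e \<ge> 1"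
begin

sublocale derivation "\<lambda>f. E * fls_deriv f"
  by unfold_locales (simp_all add: algebra_simps)

text \<open>
  On a term \<open>t\<^sup>i X\<^sup>j\<close> of weight \<open>w\<close> the operator \<open>t d/dt\<close> acts as \<open>i = (w + r j)/s\<close>; an Euler
  relation thus expresses it by the derivative with respect to \<open>X\<close>.
\<close>

lemma weighted_deltas:
  assumes s: "s > 0" and P: "weighted r s w P"
  shows "weighted r s (w + s * (e - 1)) (deltas P)"
    and "smult (of_int s) (wsymbol r s (w + s * (e - 1)) (deltas P)) =
      smult (E $$ e) (of_int w * wsymbol r s w P + of_int r * pCons 0 (pderiv (wsymbol r s w P)))"
proof -
  have E: "frac_ge s (s * e) E"
    using s E_lower by (auto simp: frac_ge_def)
  have PE: "frac_ge s (w + r * int j - s) (fls_deriv (coeff P j))" for j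
    using P by (auto simp: weighted_def intro: frac_ge_deriv)
  have idx: "w + s * (e - 1) + r * int j = s * e + (w + r * int j - s)" for j
    by (simp add: algebra_simps)
  show "weighted r s (w + s * (e - 1)) (deltas P)"
    unfolding weighted_def coeff_deltas idx by (intro allI frac_ge_mult s E PE)
  show "smult (of_int s) (wsymbol r s (w + s * (e - 1)) (deltas P)) =
      smult (E $$ e) (of_int w * wsymbol r s w P + of_int r * pCons 0 (pderiv (wsymbol r s w P)))"
  proof (rule poly_eqI)
    fix j
    have "coeff (smult (of_int s) (wsymbol r s (w + s * (e - 1)) (deltas P))) j =
        of_int s * (frac_nth s E (s * e) * frac_nth s (fls_deriv (coeff P j)) (w + r * int j - s))"
      using frac_nth_mult[OF s E PE[of j]] by (simp add: idx)
    also have "frac_nth s E (s * e) = E $$ e" using s by (simp add: frac_nth_def)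
    also have "of_int s * (E $$ e * frac_nth s (fls_deriv (coeff P j)) (w + r * int j - s)) =
        E $$ e * (of_int (w + r * int j) * frac_nth s (coeff P j) (w + r * int j))"
      using frac_nth_deriv[OF s, of "coeff P j" "w + r * int j"] by (metis mult.left_commute)
    also have "\<dots> = coeff (smult (E $$ e) (of_int w * wsymbol r s w P
        + of_int r * pCons 0 (pderiv (wsymbol r s w P)))) j"
      by (cases j) (simp_all add: of_int_poly coeff_pderiv algebra_simps)
    finally show "coeff (smult (of_int s) (wsymbol r s (w + s * (e - 1)) (deltas P))) j = \<dots>" .
  qed
qed

text \<open>
  The leading parts have Poisson bracket zero. With the Euler relation the bracket becomes an
  equation in \<open>X\<close> alone, in which the terms with \<open>X A' B'\<close> cancel.
\<close>

lemma weighted_commute: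
  assumes rs: "r > 0" "s > 0" and comm: "star P Q = star Q P"
    and P: "weighted r s (- (r * int n)) P" and Q: "weighted r s (- (r * int m)) Q"
  defines "A \<equiv> wsymbol r s (- (r * int n)) P" and "B \<equiv> wsymbol r s (- (r * int m)) Q"
  shows "of_nat m * pderiv A * B = of_nat n * A * pderiv B"
proof -
  let ?wP = "- (r * int n)" and ?wQ = "- (r * int m)" and ?t = "s * (e - 1)"
  let ?c = "pderiv Q * deltas P - pderiv P * deltas Q"
  have t: "?t \<ge> 0" using rs e by simp
  have "weighted r s (?wP + ?wQ + 2 * (r + ?t)) ?c"
    by (rule commutator_expand[where V = "weighted r s"])
      (use rs t comm P Q in \<open>auto intro: weighted_add weighted_minus weighted_mono weighted_pCons
        weighted_deltas(1) weighted_smult_coeff\<close>)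
  then have "wsymbol r s (?wP + ?wQ + (r + ?t)) ?c = 0"
    by (rule wsymbol_eq_0[rotated]) (use rs t in auto)
  moreover have "wsymbol r s (?wP + ?wQ + (r + ?t)) (pderiv Q * deltas P) =
      pderiv B * wsymbol r s (?wP + ?t) (deltas P)"
    unfolding B_def wsymbol_pderiv[symmetric]
    using weighted_mult(2)[OF rs(2) weighted_pderiv[OF Q] weighted_deltas(1)[OF rs(2) P]]
    by (metis (no_types, lifting) add.commute add.left_commute)
  moreover have "wsymbol r s (?wP + ?wQ + (r + ?t)) (pderiv P * deltas Q) =
      pderiv A * wsymbol r s (?wQ + ?t) (deltas Q)"
    unfolding A_def wsymbol_pderiv[symmetric]
    using weighted_mult(2)[OF rs(2) weighted_pderiv[OF P] weighted_deltas(1)[OF rs(2) Q]]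
    by (metis (no_types, lifting) add.commute add.left_commute)
  ultimately have "pderiv B * wsymbol r s (?wP + ?t) (deltas P) =
      pderiv A * wsymbol r s (?wQ + ?t) (deltas Q)"
    by (simp add: wsymbol_diff)
  then have "pderiv B * smult (of_int s) (wsymbol r s (?wP + ?t) (deltas P)) =
      pderiv A * smult (of_int s) (wsymbol r s (?wQ + ?t) (deltas Q))" by simp
  then have "smult (E $$ e) (pderiv B * (of_int ?wP * A + of_int r * pCons 0 (pderiv A))) =
      smult (E $$ e) (pderiv A * (of_int ?wQ * B + of_int r * pCons 0 (pderiv B)))"
    unfolding weighted_deltas(2)[OF rs(2) P] weighted_deltas(2)[OF rs(2) Q] A_def B_def by simp
  then have "pderiv B * (of_int ?wP * A + of_int r * pCons 0 (pderiv A)) =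
      pderiv A * (of_int ?wQ * B + of_int r * pCons 0 (pderiv B))"
    using E_e by (metis smult_eq_iff[THEN iffD1] smult_1_left left_inverse smult_smult)
  then have "of_int r * (of_nat m * pderiv A * B - of_nat n * A * pderiv B) = 0"
    by (simp add: algebra_simps)
  moreover have "of_int r \<noteq> (0 :: 'b poly)" using rs(1) by simp
  ultimately show ?thesis by simp
qed

end

context laurent_derivation
begin

text \<open>
  The new slope is the largest quotient \<open>v\<^sub>j/(m - j)\<close>, where \<open>v\<^sub>j\<close> is the pole order of the \<open>j\<close>-th
  coefficient: it is the slope of the edge of the Newton polygon at the vertex of the leading term.
\<close>

lemma larger_slope_exists:
  assumes rs: "r \<ge> 0" "s > 0" and Q: "degree Q \<le> m" "coeff Q m = fls_const \<beta>"
    and not: "\<not> weighted r s (- (r * int m)) Q"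
  obtains r' s' j where "r' > 0" "s' > 0" "r * s' < r' * s"
    "weighted r' s' (- (r' * int m)) Q"
    "j < m" "coeff (wsymbol r' s' (- (r' * int m)) Q) j \<noteq> 0"
proof -
  define J where "J = {j. j < m \<and> coeff Q j \<noteq> 0}"
  define v where "v j = - fls_subdegree (coeff Q j)" for j
  define \<mu> :: "nat \<Rightarrow> rat" where "\<mu> j = of_int (v j) / of_int (int m - int j)" for j
  have top: "frac_ge s' 0 (coeff Q m)" if "s' > 0" for s'
    using that by (auto simp: Q frac_ge_def mult_less_0_iff)
  from not obtain j0 i where i: "s * i < - (r * int m) + r * int j0" "coeff Q j0 $$ i \<noteq> 0"
    by (auto simp: weighted_def frac_ge_def)
  have "j0 \<noteq> m"
  proof
    assume "j0 = m"
    with i(1) have "s * i < 0" by simp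
    with top[OF rs(2)] have "coeff Q m $$ i = 0" unfolding frac_ge_def by blast
    with i(2) \<open>j0 = m\<close> show False by simp
  qed
  moreover have "coeff Q j0 \<noteq> 0" using i(2) by auto
  then have "j0 \<le> m" by (rule le_trans[OF le_degree Q(1)])
  ultimately have j0: "j0 \<in> J" using i(2) by (auto simp: J_def)
  have "finite J" by (simp add: J_def)
  with j0 have "Max (\<mu> ` J) \<in> \<mu> ` J" by (intro Max_in) auto
  then obtain j where j: "j \<in> J" and "Max (\<mu> ` J) = \<mu> j" by blast
  with \<open>finite J\<close> have max: "\<mu> l \<le> \<mu> j" if "l \<in> J" for l
    using that by (metis Max_ge finite_imageI imageI)
  define r' where "r' = v j"
  define s' where "s' = int m - int j"
  have s': "s' > 0" using j by (simp add: s'_def J_def)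
  have cmp: "v l * s' \<le> r' * (int m - int l)" if "l \<in> J" for l
  proof -
    have pos: "(of_int (int m - int l) :: rat) > 0" "(of_int s' :: rat) > 0"
      using that s' by (auto simp: J_def)
    have "(of_int (v l) :: rat) / of_int (int m - int l) \<le> of_int r' / of_int s'"
      using max[OF that] by (simp add: \<mu>_def r'_def s'_def)
    then have "(of_int (v l) :: rat) * of_int s' \<le> of_int r' * of_int (int m - int l)"
      using pos by (simp add: frac_le_eq divide_le_eq pos_le_divide_eq mult.commute)
    then show ?thesis by (metis of_int_le_iff of_int_mult)
  qed
  have "fls_subdegree (coeff Q j0) \<le> i" using i(2) by (rule fls_subdegree_leI)
  then have "s * (- v j0) \<le> s * i" using rs(2) by (simp add: v_def)
  with i(1) have gt: "r * (int m - int j0) < s * v j0" by (simp add: algebra_simps)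
  \<comment> \<open>The offending term at \<open>j0\<close> is steeper than \<open>r/s\<close>, so the maximal slope is as well.\<close>
  have jm: "int m - int j0 > 0" using j0 by (simp add: J_def)
  have slope: "r * s' < r' * s"
  proof -
    have "(r * s') * (int m - int j0) < s * v j0 * s'"
      using gt s' by (metis mult.assoc mult.commute mult_strict_right_mono)
    also have "\<dots> = s * (v j0 * s')" by simp
    also have "\<dots> \<le> s * (r' * (int m - int j0))" using cmp[OF j0] rs(2) by simp
    finally have "(r * s') * (int m - int j0) < (r' * s) * (int m - int j0)" by (simp add: ac_simps)
    then show ?thesis using jm by simp
  qed
  then have "r' * s > 0" using rs s' by (smt (verit) mult_nonneg_nonneg)
  then have r': "r' > 0" using rs(2) by (simp add: zero_less_mult_iff)
  have "weighted r' s' (- (r' * int m)) Q"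
    unfolding weighted_def frac_ge_def
  proof (intro allI impI)
    fix l k assume less: "s' * k < - (r' * int m) + r' * int l"
    show "coeff Q l $$ k = 0"
    proof (cases l m rule: linorder_cases)
      case less': less
      show ?thesis
      proof (rule ccontr)
        assume nz: "coeff Q l $$ k \<noteq> 0"
        then have "l \<in> J" using less' by (auto simp: J_def)
        from cmp[OF this] have "v l * s' \<le> r' * (int m - int l)" .
        moreover have "- v l \<le> k" using nz by (simp add: v_def fls_subdegree_leI)
        then have "s' * (- v l) \<le> s' * k" by (rule mult_left_mono) (use s' in simp)
        ultimately show False using less by (simp add: algebra_simps)
      qed
    next
      case equal
      then show ?thesis using less top[OF s'] by (auto simp: frac_ge_def)
    qed (use Q(1) in \<open>simp add: coeff_eq_0\<close>)
  qed
  moreover have "coeff (wsymbol r' s' (- (r' * int m)) Q) j \<noteq> 0"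
  proof -
    have e: "- (r' * int m) + r' * int j = s' * (- r')" by (simp add: s'_def algebra_simps)
    have "coeff Q j \<noteq> 0" using j by (simp add: J_def)
    then have "coeff Q j $$ (- r') \<noteq> 0" by (simp add: r'_def v_def nth_fls_subdegree_nonzero)
    moreover have "s' * (- r') div s' = - r'" using s' by (intro nonzero_mult_div_cancel_left) auto
    ultimately show ?thesis unfolding coeff_wsymbol e frac_nth_def by simp
  qed
  moreover have "j < m" using j by (simp add: J_def)
  ultimately show ?thesis using that r' s' slope by blast
qed

text \<open>
  A line through the vertex of the leading term that is steeper than the Newton polygon touches it
  only in that vertex.
\<close>

lemma wsymbol_larger_slope:
  assumes rs: "s > 0" "s' > 0" "r * s' < r' * s"
    and P: "degree P \<le> n" "coeff P n = fls_const \<alpha>" and w: "weighted r s (- (r * int n)) P"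
  shows "weighted r' s' (- (r' * int n)) P" and "wsymbol r' s' (- (r' * int n)) P = monom \<alpha> n"
proof -
  have key: "s' * i > - (r' * int n) + r' * int j" if nz: "coeff P j $$ i \<noteq> 0" and jn: "j < n" for i j
  proof -
    have "s * i \<ge> - (r * int n) + r * int j"
      using w nz by (auto simp: weighted_def frac_ge_def not_less[symmetric])
    then have "- (r * (int n - int j)) \<le> s * i" by (simp add: algebra_simps)
    then have "s' * (- (r * (int n - int j))) \<le> s' * (s * i)" by (rule mult_left_mono) (use rs in simp)
    moreover have "(r * s') * (int n - int j) < (r' * s) * (int n - int j)"
      using rs(3) jn by simp
    ultimately have "s * (- (r' * (int n - int j))) < s * (s' * i)" by (simp add: algebra_simps)
    then have "- (r' * (int n - int j)) < s' * i" using rs(1) by (rule mult_less_cancel_left_pos[THEN iffD1, rotated])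
    then show ?thesis by (simp add: algebra_simps)
  qed
  have z: "coeff P j = 0" if "n < j" for j using that P(1) by (simp add: coeff_eq_0)
  show "weighted r' s' (- (r' * int n)) P"
    unfolding weighted_def frac_ge_def
  proof (intro allI impI)
    fix j i assume less: "s' * i < - (r' * int n) + r' * int j"
    show "coeff P j $$ i = 0"
    proof (cases j n rule: linorder_cases)
      case less': less
      show ?thesis using key[OF _ less'] less by (metis not_less_iff_gr_or_eq)
    next
      case equal
      with less rs(2) have "i < 0" by (simp add: mult_less_0_iff)
      with equal P(2) show ?thesis by simp
    qed (simp add: z)
  qed
  show "wsymbol r' s' (- (r' * int n)) P = monom \<alpha> n"
  proof (rule poly_eqI)
    fix j
    show "coeff (wsymbol r' s' (- (r' * int n)) P) j = coeff (monom \<alpha> n) j"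
    proof (cases j n rule: linorder_cases)
      case less
      then show ?thesis
        using key[OF _ less] rs(2) by (force simp: frac_nth_def elim!: dvdE)
    qed (use P(2) z in \<open>auto simp: frac_nth_def\<close>)
  qed
qed

text \<open>
  Otherwise there is a slope at which the leading form of \<open>P\<close> is the monomial \<open>\<alpha> X\<^sup>n\<close> while that of \<open>Q\<close>
  is not a monomial; but the two have proportional powers.
\<close>

lemma commuting_inherits_weight:
  assumes rs: "r \<ge> 0" "s > 0" and comm: "star P Q = star Q P"
    and P: "degree P \<le> n" "coeff P n = fls_const \<alpha>" "\<alpha> \<noteq> 0" "n > 0"
    and Q: "degree Q \<le> m" "coeff Q m = fls_const \<beta>"
    and w: "weighted r s (- (r * int n)) P"
  shows "weighted r s (- (r * int m)) Q"
proof (rule ccontr)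
  assume "\<not> ?thesis"
  from larger_slope_exists[OF rs Q(1,2) this] obtain r' s' j where
    r': "r' > 0" "s' > 0" "r * s' < r' * s" and wQ: "weighted r' s' (- (r' * int m)) Q"
    and j: "j < m" "coeff (wsymbol r' s' (- (r' * int m)) Q) j \<noteq> 0" by metis
  let ?B = "wsymbol r' s' (- (r' * int m)) Q"
  note wP = wsymbol_larger_slope[OF rs(2) r'(2,3) P(1,2) w]
  have B: "?B \<noteq> 0" using j(2) by (metis coeff_0)
  have "of_nat m * pderiv (monom \<alpha> n) * ?B = of_nat n * monom \<alpha> n * pderiv ?B"
    using weighted_commute[OF r'(1,2) comm wP(1) wQ] by (simp only: wP(2))
  then obtain c where "c \<noteq> 0" "monom \<alpha> n ^ m = smult c (?B ^ n)"
    using powers_proportional[of "monom \<alpha> n" ?B m n] P(3) B by auto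
  then have "?B ^ n = smult (\<alpha> ^ m / c) (monom 1 m ^ n)"
    by (metis (no_types, opaque_lifting) divide_inverse_commute left_inverse monom_power mult.commute
        mult.right_neutral power_one smult_1_left smult_monom smult_smult)
  then obtain c' where "?B = smult c' (monom 1 m)"
    using proportional_if_powers_proportional[of ?B "monom 1 m" n] B P(4) by auto
  then show False using j by simp
qed

text \<open>
  At a positive slope of \<open>P\<close> the leading form is \<open>c R\<^sup>n\<close> by \<open>common_root_extraction\<close>, so \<open>R\<close> is linear.
  The missing subleading coefficient makes \<open>R\<close> a multiple of \<open>X\<close>, hence the leading form a monomial, in
  contradiction to the choice of the slope.
\<close>

lemma regular_if_normalised:
  assumes P: "degree P \<le> Suc n" "coeff P (Suc n) = fls_const \<alpha>" "\<alpha> \<noteq> 0" and norm: "coeff P n = 0"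
    and Q1: "star P Q1 = star Q1 P" "degree Q1 \<le> Suc k" "coeff Q1 (Suc k) = fls_const \<beta>1" "\<beta>1 \<noteq> 0"
    and Q0: "star P Q0 = star Q0 P" "degree Q0 \<le> k" "coeff Q0 k = fls_const \<beta>0" "\<beta>0 \<noteq> 0"
  shows "weighted 0 1 0 P"
proof (rule ccontr)
  let ?n = "Suc n"
  assume "\<not> ?thesis"
  then have "\<not> weighted 0 1 (- (0 * int ?n)) P" by simp
  from larger_slope_exists[OF order_refl zero_less_one P(1,2) this] obtain r s j where
    rs: "r > 0" "s > 0" and wP: "weighted r s (- (r * int ?n)) P"
    and j: "j < ?n" "coeff (wsymbol r s (- (r * int ?n)) P) j \<noteq> 0" by metis
  define A where "A = wsymbol r s (- (r * int ?n)) P"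
  have wQ1: "weighted r s (- (r * int (Suc k))) Q1"
    using commuting_inherits_weight[OF _ rs(2) Q1(1) P _ Q1(2,3) wP] rs by simp
  have wQ0: "weighted r s (- (r * int k)) Q0"
    using commuting_inherits_weight[OF _ rs(2) Q0(1) P _ Q0(2,3) wP] rs by simp
  have nz: "wsymbol r s (- (r * int l)) Q \<noteq> 0" if "coeff Q l = fls_const \<beta>" "\<beta> \<noteq> 0" for Q l \<beta>
  proof -
    have "coeff (wsymbol r s (- (r * int l)) Q) l = \<beta>"
      using that by (simp add: frac_nth_def)
    with that(2) show ?thesis by (metis coeff_0)
  qed
  have top: "coeff A ?n = \<alpha>" using P(2) by (simp add: A_def frac_nth_def)
  have A: "A \<noteq> 0" using top P(3) by auto
  obtain c R where c: "c \<noteq> 0" "A = smult c (R ^ ?n)"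
    by (rule common_root_extraction[OF A nz[OF Q1(3,4)] nz[OF Q0(3,4)] zero_less_Suc,
          OF weighted_commute[OF rs Q1(1) wP wQ1, folded A_def]
            weighted_commute[OF rs Q0(1) wP wQ0, folded A_def]])
  have "degree A = ?n"
  proof (rule antisym)
    show "degree A \<le> ?n" unfolding A_def
      using P(1) by (intro degree_le) (simp add: coeff_eq_0)
    show "?n \<le> degree A" using top P(3) by (intro le_degree) simp
  qed
  moreover have "R \<noteq> 0" using A c by auto
  ultimately have "Suc n * degree R = Suc n * 1" using c by (simp add: degree_power_eq del: power_Suc)
  then have "degree R = 1" by (metis mult_cancel1 nat.distinct(1))
  then obtain a b where R: "R = [:a, b:]" "b \<noteq> 0"
    by (metis One_nat_def degree_pCons_eq_if degree_eq_zeroE nat.inject pCons_cases zero_neq_one pCons_eq_0_iff)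
  have "R = smult b [:a / b, 1:]" using R by simp
  then have A': "A = smult (c * b ^ ?n) ([:a / b, 1:] ^ ?n)"
    unfolding c(2) by (subst \<open>R = smult b _\<close>) (simp only: smult_power smult_smult)
  have "coeff A n = 0" using norm by (simp add: A_def)
  then have "c * b ^ ?n * (of_nat ?n * (a / b)) = 0"
    unfolding A' coeff_smult coeff_linear_power_pred .
  then have "a = 0" using R(2) c(1) by (simp del: of_nat_Suc)
  then have "A = monom (c * b ^ ?n) ?n"
    using A' by (simp add: monom_altdef del: power_Suc)
  then have "coeff A j = 0" using j(1) by (simp del: power_Suc)
  with j(2) show False unfolding A_def by metis
qed

text \<open>
  \<open>wsymbol 0 1 0\<close> puts \<open>t = 0\<close> in the coefficients. It is multiplicative on regular symbols because
  \<open>\<delta>\<close> maps power series to multiples of \<open>t\<close>.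
\<close>

lemma wsymbol_0_star:
  assumes P: "weighted 0 1 0 P" and Q: "weighted 0 1 0 Q"
  shows "wsymbol 0 1 0 (star P Q) = wsymbol 0 1 0 P * wsymbol 0 1 0 Q"
proof -
  have d: "weighted 0 1 1 (deltas R)" if "weighted 0 1 0 R" for R
  proof -
    have "frac_ge 1 1 (E * fls_deriv (coeff R j))" for j
    proof -
      have "frac_ge 1 0 (coeff R j)" using that by (simp add: weighted_def)
      then have "fls_deriv (coeff R j) $$ i = 0" if "i < 0" for i
        using that by (cases "i = -1") (auto simp: frac_ge_def)
      then have "frac_ge 1 0 (fls_deriv (coeff R j))" by (simp add: frac_ge_def)
      moreover have "frac_ge 1 e E" using E_lower by (simp add: frac_ge_def)
      ultimately have "frac_ge 1 (e + 0) (E * fls_deriv (coeff R j))" by (intro frac_ge_mult) auto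
      then show ?thesis using e by (auto simp: frac_ge_def)
    qed
    then show ?thesis by (simp add: weighted_def)
  qed
  have D: "weighted 0 1 0 (D R)" "wsymbol 0 1 0 (D R) = pCons 0 (wsymbol 0 1 0 R)"
    if R: "weighted 0 1 0 R" for R
  proof -
    have "weighted 0 1 0 (pCons 0 R)" using weighted_pCons[OF R] by simp
    moreover have "weighted 0 1 0 (deltas R)" by (rule weighted_mono[OF d[OF R]]) simp
    ultimately show "weighted 0 1 0 (D R)" by (simp add: D_def weighted_add)
    have "wsymbol 0 1 0 (deltas R) = 0" by (rule wsymbol_eq_0[OF _ d[OF R]]) auto
    moreover have "wsymbol 0 1 0 (pCons 0 R) = pCons 0 (wsymbol 0 1 0 R)"
      by (rule poly_eqI) (simp add: coeff_pCons split: nat.splits)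
    ultimately show "wsymbol 0 1 0 (D R) = pCons 0 (wsymbol 0 1 0 R)"
      by (simp add: D_def wsymbol_add)
  qed
  have "weighted 0 1 0 ((D ^^ j) Q) \<and> wsymbol 0 1 0 ((D ^^ j) Q) = monom 1 j * wsymbol 0 1 0 Q" for j
    by (induction j) (auto simp: Q D monom_Suc)
  then have Dj: "weighted 0 1 0 ((D ^^ j) Q)" "wsymbol 0 1 0 ((D ^^ j) Q) = monom 1 j * wsymbol 0 1 0 Q" for j
    by auto
  have c: "wsymbol 0 1 0 (smult (coeff P j) R) = smult (coeff (wsymbol 0 1 0 P) j) (wsymbol 0 1 0 R)"
    if "weighted 0 1 0 R" for R j
  proof (rule poly_eqI)
    fix i
    have "frac_nth 1 (coeff P j * coeff R i) (0 + 0) = frac_nth 1 (coeff P j) 0 * frac_nth 1 (coeff R i) 0"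
      using P that by (intro frac_nth_mult) (auto simp: weighted_def)
    then show "coeff (wsymbol 0 1 0 (smult (coeff P j) R)) i =
        coeff (smult (coeff (wsymbol 0 1 0 P) j) (wsymbol 0 1 0 R)) i" by simp
  qed
  have sum: "wsymbol 0 1 0 (sum F A) = (\<Sum>x\<in>A. wsymbol 0 1 0 (F x))" for F :: "nat \<Rightarrow> 'b fls poly" and A
    by (rule poly_eqI) (simp add: coeff_sum frac_nth_sum)
  have deg: "degree (wsymbol 0 1 0 P) \<le> degree P"
    by (intro degree_le) (simp add: coeff_eq_0)
  have "wsymbol 0 1 0 (star P Q) =
      (\<Sum>j\<le>degree P. smult (coeff (wsymbol 0 1 0 P) j) (monom 1 j)) * wsymbol 0 1 0 Q"
    unfolding star_def sum c[OF Dj(1)] Dj(2) by (simp add: sum_distrib_right)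
  also have "(\<Sum>j\<le>degree P. smult (coeff (wsymbol 0 1 0 P) j) (monom 1 j)) = wsymbol 0 1 0 P"
    using deg by (simp only: smult_monom mult_1_right poly_as_sum_of_monoms')
  finally show ?thesis .
qed

end

section \<open>Fields of definition\<close>

definition is_subfield :: "'a::field set \<Rightarrow> bool" where
  "is_subfield S \<longleftrightarrow> 1 \<in> S \<and> (\<forall>x\<in>S. \<forall>y\<in>S. x - y \<in> S \<and> x * y \<in> S \<and> inverse x \<in> S)"

lemma is_subfieldD:
  assumes "is_subfield S"
  shows "1 \<in> S" "0 \<in> S" "x \<in> S \<Longrightarrow> - x \<in> S" "x \<in> S \<Longrightarrow> y \<in> S \<Longrightarrow> x + y \<in> S"
    "x \<in> S \<Longrightarrow> y \<in> S \<Longrightarrow> x - y \<in> S" "x \<in> S \<Longrightarrow> y \<in> S \<Longrightarrow> x * y \<in> S"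
    "x \<in> S \<Longrightarrow> inverse x \<in> S" "x \<in> S \<Longrightarrow> y \<in> S \<Longrightarrow> x / y \<in> S" "of_nat n \<in> S" "of_int k \<in> S"
    "x \<in> S \<Longrightarrow> x ^ n \<in> S" "(\<And>z. z \<in> A \<Longrightarrow> F z \<in> S) \<Longrightarrow> sum F A \<in> S"
proof -
  have S: "1 \<in> S" "\<And>x y. x \<in> S \<Longrightarrow> y \<in> S \<Longrightarrow> x - y \<in> S" "\<And>x y. x \<in> S \<Longrightarrow> y \<in> S \<Longrightarrow> x * y \<in> S"
    "\<And>x. x \<in> S \<Longrightarrow> inverse x \<in> S"
    using assms by (auto simp: is_subfield_def)
  have zero: "0 \<in> S" using S(2)[OF S(1) S(1)] by simp
  have minus: "- x \<in> S" if "x \<in> S" for x using S(2)[OF zero that] by simp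
  have add: "x + y \<in> S" if "x \<in> S" "y \<in> S" for x y using S(2)[OF that(1) minus[OF that(2)]] by simp
  have nat: "of_nat n \<in> S" for n by (induction n) (auto simp: S zero add)
  show "of_int k \<in> S" by (cases k) (auto simp: nat minus simp del: of_nat_Suc)
  show "1 \<in> S" "0 \<in> S" "of_nat n \<in> S" by (fact S zero nat)+
  show "x \<in> S \<Longrightarrow> - x \<in> S" "x \<in> S \<Longrightarrow> y \<in> S \<Longrightarrow> x + y \<in> S" "x \<in> S \<Longrightarrow> y \<in> S \<Longrightarrow> x - y \<in> S"
    "x \<in> S \<Longrightarrow> y \<in> S \<Longrightarrow> x * y \<in> S" "x \<in> S \<Longrightarrow> inverse x \<in> S"
    by (fact minus add S)+
  show "x \<in> S \<Longrightarrow> y \<in> S \<Longrightarrow> x / y \<in> S" by (simp add: divide_inverse S)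
  show "x \<in> S \<Longrightarrow> x ^ n \<in> S" by (induction n) (auto simp: S)
  show "(\<And>z. z \<in> A \<Longrightarrow> F z \<in> S) \<Longrightarrow> sum F A \<in> S"
    by (induction A rule: infinite_finite_induct) (auto simp: zero add)
qed

text \<open>
  The coefficients of an inverse are determined recursively, dividing only by the lowest coefficient.
\<close>

lemma is_subfield_fls:
  assumes S: "is_subfield S"
  shows "is_subfield {u :: 'a::field fls. \<forall>i. u $$ i \<in> S}"
proof -
  note S' = is_subfieldD[OF S]
  have inv: "inverse u $$ k \<in> S" if u: "\<And>i. u $$ i \<in> S" for u :: "'a fls" and k
  proof (cases "u = 0")
    case False
    define v where "v = inverse u"
    let ?d = "fls_subdegree u"
    have uv: "u * v = 1" using False by (simp add: v_def)
    have v0: "v $$ k = 0" if "k < - ?d" for k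
      using that by (simp add: v_def fls_inverse_subdegree)
    have "v $$ (int m - ?d) \<in> S" for m
    proof (induction m rule: less_induct)
      case (less m)
      have sd: "fls_subdegree v = - ?d" by (simp add: v_def fls_inverse_subdegree)
      have "(u * v) $$ int m = (\<Sum>i=0..int m. u $$ (?d + i) * v $$ (int m - ?d - i))"
        using fls_times_nth(4)[of u v "int m"] by (simp add: sd)
      also have "\<dots> = u $$ ?d * v $$ (int m - ?d) + (\<Sum>i\<in>{0<..int m}. u $$ (?d + i) * v $$ (int m - ?d - i))"
        by (subst sum.remove[of _ 0]) (auto intro!: sum.cong)
      finally have eq: "u $$ ?d * v $$ (int m - ?d) =
          (if m = 0 then 1 else 0) - (\<Sum>i\<in>{0<..int m}. u $$ (?d + i) * v $$ (int m - ?d - i))"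
        by (simp add: uv algebra_simps)
      have "v $$ (int m - ?d - i) \<in> S" if "i \<in> {0<..int m}" for i
      proof -
        have "nat (int m - i) < m" and m': "int (nat (int m - i)) = int m - i" using that by auto
        from less[OF this(1)] show ?thesis unfolding m' by (simp add: algebra_simps)
      qed
      then have "u $$ ?d * v $$ (int m - ?d) \<in> S"
        unfolding eq by (intro S') (auto intro: S' u)
      then have "inverse (u $$ ?d) * (u $$ ?d * v $$ (int m - ?d)) \<in> S" by (rule S'(6)[OF S'(7)[OF u]])
      moreover have "inverse (u $$ ?d) * (u $$ ?d * v $$ (int m - ?d)) = v $$ (int m - ?d)"
        using nth_fls_subdegree_nonzero[OF False] by (simp add: mult.assoc[symmetric])
      ultimately show ?case by metis
    qed
    from this[of "nat (k + ?d)"] v0[of k] show ?thesis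
      by (cases "k < - ?d") (auto simp: v_def S')
  qed (simp add: S')
  have "(u * v) $$ n \<in> S" if "\<And>i. u $$ i \<in> S" "\<And>i. v $$ i \<in> S" for u v :: "'a fls" and n
    unfolding fls_times_nth(2) by (intro S' that)
  then show ?thesis using inv by (auto simp: is_subfield_def S')
qed

context weyl_symbol
begin

lemma coeff_sym_closed:
  assumes zero: "0 \<in> T" and one: "1 \<in> T" and add: "\<And>x y. x \<in> T \<Longrightarrow> y \<in> T \<Longrightarrow> x + y \<in> T"
    and mult: "\<And>x y. x \<in> T \<Longrightarrow> y \<in> T \<Longrightarrow> x * y \<in> T" and \<delta>: "\<And>x. x \<in> T \<Longrightarrow> \<delta> x \<in> T"
    and \<iota>: "\<And>c. \<iota> c \<in> T" and gens: "\<xi> \<in> T" "g \<in> T" "h \<in> T"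
  shows "coeff (sym w) i \<in> T"
proof -
  let ?P = "\<lambda>P. \<forall>i. coeff P i \<in> T"
  have D: "?P (D Q)" if "?P Q" for Q
    using that zero by (auto simp: D_def coeff_pCons intro!: add \<delta> split: nat.splits)
  have "?P (expr_sym e P)" if "?P P" for e P
    using that
  proof (induction e arbitrary: P)
    case GenD
    with D show ?case by (auto simp: G_def intro!: add mult gens)
  qed (auto intro!: add mult gens \<iota>)
  from this[of 1 "rep_weyl w"] show ?thesis
    using zero one by (simp add: sym_def)
qed

end

section \<open>Evaluation of symbols at a singular point\<close>

context rank_one_centralizer
begin

text \<open>
  \<open>\<xi>\<close> is the coordinate \<open>x\<close> near a zero of the vector field \<open>f \<partial> = E d/dt\<close>. The last
  conclusion records a field of definition of the embedding, which is needed for the descent to \<open>K\<close>.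
\<close>

lemma local_embedding:
  fixes \<iota> :: "'a \<Rightarrow> 'b::field_char_0" and E \<xi> :: "'b fls"
  assumes iota: "\<And>c d. \<iota> (c + d) = \<iota> c + \<iota> d" "\<And>c d. \<iota> (c * d) = \<iota> c * \<iota> d" "\<iota> 1 = 1"
    and E: "laurent_derivation E e"
    and xi: "E * fls_deriv \<xi> = poly (map_poly (\<lambda>c. fls_const (\<iota> c)) f) \<xi>"
    and fxi: "poly (map_poly (\<lambda>c. fls_const (\<iota> c)) f) \<xi> \<noteq> 0"
  obtains \<phi> :: "'a weyl \<Rightarrow> 'b poly" where
    "\<phi> 1 = 1" "\<And>v w. \<phi> (v + w) = \<phi> v + \<phi> w"
    "\<And>v w. v \<in> centralizer a \<Longrightarrow> w \<in> centralizer a \<Longrightarrow> \<phi> (v * w) = \<phi> v * \<phi> w"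
    "\<And>c v. \<phi> (weyl_const c * v) = smult (\<iota> c) (\<phi> v)"
    "\<And>b c. b \<in> centralizer a \<Longrightarrow> b \<noteq> 0 \<Longrightarrow> lead_coeff (std_sym b) = smult c (f ^ degree (std_sym b)) \<Longrightarrow>
       degree (\<phi> b) = degree (std_sym b) \<and> lead_coeff (\<phi> b) = \<iota> c"
    "coeff (\<phi> a) n = 0"
    "\<And>S b i. is_subfield S \<Longrightarrow> range \<iota> \<subseteq> S \<Longrightarrow> (\<And>i. E $$ i \<in> S) \<Longrightarrow> (\<And>i. \<xi> $$ i \<in> S) \<Longrightarrow>
       coeff (\<phi> b) i \<in> S"
proof -
  interpret laurent_derivation E e by (rule E)
  define ev where "ev p = poly (map_poly (\<lambda>c. fls_const (\<iota> c)) p) \<xi>" for p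
  define g where "g = inverse (ev f)"
  have g: "g * ev f = 1" using fxi by (simp add: g_def ev_def)
  have ws: "weyl_symbol (\<lambda>f. E * fls_deriv f) (\<lambda>c. fls_const (\<iota> c)) \<xi> g"
    by unfold_locales (use iota g xi in \<open>simp_all add: ev_def fls_plus_const\<close>)
  interpret s0: weyl_symbol "\<lambda>f. E * fls_deriv f" "\<lambda>c. fls_const (\<iota> c)" \<xi> g 0 by (rule ws)
  have ev: "s0.ev = ev" by (simp add: fun_eq_iff s0.ev_def ev_def)
  have inj: "\<iota> c \<noteq> 0" if "c \<noteq> 0" for c
    using iota(2)[of c "inverse c"] that iota(3) by auto
  obtain ca where ca: "lead_coeff (std_sym a) = smult ca (f ^ Suc n)"
    using lead[of a] n by (auto simp: centralizer_def)
  have ca0: "ca \<noteq> 0"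
  proof
    assume "ca = 0"
    with ca have "std_sym a = 0" by simp
    with n show False by simp
  qed
  \<comment> \<open>The subleading coefficient is affine in \<open>h\<close>; this value makes it vanish.\<close>
  define h where "h = - coeff (s0.sym a) n * g / (of_nat (Suc n) * fls_const (\<iota> ca))"
  interpret s: weyl_symbol "\<lambda>f. E * fls_deriv f" "\<lambda>c. fls_const (\<iota> c)" \<xi> g h by (rule ws)
  have evs: "s.ev = ev" by (simp add: fun_eq_iff s.ev_def ev_def)
  define C where "C = centralizer a"
  have top: "degree (s.sym b) \<le> degree (std_sym b)" "coeff (s.sym b) (degree (std_sym b)) = fls_const (\<iota> c)"
    if "lead_coeff (std_sym b) = smult c (f ^ degree (std_sym b))" for b c
  proof -
    show "degree (s.sym b) \<le> degree (std_sym b)" by (rule s.degree_sym_le)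
    have "coeff (s.sym b) (degree (std_sym b)) = fls_const (\<iota> c) * (ev f * g) ^ degree (std_sym b)"
      by (subst s.coeff_sym_top[OF order_refl])
        (simp add: that s.ev_smult s.ev_power power_mult_distrib flip: evs)
    then show "coeff (s.sym b) (degree (std_sym b)) = fls_const (\<iota> c)" using g by (simp add: mult.commute)
  qed
  have a_top: "degree (s.sym a) \<le> Suc n" "coeff (s.sym a) (Suc n) = fls_const (\<iota> ca)"
    using top[of a ca] ca n by auto
  have norm: "coeff (s.sym a) n = 0"
  proof -
    have "coeff (s.sym a) n = coeff (s0.sym a) n + ev (coeff (std_sym a) (Suc n)) * (of_nat (Suc n) * g ^ n * h)"
      using s.coeff_sym_pred[of a n] s0.coeff_sym_pred[of a n] n
      by (simp add: ev evs algebra_simps del: of_nat_Suc)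
    also have "ev (coeff (std_sym a) (Suc n)) = fls_const (\<iota> ca) * ev f ^ Suc n"
      using ca n by (simp add: s.ev_smult s.ev_mult s.ev_power flip: evs)
    also have "fls_const (\<iota> ca) * ev f ^ Suc n * (of_nat (Suc n) * g ^ n * h) =
        (g * ev f) ^ n * (fls_const (\<iota> ca) * ev f * of_nat (Suc n) * h)"
      by (simp add: power_mult_distrib ac_simps)
    also have "\<dots> = - coeff (s0.sym a) n * (g * ev f)"
    proof -
      have "(of_nat (Suc n) :: 'b fls) = fls_const (of_nat (Suc n))" by (rule fls_of_nat)
      then have "of_nat (Suc n) \<noteq> (0 :: 'b fls)"
        using fls_const_nonzero[of "of_nat (Suc n) :: 'b"] by (simp del: of_nat_Suc)
      then have "of_nat (Suc n) * fls_const (\<iota> ca) \<noteq> 0" using inj[OF ca0] by (simp del: of_nat_Suc)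
      then show ?thesis unfolding g h_def by (simp add: g field_simps del: of_nat_Suc)
    qed
    finally show ?thesis by (simp add: g)
  qed
  have comm: "star (s.sym a) (s.sym b) = star (s.sym b) (s.sym a)" if "b \<in> C" for b
    using that by (simp add: C_def centralizer_def flip: s.sym_mult)
  from lead_nonzero[OF p(1,2)] lead_nonzero[OF q(1,2)] obtain cp cq where
    cp: "cp \<noteq> 0" "lead_coeff (std_sym p) = smult cp (f ^ degree (std_sym p))" and
    cq: "cq \<noteq> 0" "lead_coeff (std_sym q) = smult cq (f ^ degree (std_sym q))"
    by blast
  \<comment> \<open>Consecutive orders give the regularity of \<open>a\<close> first; commutation then passes it on to the
      whole centralizer.\<close>
  have reg_a: "weighted 0 1 0 (s.sym a)"
    by (rule regular_if_normalised[OF a_top inj[OF ca0] norm comm _ _ inj[OF cp(1)] comm _ _ inj[OF cq(1)]])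
      (use p q top[OF cp(2)] top[OF cq(2)] in \<open>auto simp: C_def\<close>)
  have reg: "weighted 0 1 0 (s.sym b)" if "b \<in> C" for b
  proof (cases "b = 0")
    case False
    with that obtain c where c: "c \<noteq> 0" "lead_coeff (std_sym b) = smult c (f ^ degree (std_sym b))"
      using lead_nonzero unfolding C_def by blast
    have "weighted 0 1 (- (0 * int (degree (std_sym b)))) (s.sym b)"
      by (rule commuting_inherits_weight[OF order_refl zero_less_one comm[OF that] a_top inj[OF ca0] _
            top[OF c(2)]]) (use reg_a in auto)
    then show ?thesis by simp
  qed simp
  define \<phi> where "\<phi> b = wsymbol 0 1 0 (s.sym b)" for b
  show ?thesis
  proof
    show "\<phi> 1 = 1" by (rule poly_eqI) (simp add: \<phi>_def frac_nth_def)
    show "\<phi> (v + w) = \<phi> v + \<phi> w" for v w by (simp add: \<phi>_def s.sym_add wsymbol_add)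
    show "\<phi> (v * w) = \<phi> v * \<phi> w" if "v \<in> centralizer a" "w \<in> centralizer a" for v w
      unfolding \<phi>_def s.sym_mult by (rule wsymbol_0_star) (use reg that in \<open>auto simp: C_def\<close>)
    show "\<phi> (weyl_const c * v) = smult (\<iota> c) (\<phi> v)" for c v
      by (rule poly_eqI) (simp add: \<phi>_def s.sym_const_mult frac_nth_def)
    show "degree (\<phi> b) = degree (std_sym b) \<and> lead_coeff (\<phi> b) = \<iota> c"
      if "b \<in> centralizer a" "b \<noteq> 0" "lead_coeff (std_sym b) = smult c (f ^ degree (std_sym b))" for b c
    proof -
      have "c \<noteq> 0" using that std_sym_eq_0_iff[of b] by auto
      have deg: "degree (\<phi> b) \<le> degree (std_sym b)"
        using top(1)[OF that(3)] by (intro degree_le) (simp add: \<phi>_def coeff_eq_0)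
      have c: "coeff (\<phi> b) (degree (std_sym b)) = \<iota> c"
        by (simp add: \<phi>_def top(2)[OF that(3)] frac_nth_def)
      with deg have "degree (\<phi> b) = degree (std_sym b)"
        using inj[OF \<open>c \<noteq> 0\<close>] by (intro degree_eq_if_coeff) auto
      with c show ?thesis by simp
    qed
    show "coeff (\<phi> a) n = 0" by (simp add: \<phi>_def norm)
    show "coeff (\<phi> b) i \<in> S"
      if S: "is_subfield S" and i: "range \<iota> \<subseteq> S" and ES: "\<And>i. E $$ i \<in> S" and xiS: "\<And>i. \<xi> $$ i \<in> S" for S b i
    proof -
      let ?T = "{u :: 'b fls. \<forall>i. u $$ i \<in> S}"
      have T: "is_subfield ?T" by (rule is_subfield_fls[OF S])
      note T' = is_subfieldD[OF T]
      have cT: "fls_const (\<iota> c) \<in> ?T" for c using i is_subfieldD(2)[OF S] by auto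
      have xT: "\<xi> \<in> ?T" and ET: "E \<in> ?T" using ES xiS by auto
      have dT: "E * fls_deriv u \<in> ?T" if "u \<in> ?T" for u
        using that by (intro T' ET) (auto intro: is_subfieldD[OF S])
      have "s.ev p \<in> ?T" for p
      proof (induction p)
        case 0
        show ?case unfolding s.ev_0 by (rule T')
      next
        case (pCons c p)
        show ?case unfolding s.ev_pCons by (intro T' cT xT pCons.IH)
      qed
      then have "ev p \<in> ?T" for p unfolding evs .
      then have gT: "g \<in> ?T" unfolding g_def by (intro T')
      have "coeff (s0.sym a) n \<in> ?T"
        by (rule s0.coeff_sym_closed) (intro T' dT cT gT xT; assumption)+
      then have hT: "h \<in> ?T" unfolding h_def by (intro T' gT cT)
      have "coeff (s.sym b) i \<in> ?T" for i
        by (rule s.coeff_sym_closed) (intro T' dT cT gT xT hT; assumption)+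
      then show ?thesis by (auto simp: \<phi>_def frac_nth_def is_subfieldD[OF S])
    qed
  qed
qed

end

section \<open>Polynomial parametrizations with the same coordinates\<close>

text \<open>
  More vectors than coordinates are linearly dependent. The induction eliminates the last
  coordinate.
\<close>

lemma exists_linear_relation:
  fixes \<rho> :: "nat \<Rightarrow> 'b::field poly"
  assumes "finite I" "card I > k" "\<And>i j. i \<in> I \<Longrightarrow> k \<le> j \<Longrightarrow> coeff (\<rho> i) j = 0"
  shows "\<exists>c. (\<exists>i\<in>I. c i \<noteq> 0) \<and> (\<Sum>i\<in>I. smult (c i) (\<rho> i)) = 0"
  using assms
proof (induction k arbitrary: I \<rho>)
  case 0
  then have "\<rho> i = 0" if "i \<in> I" for i using that by (intro poly_eqI) simp
  moreover obtain i where "i \<in> I" using 0 by fastforce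
  ultimately show ?case by (intro exI[of _ "\<lambda>_. 1"]) auto
next
  case (Suc k)
  show ?case
  proof (cases "\<forall>i\<in>I. coeff (\<rho> i) k = 0")
    case True
    have "coeff (\<rho> i) j = 0" if "i \<in> I" "k \<le> j" for i j
      using that True Suc.prems(3)[of i j] by (cases "j = k") auto
    with Suc.IH[of I \<rho>] Suc.prems show ?thesis by simp
  next
    case False
    then obtain l where l: "l \<in> I" "coeff (\<rho> l) k \<noteq> 0" by blast
    define t where "t i = coeff (\<rho> i) k / coeff (\<rho> l) k" for i
    let ?\<rho> = "\<lambda>i. \<rho> i - smult (t i) (\<rho> l)"
    have "coeff (?\<rho> i) j = 0" if "i \<in> I - {l}" "k \<le> j" for i j
      using that l Suc.prems(3)[of i j] Suc.prems(3)[of l j]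
      by (cases "j = k") (auto simp: t_def)
    moreover have "finite (I - {l})" "k < card (I - {l})" using Suc.prems(1,2) l(1) by auto
    ultimately obtain c where
      c: "\<exists>i\<in>I - {l}. c i \<noteq> 0" "(\<Sum>i\<in>I - {l}. smult (c i) (?\<rho> i)) = 0"
      using Suc.IH[of "I - {l}" ?\<rho>] by blast
    define c' where "c' = c(l := - (\<Sum>i\<in>I - {l}. c i * t i))"
    have "(\<Sum>i\<in>I. smult (c' i) (\<rho> i)) = smult (c' l) (\<rho> l) + (\<Sum>i\<in>I - {l}. smult (c' i) (\<rho> i))"
      using Suc.prems(1) l(1) by (rule sum.remove)
    also have "(\<Sum>i\<in>I - {l}. smult (c' i) (\<rho> i)) = (\<Sum>i\<in>I - {l}. smult (c i) (\<rho> i))"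
      by (intro sum.cong) (auto simp: c'_def)
    also have "smult (c' l) (\<rho> l) + (\<Sum>i\<in>I - {l}. smult (c i) (\<rho> i)) = 0"
      using c(2) by (simp add: c'_def smult_diff_right sum_subtractf smult_sum)
    finally show ?thesis using c(1) by (intro exI[of _ c']) (auto simp: c'_def)
  qed
qed

text \<open>
  The pairs in \<open>T\<close> are the values of two embeddings of one \<open>K\<close>-algebra into \<open>'b[z]\<close> that agree in degrees
  and leading coefficients. Working with the graph \<open>T\<close> avoids naming the algebra.
\<close>

locale parametrization_pair =
  fixes T :: "('b::field_char_0 poly \<times> 'b poly) set" and K :: "'b set"
  assumes K: "is_subfield K"
    and T_1: "(1, 1) \<in> T"
    and T_add: "(P, Q) \<in> T \<Longrightarrow> (P', Q') \<in> T \<Longrightarrow> (P + P', Q + Q') \<in> T"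
    and T_mult: "(P, Q) \<in> T \<Longrightarrow> (P', Q') \<in> T \<Longrightarrow> (P * P', Q * Q') \<in> T"
    and T_smult: "(P, Q) \<in> T \<Longrightarrow> c \<in> K \<Longrightarrow> (smult c P, smult c Q) \<in> T"
    and T_lead: "(P, Q) \<in> T \<Longrightarrow> degree P = degree Q \<and> lead_coeff P = lead_coeff Q \<and> lead_coeff P \<in> K"
begin

text \<open>
  The \<open>'b\<close>-span of \<open>T\<close>, which is the graph of the extension of scalars of the isomorphism between the
  two images.
\<close>

inductive_set R :: "('b poly \<times> 'b poly) set" where
  R_0: "(0, 0) \<in> R"
| R_step: "(P, Q) \<in> T \<Longrightarrow> (U, V) \<in> R \<Longrightarrow> (smult c P + U, smult c Q + V) \<in> R"

lemma R_add: "(U, V) \<in> R \<Longrightarrow> (U', V') \<in> R \<Longrightarrow> (U + U', V + V') \<in> R"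
  by (induction rule: R.induct) (auto simp: add.assoc intro: R.intros)

lemma R_smult: "(U, V) \<in> R \<Longrightarrow> (smult c U, smult c V) \<in> R"
  by (induction rule: R.induct) (auto simp: smult_add_right intro: R.intros)

lemma R_minus: "(U, V) \<in> R \<Longrightarrow> (- U, - V) \<in> R"
  using R_smult[of U V "- 1"] by simp

lemma R_diff: "(U, V) \<in> R \<Longrightarrow> (U', V') \<in> R \<Longrightarrow> (U - U', V - V') \<in> R"
  using R_add[OF _ R_minus] by simp

lemma T_imp_R: "(P, Q) \<in> T \<Longrightarrow> (P, Q) \<in> R"
  using R_step[OF _ R_0, of P Q 1] by simp

lemma R_mult:
  assumes "(U, V) \<in> R" "(U', V') \<in> R"
  shows "(U * U', V * V') \<in> R"
proof -
  have 1: "(P * U, Q * V) \<in> R" if "(P, Q) \<in> T" "(U, V) \<in> R" for P Q U V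
    using that(2)
  proof (induction rule: R.induct)
    case (R_step P' Q' U V c)
    then show ?case
      using R.R_step[OF T_mult[OF that(1) R_step(1)], of _ _ c] by (simp add: distrib_left)
  qed (simp add: R_0)
  from assms(1) show ?thesis
  proof (induction rule: R.induct)
    case (R_step P Q U V c)
    then show ?case
      using R_add[OF R_smult[OF 1[OF R_step(1) assms(2)], of c]] by (simp add: distrib_right)
  qed (simp add: R_0)
qed

lemma R_sum: "(\<And>x. x \<in> A \<Longrightarrow> (F x, G x) \<in> R) \<Longrightarrow> (sum F A, sum G A) \<in> R"
  by (induction A rule: infinite_finite_induct) (auto intro: R_0 R_add)

definition degs :: "nat set" where
  "degs = {degree P | P Q. (P, Q) \<in> T \<and> P \<noteq> 0}"

lemma degs_0: "0 \<in> degs"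
  using T_1 degree_1 one_neq_zero unfolding degs_def by (metis (mono_tags, lifting) mem_Collect_eq)

lemma degs_add: "d \<in> degs \<Longrightarrow> e \<in> degs \<Longrightarrow> d + e \<in> degs"
proof -
  assume "d \<in> degs" "e \<in> degs"
  then obtain P Q P' Q' where "(P, Q) \<in> T" "P \<noteq> 0" "d = degree P" "(P', Q') \<in> T" "P' \<noteq> 0" "e = degree P'"
    by (auto simp: degs_def)
  then have "(P * P', Q * Q') \<in> T" "P * P' \<noteq> 0" "degree (P * P') = d + e"
    by (auto intro: T_mult simp: degree_mult_eq)
  then show ?thesis unfolding degs_def by (metis (mono_tags, lifting) mem_Collect_eq)
qed

text \<open>
  Monic representatives, one for each degree that occurs. They span \<open>T\<close> over \<open>K\<close>, and having
  distinct degrees they show that \<open>R\<close> inherits the comparison of leading terms from \<open>T\<close>.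
\<close>

definition mon :: "nat \<Rightarrow> 'b poly \<times> 'b poly" where
  "mon d = (SOME p. p \<in> T \<and> degree (fst p) = d \<and> lead_coeff (fst p) = 1)"

lemma mon:
  assumes "d \<in> degs"
  shows "mon d \<in> T" "degree (fst (mon d)) = d" "coeff (fst (mon d)) d = 1"
    "degree (snd (mon d)) = d" "coeff (snd (mon d)) d = 1"
proof -
  from assms obtain P Q where PQ: "(P, Q) \<in> T" "P \<noteq> 0" "degree P = d" by (auto simp: degs_def)
  have "inverse (lead_coeff P) \<in> K" using T_lead[OF PQ(1)] is_subfieldD(7)[OF K] by blast
  then have "(smult (inverse (lead_coeff P)) P, smult (inverse (lead_coeff P)) Q) \<in> T"
    by (rule T_smult[OF PQ(1)])
  moreover have "degree (smult (inverse (lead_coeff P)) P) = d"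
    "lead_coeff (smult (inverse (lead_coeff P)) P) = 1" using PQ by auto
  ultimately have "\<exists>p. p \<in> T \<and> degree (fst p) = d \<and> lead_coeff (fst p) = 1" by (metis fst_conv)
  from someI_ex[OF this, folded mon_def]
  have m: "mon d \<in> T" "degree (fst (mon d)) = d" "lead_coeff (fst (mon d)) = 1" by auto
  then show "mon d \<in> T" "degree (fst (mon d)) = d" "coeff (fst (mon d)) d = 1" by auto
  have "(fst (mon d), snd (mon d)) \<in> T" using m by simp
  from T_lead[OF this] m show "degree (snd (mon d)) = d" "coeff (snd (mon d)) d = 1" by auto
qed

definition comb :: "(nat \<Rightarrow> 'b poly) \<Rightarrow> 'b poly \<Rightarrow> 'b poly" where
  "comb F c = (\<Sum>d\<le>degree c. smult (coeff c d) (F d))"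

lemma comb_eq_sum: "degree c \<le> N \<Longrightarrow> comb F c = (\<Sum>d\<le>N. smult (coeff c d) (F d))"
  unfolding comb_def by (intro sum.mono_neutral_left) (auto simp: coeff_eq_0)

lemma comb_add: "comb F (c + c') = comb F c + comb F c'"
proof -
  let ?N = "max (degree c) (degree c')"
  have "degree (c + c') \<le> ?N" by (rule degree_add_le_max)
  then show ?thesis by (simp add: comb_eq_sum[of _ ?N] smult_add_left sum.distrib)
qed

lemma comb_smult: "comb F (smult a c) = smult a (comb F c)"
proof -
  have "smult a (sum G A) = (\<Sum>x\<in>A. smult a (G x))" for G :: "nat \<Rightarrow> 'b poly" and A
    by (induction A rule: infinite_finite_induct) (simp_all add: smult_add_right)
  then show ?thesis by (simp add: comb_eq_sum[of _ "degree c"])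
qed

lemma comb_monom: "comb F (monom a d) = smult a (F d)"
proof -
  have "comb F (monom a d) = (\<Sum>i\<le>d. smult (coeff (monom a d) i) (F i))"
    by (rule comb_eq_sum) (rule degree_monom_le)
  also have "\<dots> = (\<Sum>i\<le>d. if i = d then smult a (F d) else 0)"
    by (intro sum.cong) auto
  finally show ?thesis by simp
qed

lemma T_comb:
  assumes "(P, Q) \<in> T"
  shows "\<exists>c. (\<forall>d. coeff c d \<noteq> 0 \<longrightarrow> d \<in> degs) \<and> P = comb (fst \<circ> mon) c \<and> Q = comb (snd \<circ> mon) c"
  using assms
proof (induction "degree P" arbitrary: P Q rule: less_induct)
  case less
  show ?case
  proof (cases "P = 0")
    case True
    with T_lead[OF less.prems] show ?thesis by (intro exI[of _ 0]) (simp add: comb_def)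
  next
    case False
    define d where "d = degree P"
    define l where "l = lead_coeff P"
    have d: "d \<in> degs" using False less.prems by (auto simp: degs_def d_def)
    note m = mon[OF d]
    let ?P' = "P + smult (- l) (fst (mon d))" and ?Q' = "Q + smult (- l) (snd (mon d))"
    have "l \<in> K" using T_lead[OF less.prems] unfolding l_def by blast
    then have "- l \<in> K" by (rule is_subfieldD(3)[OF K])
    then have T': "(?P', ?Q') \<in> T" using m(1) by (intro T_add less.prems T_smult) auto
    have "\<exists>c. (\<forall>d. coeff c d \<noteq> 0 \<longrightarrow> d \<in> degs) \<and> ?P' = comb (fst \<circ> mon) c \<and> ?Q' = comb (snd \<circ> mon) c"
    proof (cases "?P' = 0")
      case True
      then have "?Q' = 0" using T_lead[OF T'] by (metis leading_coeff_0_iff)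
      with True show ?thesis by (intro exI[of _ 0]) (simp add: comb_def)
    next
      case nz: False
      have z: "coeff ?P' i = 0" if "i \<ge> d" for i
        using that m d_def l_def by (cases "i = d") (auto simp: coeff_eq_0)
      have "degree ?P' < d"
      proof (rule ccontr)
        assume "\<not> ?thesis"
        then have "lead_coeff ?P' = 0" by (intro z) simp
        with nz show False by (simp only: leading_coeff_0_iff)
      qed
      then show ?thesis using less.hyps T' by (simp add: d_def)
    qed
    then obtain c where c: "\<forall>d. coeff c d \<noteq> 0 \<longrightarrow> d \<in> degs" "?P' = comb (fst \<circ> mon) c" "?Q' = comb (snd \<circ> mon) c"
      by blast
    show ?thesis
    proof (intro exI conjI allI impI)
      show "i \<in> degs" if "coeff (c + monom l d) i \<noteq> 0" for i
        using that c(1) d by (cases "i = d") auto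
      show "P = comb (fst \<circ> mon) (c + monom l d)" "Q = comb (snd \<circ> mon) (c + monom l d)"
        by (simp_all add: comb_add comb_monom c(2,3)[symmetric])
    qed
  qed
qed

lemma R_comb:
  assumes "(U, V) \<in> R"
  shows "\<exists>c. (\<forall>d. coeff c d \<noteq> 0 \<longrightarrow> d \<in> degs) \<and> U = comb (fst \<circ> mon) c \<and> V = comb (snd \<circ> mon) c"
  using assms
proof (induction rule: R.induct)
  case R_0
  show ?case by (intro exI[of _ 0]) (simp add: comb_def)
next
  case (R_step P Q U V a)
  from T_comb[OF R_step(1)] obtain c where c: "\<forall>d. coeff c d \<noteq> 0 \<longrightarrow> d \<in> degs"
    "P = comb (fst \<circ> mon) c" "Q = comb (snd \<circ> mon) c" by blast
  from R_step.IH obtain c' where c': "\<forall>d. coeff c' d \<noteq> 0 \<longrightarrow> d \<in> degs"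
    "U = comb (fst \<circ> mon) c'" "V = comb (snd \<circ> mon) c'" by blast
  show ?case
  proof (intro exI conjI allI impI)
    show "i \<in> degs" if "coeff (smult a c + c') i \<noteq> 0" for i
      using that c(1) c'(1) by (cases "coeff c i = 0") auto
    show "smult a P + U = comb (fst \<circ> mon) (smult a c + c')"
      "smult a Q + V = comb (snd \<circ> mon) (smult a c + c')"
      by (simp_all add: comb_add comb_smult c c')
  qed
qed

lemma comb_lead:
  assumes "\<And>d. coeff c d \<noteq> 0 \<Longrightarrow> degree (F d) = d \<and> coeff (F d) d = 1"
  shows "degree (comb F c) = degree c" "lead_coeff (comb F c) = lead_coeff c"
proof -
  have co: "coeff (comb F c) i = (if i = degree c then lead_coeff c else 0)" if "i \<ge> degree c" for i
  proof -
    have "coeff (comb F c) i = (\<Sum>d\<le>degree c. if d = i then lead_coeff c else 0)"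
      unfolding comb_def coeff_sum
    proof (intro sum.cong refl)
      fix d assume "d \<in> {..degree c}"
      show "coeff (smult (coeff c d) (F d)) i = (if d = i then lead_coeff c else 0)"
      proof (cases "coeff c d = 0")
        case True
        with that \<open>d \<in> _\<close> show ?thesis by auto
      next
        case False
        with assms[OF this] that \<open>d \<in> _\<close> show ?thesis by (auto simp: coeff_eq_0)
      qed
    qed
    with that show ?thesis by auto
  qed
  show "degree (comb F c) = degree c"
  proof (cases "c = 0")
    case False
    show ?thesis
    proof (rule antisym)
      show "degree (comb F c) \<le> degree c" by (intro degree_le) (simp add: co)
      show "degree c \<le> degree (comb F c)" using False by (intro le_degree) (simp add: co)
    qed
  qed (simp add: comb_def)
  then show "lead_coeff (comb F c) = lead_coeff c" by (simp add: co)
qed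

lemma R_lead:
  assumes "(U, V) \<in> R"
  shows "degree U = degree V" "lead_coeff U = lead_coeff V"
proof -
  obtain c where c: "\<forall>d. coeff c d \<noteq> 0 \<longrightarrow> d \<in> degs" "U = comb (fst \<circ> mon) c" "V = comb (snd \<circ> mon) c"
    using R_comb[OF assms] by blast
  have "degree U = degree c \<and> lead_coeff U = lead_coeff c" "degree V = degree c \<and> lead_coeff V = lead_coeff c"
    unfolding c(2,3) using c(1) by (auto intro!: comb_lead simp: mon)
  then show "degree U = degree V" "lead_coeff U = lead_coeff V" by auto
qed

text \<open>
  \<open>R\<close> is the graph of a function, because a pair \<open>(0, V)\<close> in \<open>R\<close> has equal leading coefficients.
\<close>

lemma R_unique: "(U, V) \<in> R \<Longrightarrow> (U, V') \<in> R \<Longrightarrow> V = V'"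
  using R_lead(2)[OF R_diff, of U V U V'] by (metis coeff_0 diff_self eq_iff_diff_eq_0 leading_coeff_0_iff)

lemma mem_fst_R: "x \<in> fst ` R \<longleftrightarrow> (\<exists>V. (x, V) \<in> R)"
  by force

lemma fst_R_add: "x \<in> fst ` R \<Longrightarrow> y \<in> fst ` R \<Longrightarrow> x + y \<in> fst ` R"
  unfolding mem_fst_R by (blast intro: R_add)

lemma fst_R_mult: "x \<in> fst ` R \<Longrightarrow> y \<in> fst ` R \<Longrightarrow> x * y \<in> fst ` R"
  unfolding mem_fst_R by (blast intro: R_mult)

text \<open>
  Modulo the first projection of \<open>R\<close> every polynomial has a representative of degree below \<open>k0\<close>.
\<close>

lemma remainder_exists:
  assumes "\<And>d. k0 \<le> d \<Longrightarrow> d \<in> degs"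
  shows "\<exists>\<rho>. U - \<rho> \<in> fst ` R \<and> (\<forall>j\<ge>k0. coeff \<rho> j = 0)"
proof (induction "degree U" arbitrary: U rule: less_induct)
  case less
  show ?case
  proof (cases "degree U < k0 \<or> U = 0")
    case True
    then have "coeff U j = 0" if "k0 \<le> j" for j using that by (cases "U = 0") (auto intro: coeff_eq_0)
    then show ?thesis by (intro exI[of _ U]) (auto intro!: image_eqI[OF _ R_0])
  next
    case False
    define d where "d = degree U"
    have d: "d \<in> degs" using assms False by (simp add: d_def)
    note m = mon[OF d]
    let ?U = "U - smult (lead_coeff U) (fst (mon d))"
    have R: "smult (lead_coeff U) (fst (mon d)) \<in> fst ` R"
      using R_smult[OF T_imp_R, of "fst (mon d)" "snd (mon d)"] m(1) by force
    have "\<exists>\<rho>. ?U - \<rho> \<in> fst ` R \<and> (\<forall>j\<ge>k0. coeff \<rho> j = 0)"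
    proof (cases "?U = 0")
      case True
      then show ?thesis by (intro exI[of _ 0]) (auto intro!: image_eqI[OF _ R_0])
    next
      case nz: False
      have z: "coeff ?U i = 0" if "i \<ge> d" for i
        using that m d_def by (cases "i = d") (auto simp: coeff_eq_0)
      have "degree ?U < d"
      proof (rule ccontr)
        assume "\<not> ?thesis"
        then have "lead_coeff ?U = 0" by (intro z) simp
        with nz show False by (simp only: leading_coeff_0_iff)
      qed
      then show ?thesis using less by (simp add: d_def)
    qed
    then obtain \<rho> where \<rho>: "?U - \<rho> \<in> fst ` R" "\<forall>j\<ge>k0. coeff \<rho> j = 0" by blast
    have "U - \<rho> = (?U - \<rho>) + smult (lead_coeff U) (fst (mon d))" by simp
    also have "\<dots> \<in> fst ` R" using \<rho>(1) R by (rule fst_R_add)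
    finally show ?thesis using \<rho>(2) by blast
  qed
qed

text \<open>
  Among the \<open>k0 + 1\<close> products of \<open>H\<close> with elements of distinct degrees some nontrivial combination has
  remainder \<open>0\<close>, since remainders have \<open>k0\<close> coordinates.
\<close>

lemma denominator_exists:
  assumes k0: "\<And>d. k0 \<le> d \<Longrightarrow> d \<in> degs"
  shows "\<exists>c. c \<noteq> 0 \<and> c \<in> fst ` R \<and> c * H \<in> fst ` R"
proof -
  define q where "q i = fst (mon (k0 + i))" for i
  have q: "degree (q i) = k0 + i" "coeff (q i) (k0 + i) = 1" "q i \<in> fst ` R" for i
  proof -
    have "k0 + i \<in> degs" by (rule k0) simp
    note m = mon[OF this]
    show "degree (q i) = k0 + i" "coeff (q i) (k0 + i) = 1" using m by (auto simp: q_def)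
    have "(fst (mon (k0 + i)), snd (mon (k0 + i))) \<in> R" using m(1) by (intro T_imp_R) simp
    then show "q i \<in> fst ` R" unfolding q_def by force
  qed
  have "\<forall>i. \<exists>\<rho>. q i * H - \<rho> \<in> fst ` R \<and> (\<forall>j\<ge>k0. coeff \<rho> j = 0)"
    by (intro allI remainder_exists k0)
  from choice[OF this] obtain \<rho> where
    "\<forall>i. q i * H - \<rho> i \<in> fst ` R \<and> (\<forall>j\<ge>k0. coeff (\<rho> i) j = 0)" ..
  then have \<rho>: "q i * H - \<rho> i \<in> fst ` R" "k0 \<le> j \<Longrightarrow> coeff (\<rho> i) j = 0" for i j by blast+
  obtain c where c: "\<exists>i\<in>{..k0}. c i \<noteq> 0" "(\<Sum>i\<le>k0. smult (c i) (\<rho> i)) = 0"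
    using exists_linear_relation[of "{..k0}" k0 \<rho>] \<rho>(2) by auto
  define C where "C = (\<Sum>i\<le>k0. smult (c i) (q i))"
  have sum_R: "(\<Sum>i\<le>k0. smult (c i) (F i)) \<in> fst ` R" if F: "\<And>i. F i \<in> fst ` R" for F
  proof -
    obtain G where "\<And>i. (F i, G i) \<in> R" using F unfolding mem_fst_R by metis
    then have "(\<Sum>i\<le>k0. smult (c i) (F i), \<Sum>i\<le>k0. smult (c i) (G i)) \<in> R"
      by (intro R_sum R_smult)
    then show ?thesis by force
  qed
  have "C * H = (\<Sum>i\<le>k0. smult (c i) (q i * H - \<rho> i)) + (\<Sum>i\<le>k0. smult (c i) (\<rho> i))"
    by (simp add: C_def sum_distrib_right smult_diff_right sum_subtractf)
  then have "C * H = (\<Sum>i\<le>k0. smult (c i) (q i * H - \<rho> i))" using c(2) by simp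
  then have "C * H \<in> fst ` R" using sum_R[OF \<rho>(1)] by simp
  moreover have "C \<in> fst ` R" unfolding C_def by (intro sum_R q)
  moreover have "C \<noteq> 0"
  proof
    assume "C = 0"
    define i where "i = Max {i. i \<le> k0 \<and> c i \<noteq> 0}"
    have fin: "finite {i. i \<le> k0 \<and> c i \<noteq> 0}" by simp
    have "i \<in> {i. i \<le> k0 \<and> c i \<noteq> 0}"
      unfolding i_def by (rule Max_in[OF fin]) (use c(1) in auto)
    then have i: "i \<le> k0" "c i \<noteq> 0" by auto
    have gt: "c l = 0" if "l > i" "l \<le> k0" for l
      using Max_ge[OF fin, of l] that unfolding i_def by (metis (mono_tags, lifting) linorder_not_le mem_Collect_eq)
    have "coeff C (k0 + i) = (\<Sum>l\<le>k0. if l = i then c i else 0)"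
      unfolding C_def coeff_sum
    proof (intro sum.cong refl)
      fix l assume "l \<in> {..k0}"
      then show "coeff (smult (c l) (q l)) (k0 + i) = (if l = i then c i else 0)"
        using q[of l] gt[of l] by (cases l i rule: linorder_cases) (auto simp: coeff_eq_0)
    qed
    with i \<open>C = 0\<close> show False by simp
  qed
  ultimately show ?thesis by blast
qed

text \<open>
  A product of denominators of \<open>1, z, \<dots>, z\<^bsup>k0-1\<^esup>\<close> is a denominator of all polynomials.
\<close>

lemma conductor_exists:
  assumes k0: "\<And>d. k0 \<le> d \<Longrightarrow> d \<in> degs"
  shows "\<exists>c. c \<noteq> 0 \<and> (\<forall>H. c * H \<in> fst ` R)"
proof -
  note mult = fst_R_mult
  have "\<exists>c. c \<noteq> 0 \<and> c \<in> fst ` R \<and> (\<forall>j<m. c * monom 1 j \<in> fst ` R)" for m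
  proof (induction m)
    case 0
    show ?case using T_imp_R[OF T_1] by (intro exI[of _ 1]) force
  next
    case (Suc m)
    then obtain c where c: "c \<noteq> 0" "c \<in> fst ` R" "\<forall>j<m. c * monom 1 j \<in> fst ` R" by blast
    obtain d where d: "d \<noteq> 0" "d \<in> fst ` R" "d * monom 1 m \<in> fst ` R"
      using denominator_exists[OF k0] by blast
    have "c * d * monom 1 j \<in> fst ` R" if "j < Suc m" for j
    proof (cases "j = m")
      case True
      then show ?thesis using mult[OF c(2) d(3)] by (simp add: mult.assoc)
    next
      case False
      then show ?thesis using mult[OF _ d(2), of "c * monom 1 j"] c(3) that by (simp add: ac_simps)
    qed
    with mult[OF c(2) d(2)] c(1) d(1) show ?case by (intro exI[of _ "c * d"]) auto
  qed
  from this[of k0] obtain c where c: "c \<noteq> 0" "c \<in> fst ` R" "\<forall>j<k0. c * monom 1 j \<in> fst ` R" by blast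
  have "c * H \<in> fst ` R" for H
  proof -
    obtain \<rho> where \<rho>: "H - \<rho> \<in> fst ` R" "\<forall>j\<ge>k0. coeff \<rho> j = 0"
      using remainder_exists[OF k0] by blast
    obtain G where G: "\<And>j. j < k0 \<Longrightarrow> (c * monom 1 j, G j) \<in> R"
      using c(3) unfolding mem_fst_R by metis
    have "c * \<rho> = (\<Sum>j<k0. smult (coeff \<rho> j) (c * monom 1 j))"
    proof -
      have "\<rho> = (\<Sum>j<k0. smult (coeff \<rho> j) (monom 1 j))"
        by (rule poly_eqI) (use \<rho>(2) in \<open>auto simp: coeff_sum not_less if_distrib cong: if_cong\<close>)
      then have "c * \<rho> = c * (\<Sum>j<k0. smult (coeff \<rho> j) (monom 1 j))" by simp
      then show ?thesis by (simp add: sum_distrib_left)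
    qed
    moreover have "(\<Sum>j<k0. smult (coeff \<rho> j) (c * monom 1 j), \<Sum>j<k0. smult (coeff \<rho> j) (G j)) \<in> R"
      by (intro R_sum R_smult G) auto
    ultimately have "c * \<rho> \<in> fst ` R" by force
    moreover have "c * H = c * (H - \<rho>) + c * \<rho>" by (simp add: algebra_simps)
    ultimately show ?thesis using fst_R_add[OF mult[OF c(2) \<rho>(1)]] by simp
  qed
  with c(1) show ?thesis by blast
qed

text \<open>
  Let \<open>c\<close> be in the conductor and let \<open>\<theta> H\<close> be the partner of \<open>c H\<close>. Then \<open>H \<mapsto> \<theta> H / \<theta> 1\<close> is a homomorphism
  from \<open>'b[z]\<close> to its fraction field. The image \<open>y\<close> of \<open>z\<close> is integral, hence a polynomial, and its
  degree and leading coefficient are \<open>1\<close>.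
\<close>

lemma translation_exists:
  assumes k0: "\<And>d. k0 \<le> d \<Longrightarrow> d \<in> degs"
  obtains s where "\<And>P Q. (P, Q) \<in> T \<Longrightarrow> Q = pcompose P [:s, 1:]"
proof -
  obtain c where c: "c \<noteq> 0" "\<And>H. c * H \<in> fst ` R" using conductor_exists[OF k0] by blast
  define \<theta> where "\<theta> H = (SOME V. (c * H, V) \<in> R)" for H
  have \<theta>: "(c * H, \<theta> H) \<in> R" for H
    unfolding \<theta>_def using c(2)[of H] by (auto intro: someI)
  have \<theta>_eqI: "(c * H, V) \<in> R \<Longrightarrow> \<theta> H = V" for H V using R_unique[OF \<theta>] by blast
  have \<theta>_add: "\<theta> (H + H') = \<theta> H + \<theta> H'" for H H'
    using R_add[OF \<theta> \<theta>, of H H'] by (intro \<theta>_eqI) (simp add: distrib_left)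
  have \<theta>_smult: "\<theta> (smult a H) = smult a (\<theta> H)" for a H
    using R_smult[OF \<theta>, of a H] by (intro \<theta>_eqI) simp
  have \<theta>_mult: "\<theta> H * \<theta> H' = \<theta> (H * H') * \<theta> 1" for H H'
    using R_mult[OF \<theta> \<theta>, of H H'] R_mult[OF \<theta> \<theta>, of "H * H'" 1]
    by (intro R_unique[of "c * c * H * H'"]) (simp_all add: ac_simps)
  have \<theta>1: "degree (\<theta> 1) = degree c" "lead_coeff (\<theta> 1) = lead_coeff c"
    using R_lead[OF \<theta>[of 1]] by auto
  then have nz: "\<theta> 1 \<noteq> 0" using c(1) by (metis leading_coeff_0_iff)
  let ?z = "[:0, 1:] :: 'b poly"
  \<comment> \<open>All powers of \<open>\<theta> z / \<theta> 1\<close> have the denominator \<open>\<theta> 1\<close>.\<close>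
  have pow: "\<theta> ?z ^ Suc k = \<theta> (?z ^ Suc k) * \<theta> 1 ^ k" for k
  proof (induction k)
    case (Suc k)
    have "\<theta> ?z ^ Suc (Suc k) = (\<theta> ?z * \<theta> (?z ^ Suc k)) * \<theta> 1 ^ k"
      using Suc by (simp add: mult.assoc)
    also have "\<theta> ?z * \<theta> (?z ^ Suc k) = \<theta> (?z ^ Suc (Suc k)) * \<theta> 1"
      by (subst \<theta>_mult) (simp only: power_Suc)
    also have "\<dots> * \<theta> 1 ^ k = \<theta> (?z ^ Suc (Suc k)) * \<theta> 1 ^ Suc k"
      by (simp only: power_Suc mult.assoc)
    finally show ?case .
  qed simp
  have "\<theta> 1 dvd \<theta> ?z"
    by (rule field_poly_dvd_if_powers_dvd[OF nz]) (metis pow dvd_triv_right)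
  then obtain y where y: "\<theta> ?z = \<theta> 1 * y" ..
  have "degree (c * ?z) = Suc (degree c)" "lead_coeff (c * ?z) = lead_coeff c"
    using c(1) by simp_all
  then have z: "degree (\<theta> ?z) = Suc (degree c)" "lead_coeff (\<theta> ?z) = lead_coeff c"
    using R_lead[OF \<theta>[of ?z]] by metis+
  then have "y \<noteq> 0" using y c(1) by auto
  then have "degree y = 1" using z(1) \<theta>1(1) nz unfolding y by (simp add: degree_mult_eq)
  moreover have "lead_coeff y = 1"
    using z(2) \<theta>1(2) c(1) unfolding y lead_coeff_mult by (metis leading_coeff_0_iff mult_cancel_left1)
  ultimately have "coeff y i = coeff [:coeff y 0, 1:] i" for i
    by (cases i; cases "i - 1") (auto simp: coeff_eq_0)
  then obtain s where s: "y = [:s, 1:]" by (metis poly_eqI)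
  have \<theta>_comp: "\<theta> H = \<theta> 1 * pcompose H y" for H
  proof (induction H)
    case 0
    show ?case using \<theta>_smult[of 0 0] by simp
  next
    case (pCons a H)
    have "\<theta> (?z * H) * \<theta> 1 = (y * \<theta> H) * \<theta> 1"
      using \<theta>_mult[of ?z H] unfolding y by (simp only: ac_simps)
    then have zH: "\<theta> (?z * H) = y * \<theta> H" using nz by simp
    have "pCons a H = smult a 1 + ?z * H"
      by (rule poly_eqI) (auto simp: coeff_pCons split: nat.splits)
    then have "\<theta> (pCons a H) = smult a (\<theta> 1) + \<theta> (?z * H)" by (simp only: \<theta>_add \<theta>_smult)
    also have "\<dots> = smult a (\<theta> 1) + y * (\<theta> 1 * pcompose H y)"
      unfolding zH by (subst pCons.IH) (rule refl)
    also have "\<dots> = \<theta> 1 * pcompose (pCons a H) y"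
      by (simp add: pcompose_pCons algebra_simps)
    finally show ?case .
  qed
  show ?thesis
  proof (rule that[of s])
    fix P Q assume "(P, Q) \<in> T"
    then have "(c * P, \<theta> 1 * Q) \<in> R" using R_mult[OF \<theta>[of 1] T_imp_R] by simp
    then have "\<theta> P = \<theta> 1 * Q" by (rule \<theta>_eqI)
    then show "Q = pcompose P [:s, 1:]" using \<theta>_comp[of P] nz s by simp
  qed
qed

end

section \<open>Descent along an algebraic extension\<close>

lemma pcompose_linear_top:
  fixes P :: "'b::comm_ring_1 poly"
  shows "degree P \<le> n \<Longrightarrow> coeff (pcompose P [:s, 1:]) n = coeff P n"
proof (induction P arbitrary: n)
  case (pCons a P)
  show ?case
  proof (cases n)
    case 0
    with pCons.prems have "P = 0" by (auto split: if_splits)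
    with 0 show ?thesis by simp
  next
    case (Suc m)
    with pCons.prems have P: "degree P \<le> m" by (auto split: if_splits)
    then have "coeff (pcompose P [:s, 1:]) (Suc m) = coeff P (Suc m)" by (intro pCons.IH) simp
    also have "\<dots> = 0" using P by (simp add: coeff_eq_0)
    finally show ?thesis using pCons.IH[OF P] Suc by (simp add: pcompose_pCons)
  qed
qed simp

lemma pcompose_linear_pred:
  fixes P :: "'b::comm_ring_1 poly"
  shows "degree P \<le> Suc n \<Longrightarrow>
    coeff (pcompose P [:s, 1:]) n = coeff P n + of_nat (Suc n) * s * coeff P (Suc n)"
proof (induction P arbitrary: n)
  case (pCons a P)
  from pCons.prems have P: "degree P \<le> n" by (auto split: if_splits)
  note top = pcompose_linear_top[OF P, of s]
  show ?case
  proof (cases n)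
    case 0
    with top show ?thesis by (simp add: pcompose_pCons)
  next
    case (Suc m)
    from pCons.IH[of m] P Suc have "coeff (pcompose P [:s, 1:]) m = coeff P m + of_nat n * s * coeff P n"
      by simp
    with top Suc show ?thesis by (simp add: pcompose_pCons algebra_simps)
  qed
qed simp

text \<open>
  Over an algebraically closed field a polynomial with simple roots has as many roots as its degree;
  the induction splits off a common root.
\<close>

lemma degree_le_if_simple_roots:
  fixes p F :: "'b::{alg_closed_field, field_char_0} poly"
  assumes "\<And>x. poly p x = 0 \<Longrightarrow> poly (pderiv p) x \<noteq> 0" "\<And>x. poly p x = 0 \<Longrightarrow> poly F x = 0" "F \<noteq> 0"
  shows "degree p \<le> degree F"
  using assms
proof (induction "degree p" arbitrary: p F)
  case (Suc n)
  then obtain a where a: "poly p a = 0" using alg_closed_imp_poly_has_root[of p] by auto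
  then obtain p' where p': "p = [:- a, 1:] * p'" by (auto simp: poly_eq_0_iff_dvd)
  from Suc.prems(2)[OF a] obtain F' where F': "F = [:- a, 1:] * F'" by (auto simp: poly_eq_0_iff_dvd)
  have nz: "F' \<noteq> 0" "p' \<noteq> 0" using Suc.prems(3) Suc.hyps(2) F' p' by auto
  have pd: "poly (pderiv p) x = (x - a) * poly (pderiv p') x + poly p' x" for x
    unfolding p' pderiv_mult by (simp add: pderiv_pCons left_diff_distrib)
  have deg: "degree p = Suc (degree p')" "degree F = Suc (degree F')"
    using nz by (simp_all add: p' F' degree_mult_eq del: mult_pCons_left)
  have "degree p' \<le> degree F'"
  proof (rule Suc.hyps(1))
    show "n = degree p'" using Suc.hyps(2) deg by simp
    show "poly (pderiv p') x \<noteq> 0" if "poly p' x = 0" for x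
      using Suc.prems(1)[of x] pd[of x] that by (auto simp: p')
    show "poly F' x = 0" if "poly p' x = 0" for x
    proof -
      have "poly F x = 0" using that by (intro Suc.prems(2)) (simp add: p')
      moreover have "x \<noteq> a" using Suc.prems(1)[OF a] pd[of a] that by auto
      ultimately show ?thesis by (simp add: F')
    qed
  qed (use nz in auto)
  then show ?case using deg by simp
qed simp

definition aeval :: "'a::field alg_closure \<Rightarrow> 'a poly \<Rightarrow> 'a alg_closure" where
  "aeval x B = poly (map_poly to_ac B) x"

lemma aeval_0 [simp]: "aeval x 0 = 0"
  by (simp add: aeval_def)

lemma aeval_pCons [simp]: "aeval x (pCons c B) = to_ac c + x * aeval x B"
  by (simp add: aeval_def map_poly_pCons)

lemma aeval_1 [simp]: "aeval x 1 = 1"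
  using aeval_pCons[of x 1 0] by simp

lemma aeval_add [simp]: "aeval x (A + B) = aeval x A + aeval x B"
proof (induction A arbitrary: B)
  case (pCons c A)
  then show ?case by (cases B) (simp add: algebra_simps)
qed simp

lemma aeval_smult [simp]: "aeval x (smult c B) = to_ac c * aeval x B"
  by (induction B) (simp_all add: algebra_simps)

lemma aeval_mult [simp]: "aeval x (A * B) = aeval x A * aeval x B"
  by (induction A) (simp_all add: algebra_simps)

lemma aeval_minus [simp]: "aeval x (- B) = - aeval x B"
  using aeval_smult[of x "- 1" B] by simp

lemma aeval_diff [simp]: "aeval x (A - B) = aeval x A - aeval x B"
  using aeval_add[of x A "- B"] by simp

locale minimal_polynomial =
  fixes x :: "'a::field_char_0 alg_closure" and \<pi> :: "'a poly"
  assumes pi_nz: "\<pi> \<noteq> 0" and pi_root: "aeval x \<pi> = 0"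
    and pi_min: "\<And>B. aeval x B = 0 \<Longrightarrow> B \<noteq> 0 \<Longrightarrow> degree \<pi> \<le> degree B"
begin

lemma mod_pi: "B mod \<pi> = 0 \<or> degree (B mod \<pi>) < degree \<pi>"
  using degree_mod_less[OF pi_nz] .

lemma aeval_mod_pi: "aeval y \<pi> = 0 \<Longrightarrow> aeval y (B mod \<pi>) = aeval y B"
  using aeval_add[of y "B div \<pi> * \<pi>" "B mod \<pi>"] by simp

lemma conjugate_root:
  assumes "aeval x B = 0" "aeval y \<pi> = 0"
  shows "aeval y B = 0"
proof -
  from assms(1) have "aeval x (B mod \<pi>) = 0" using aeval_mod_pi[OF pi_root] by simp
  then have "B mod \<pi> = 0" using pi_min mod_pi by (metis linorder_not_le)
  then show ?thesis using aeval_mod_pi[OF assms(2), of B] by simp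
qed

text \<open>
  The isomorphism from \<open>K(x)\<close> to \<open>K(y)\<close> over \<open>K\<close> that maps \<open>x\<close> to its conjugate \<open>y\<close>.
\<close>

lemma conjugation_exists:
  assumes "aeval y \<pi> = 0"
  shows "\<exists>\<sigma>. \<forall>B. \<sigma> (aeval x B) = aeval y B"
proof (intro exI allI)
  fix B
  let ?B = "SOME B'. aeval x B' = aeval x B"
  have "aeval x ?B = aeval x B" by (rule someI) (rule refl)
  then have "aeval x (?B - B) = 0" by simp
  from conjugate_root[OF this assms] show "(\<lambda>s. aeval y (SOME B. aeval x B = s)) (aeval x B) = aeval y B"
    by simp
qed

text \<open>
  A common divisor of \<open>B\<close> and \<open>\<pi>\<close> does not vanish at \<open>x\<close>; so the cofactor of \<open>\<pi>\<close> does, and by minimality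
  the divisor is constant.
\<close>

lemma bezout_pi:
  assumes "aeval x B \<noteq> 0"
  obtains r s where "r * B + s * \<pi> = 1"
proof -
  have "B \<noteq> 0" using assms by auto
  then obtain d u v r s where *: "B = d * u" "\<pi> = d * v" "d = r * B + s * \<pi>"
    using field_poly_bezout[of B \<pi>] by metis
  have "aeval x d * aeval x u \<noteq> 0" using assms unfolding *(1) aeval_mult .
  moreover have "aeval x d * aeval x v = 0" using pi_root unfolding *(2) aeval_mult .
  ultimately have "aeval x v = 0" by auto
  have "d \<noteq> 0" "v \<noteq> 0" using pi_nz *(2) by auto
  then have "degree \<pi> = degree d + degree v" unfolding *(2) by (rule degree_mult_eq)
  with pi_min[OF \<open>aeval x v = 0\<close> \<open>v \<noteq> 0\<close>] have "degree d = 0" by simp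
  then obtain c where c: "d = [:c:]" by (rule degree_eq_zeroE)
  with \<open>d \<noteq> 0\<close> have "c \<noteq> 0" by simp
  have "smult (inverse c) r * B + smult (inverse c) s * \<pi> = smult (inverse c) (r * B + s * \<pi>)"
    by (simp add: smult_add_right)
  also have "\<dots> = smult (inverse c) d" by (simp only: *(3)[symmetric])
  also have "\<dots> = 1" using \<open>c \<noteq> 0\<close> by (simp add: c)
  finally show ?thesis by (rule that)
qed

lemma is_subfield_range_aeval: "is_subfield (range (aeval x))"
  unfolding is_subfield_def
proof (intro conjI ballI)
  show "1 \<in> range (aeval x)" by (rule image_eqI[of _ _ 1]) auto
  fix a b assume "a \<in> range (aeval x)" "b \<in> range (aeval x)"
  then obtain A B where AB: "a = aeval x A" "b = aeval x B" by auto
  show "a - b \<in> range (aeval x)" by (rule image_eqI[of _ _ "A - B"]) (auto simp: AB)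
  show "a * b \<in> range (aeval x)" by (rule image_eqI[of _ _ "A * B"]) (auto simp: AB)
  show "inverse a \<in> range (aeval x)"
  proof (cases "a = 0")
    case True
    then show ?thesis by (intro image_eqI[of _ _ 0]) auto
  next
    case False
    then obtain r s where "r * A + s * \<pi> = 1" using bezout_pi[of A] AB by auto
    then have "aeval x r * a = 1" using aeval_add[of x "r * A" "s * \<pi>"] pi_root AB by simp
    then have "inverse a = aeval x r" by (metis inverse_unique mult.commute)
    then show ?thesis by simp
  qed
qed

lemma simple_roots:
  assumes "aeval y \<pi> = 0"
  shows "aeval y (pderiv \<pi>) \<noteq> 0"
proof -
  have "degree \<pi> \<noteq> 0"
  proof
    assume "degree \<pi> = 0"
    then obtain c where "\<pi> = [:c:]" by (rule degree_eq_zeroE)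
    with pi_nz pi_root show False by simp
  qed
  then have "pderiv \<pi> \<noteq> 0" "degree (pderiv \<pi>) < degree \<pi>"
    by (simp_all add: pderiv_eq_0_iff degree_pderiv)
  then have "aeval x (pderiv \<pi>) \<noteq> 0" using pi_min by (meson linorder_not_le)
  then obtain r s where "r * pderiv \<pi> + s * \<pi> = 1" using bezout_pi by blast
  then have "aeval y (r * pderiv \<pi> + s * \<pi>) = 1" by simp
  with assms show ?thesis by auto
qed

text \<open>
  With \<open>B\<close> reduced modulo \<open>\<pi>\<close>, the polynomial \<open>B - B(x)\<close> has smaller degree than \<open>\<pi>\<close> but vanishes at
  all the distinct roots of \<open>\<pi>\<close>; so \<open>B\<close> is constant.
\<close>

lemma conjugates_equal_imp_rational:
  assumes "\<And>y. aeval y \<pi> = 0 \<Longrightarrow> aeval y B = aeval x B"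
  shows "aeval x B \<in> range to_ac"
proof -
  let ?B = "B mod \<pi>" and ?p = "map_poly to_ac \<pi>"
  let ?F = "map_poly to_ac ?B - [:aeval x B:]"
  have B: "aeval y ?B = aeval y B" if "aeval y \<pi> = 0" for y using aeval_mod_pi[OF that] .
  have pd: "map_poly to_ac (pderiv \<pi>) = pderiv ?p"
    by (rule poly_eqI) (simp add: coeff_pderiv coeff_map_poly)
  have deg_map: "degree (map_poly to_ac p) = degree p" for p :: "'a poly"
    by (rule degree_map_poly) simp
  have "?F = 0"
  proof (rule ccontr)
    assume "?F \<noteq> 0"
    have "degree ?p \<le> degree ?F"
    proof (rule degree_le_if_simple_roots)
      show "poly (pderiv ?p) y \<noteq> 0" if "poly ?p y = 0" for y
        using simple_roots[of y] that by (simp add: aeval_def pd)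
      show "poly ?F y = 0" if "poly ?p y = 0" for y
        using assms[of y] B[of y] that by (simp add: aeval_def)
    qed fact
    then have "degree \<pi> \<le> degree ?F" by (simp add: deg_map)
    moreover have "degree ?F \<le> degree ?B"
      using degree_diff_le_max[of "map_poly to_ac ?B" "[:aeval x B:]"] by (simp add: deg_map)
    ultimately have "?B = 0" using mod_pi by (metis leD le_trans)
    then have "aeval x B = 0" using B[OF pi_root] by simp
    with \<open>?B = 0\<close> \<open>?F \<noteq> 0\<close> show False by simp
  qed
  then have "coeff ?F 0 = 0" by simp
  then have "aeval x B = to_ac (coeff ?B 0)" by (simp add: coeff_map_poly)
  then show ?thesis by simp
qed

end

lemma minimal_polynomial_exists:
  assumes "aeval x f = 0" "f \<noteq> 0"
  shows "\<exists>\<pi>. minimal_polynomial x \<pi>"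
proof -
  let ?Q = "\<lambda>B. aeval x B = 0 \<and> B \<noteq> 0"
  obtain \<pi> where "?Q \<pi>" "\<And>B. ?Q B \<Longrightarrow> degree \<pi> \<le> degree B"
    using ex_has_least_nat[of ?Q f degree] assms by auto
  then show ?thesis by (auto simp: minimal_polynomial_def)
qed

lemma is_subfield_range_to_ac: "is_subfield (range to_ac)"
  unfolding is_subfield_def
proof (intro conjI ballI)
  show "1 \<in> range to_ac" by (metis rangeI to_ac_1)
  fix a b :: "'a alg_closure" assume "a \<in> range to_ac" "b \<in> range to_ac"
  then obtain c d where cd: "a = to_ac c" "b = to_ac d" by auto
  show "a - b \<in> range to_ac" "a * b \<in> range to_ac" "inverse a \<in> range to_ac"
    unfolding cd by (simp_all flip: to_ac_diff to_ac_mult to_ac_inverse)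
qed

text \<open>
  \<open>A\<close> and its conjugate under \<open>x \<mapsto> y\<close> are two images of the same algebra, hence they differ by a
  translation, which \<open>P0\<close> shows to be trivial. So the coefficients are fixed by conjugation.
\<close>

lemma (in minimal_polynomial) rational_coefficients:
  assumes one: "1 \<in> A" and add: "\<And>P Q. P \<in> A \<Longrightarrow> Q \<in> A \<Longrightarrow> P + Q \<in> A"
    and mult: "\<And>P Q. P \<in> A \<Longrightarrow> Q \<in> A \<Longrightarrow> P * Q \<in> A"
    and smult: "\<And>c P. P \<in> A \<Longrightarrow> smult (to_ac c) P \<in> A"
    and lead: "\<And>P. P \<in> A \<Longrightarrow> lead_coeff P \<in> range to_ac"
    and field: "\<And>P i. P \<in> A \<Longrightarrow> coeff P i \<in> range (aeval x)"
    and norm: "P0 \<in> A" "degree P0 = Suc n" "coeff P0 n = 0"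
    and consecutive: "P1 \<in> A" "degree P1 = Suc k" "P2 \<in> A" "P2 \<noteq> 0" "degree P2 = k"
    and P: "P \<in> A"
  shows "coeff P i \<in> range to_ac"
proof -
  obtain B where B: "coeff P i = aeval x B" using field[OF P, of i] by auto
  have "aeval y B = aeval x B" if y: "aeval y \<pi> = 0" for y
  proof -
    obtain \<sigma> where \<sigma>: "\<And>B. \<sigma> (aeval x B) = aeval y B" using conjugation_exists[OF y] by blast
    have \<sigma>_const: "\<sigma> (to_ac c) = to_ac c" for c using \<sigma>[of "[:c:]"] by simp
    have \<sigma>_0: "\<sigma> 0 = 0" using \<sigma>[of 0] by simp
    have \<sigma>_add: "\<sigma> (s + t) = \<sigma> s + \<sigma> t" and \<sigma>_mult: "\<sigma> (s * t) = \<sigma> s * \<sigma> t"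
      if "s \<in> range (aeval x)" "t \<in> range (aeval x)" for s t
      using that \<sigma> by (auto simp flip: aeval_add aeval_mult)
    note S' = is_subfieldD[OF is_subfield_range_aeval]
    have \<sigma>_sum: "\<sigma> (sum F I) = (\<Sum>z\<in>I. \<sigma> (F z))" if "\<And>z. F z \<in> range (aeval x)" for F :: "nat \<Rightarrow> _" and I
      by (induction I rule: infinite_finite_induct) (auto simp: \<sigma>_0 \<sigma>_add that S')
    have toS: "to_ac c \<in> range (aeval x)" for c by (rule image_eqI[of _ _ "[:c:]"]) auto
    let ?\<psi> = "map_poly \<sigma>"
    have \<psi>_nth: "coeff (?\<psi> Q) i = \<sigma> (coeff Q i)" for Q i by (simp add: coeff_map_poly \<sigma>_0)
    define T where "T = (\<lambda>Q. (Q, ?\<psi> Q)) ` A"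
    interpret T: parametrization_pair T "range to_ac"
    proof
      show "is_subfield (range (to_ac :: 'a \<Rightarrow> _))" by (rule is_subfield_range_to_ac)
      have "?\<psi> 1 = 1" by (rule poly_eqI) (use \<sigma>_const[of 1] in \<open>simp add: \<psi>_nth \<sigma>_0\<close>)
      then show "(1, 1) \<in> T" unfolding T_def using one by (intro image_eqI[of _ _ 1]) auto
      fix Q Q' assume "(Q, Q') \<in> T"
      then have Q: "Q \<in> A" "Q' = ?\<psi> Q" by (auto simp: T_def)
      show "(smult c Q, smult c Q') \<in> T" if "c \<in> range to_ac" for c
      proof -
        from that obtain d where d: "c = to_ac d" by auto
        have "?\<psi> (smult c Q) = smult c (?\<psi> Q)"
          by (rule poly_eqI) (simp add: \<psi>_nth d \<sigma>_mult toS field[OF Q(1)] \<sigma>_const)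
        then show ?thesis unfolding T_def using Q d
          by (intro image_eqI[of _ _ "smult c Q"]) (auto intro: smult)
      qed
      show "degree Q = degree Q' \<and> lead_coeff Q = lead_coeff Q' \<and> lead_coeff Q \<in> range to_ac"
      proof (cases "Q = 0")
        case True
        with Q lead[OF Q(1)] show ?thesis by simp
      next
        case False
        obtain l where l: "lead_coeff Q = to_ac l" using lead[OF Q(1)] by auto
        have top: "coeff Q' (degree Q) = lead_coeff Q" by (simp add: Q \<psi>_nth l \<sigma>_const)
        have "degree Q' = degree Q"
        proof (rule degree_eq_if_coeff)
          show "degree Q' \<le> degree Q" by (intro degree_le) (simp add: Q \<psi>_nth coeff_eq_0 \<sigma>_0)
          show "coeff Q' (degree Q) \<noteq> 0" using top False by simp
        qed
        with top lead[OF Q(1)] show ?thesis by simp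
      qed
      fix U U' assume "(U, U') \<in> T"
      then have U: "U \<in> A" "U' = ?\<psi> U" by (auto simp: T_def)
      have "?\<psi> (Q + U) = ?\<psi> Q + ?\<psi> U"
        by (rule poly_eqI) (simp add: \<psi>_nth \<sigma>_add field Q(1) U(1))
      then show "(Q + U, Q' + U') \<in> T" unfolding T_def using Q U
        by (intro image_eqI[of _ _ "Q + U"]) (auto intro: add)
      have "?\<psi> (Q * U) = ?\<psi> Q * ?\<psi> U"
        by (rule poly_eqI) (simp add: \<psi>_nth coeff_mult \<sigma>_sum \<sigma>_mult field Q(1) U(1) S')
      then show "(Q * U, Q' * U') \<in> T" unfolding T_def using Q U
        by (intro image_eqI[of _ _ "Q * U"]) (auto intro: mult)
    qed
    have degs: "degree Q \<in> T.degs" if "Q \<in> A" "Q \<noteq> 0" for Q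
    proof -
      have "(Q, ?\<psi> Q) \<in> T" using that(1) by (simp add: T_def)
      with that(2) show ?thesis unfolding T.degs_def by blast
    qed
    have "P1 \<noteq> 0" using consecutive(2) by auto
    then have "k \<in> T.degs" "Suc k \<in> T.degs"
      using degs[OF consecutive(1)] degs[OF consecutive(3)] consecutive by auto
    then have large: "d \<in> T.degs" if "k * k \<le> d" for d
      using contains_large_if_consecutive[of T.degs k d] T.degs_0 T.degs_add that by blast
    obtain s where s: "\<And>Q Q'. (Q, Q') \<in> T \<Longrightarrow> Q' = pcompose Q [:s, 1:]"
      using T.translation_exists[OF large] by blast
    have \<psi>_eq: "?\<psi> Q = pcompose Q [:s, 1:]" if "Q \<in> A" for Q
      using that by (intro s) (auto simp: T_def)
    \<comment> \<open>A translation by \<open>s\<close> changes the subleading coefficient of \<open>P0\<close> by a nonzero multiple of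
      \<open>s\<close>, but that coefficient is \<open>0\<close> on both sides.\<close>
    have "coeff (pcompose P0 [:s, 1:]) n = 0"
      using \<psi>_nth[of P0 n] \<psi>_eq[OF norm(1)] by (simp add: norm(3) \<sigma>_0)
    then have "of_nat (Suc n) * s * coeff P0 (Suc n) = 0"
      using pcompose_linear_pred[of P0 n s] norm by simp
    moreover have "coeff P0 (Suc n) \<noteq> 0" using norm(2) by (metis leading_coeff_0_iff degree_0 nat.distinct(1))
    ultimately have "s = 0" by (simp del: of_nat_Suc)
    then have "?\<psi> P = P" using \<psi>_eq[OF P] by (simp only: pcompose_idR)
    then have "\<sigma> (coeff P i) = coeff P i" using \<psi>_nth[of P i] by simp
    then show ?thesis by (simp add: B \<sigma>)
  qed
  then show ?thesis unfolding B by (rule conjugates_equal_imp_rational)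
qed

section \<open>The embedding of the centralizer\<close>

text \<open>
  The Laurent expansion of \<open>F(x + t)\<close> is the Taylor expansion of \<open>F\<close> at \<open>x\<close>.
\<close>

lemma nth_eval_at_shifted_X:
  fixes F :: "'b::comm_ring_1 poly"
  shows "poly (map_poly fls_const F) (fls_const x + fls_X) $$ i =
    (if i < 0 then 0 else coeff (pcompose F [:x, 1:]) (nat i))"
proof (induction F arbitrary: i)
  case (pCons a F)
  have m: "map_poly fls_const (pCons a F) = pCons (fls_const a) (map_poly fls_const F)"
    by (rule map_poly_pCons) simp
  have "poly (map_poly fls_const (pCons a F)) (fls_const x + fls_X) $$ i =
      fls_const a $$ i + x * (poly (map_poly fls_const F) (fls_const x + fls_X) $$ i)
        + poly (map_poly fls_const F) (fls_const x + fls_X) $$ (i - 1)"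
    unfolding m by (simp add: distrib_right fls_X_times_conv_shift)
  also have "\<dots> = (if i < 0 then 0 else coeff (pcompose (pCons a F) [:x, 1:]) (nat i))"
    unfolding pCons.IH
    by (auto simp: pcompose_pCons coeff_pCons nat_diff_distrib split: nat.splits)
  finally show ?case .
qed simp

lemma is_K_algebra_embeddingI:
  fixes a :: "'a::field_char_0 weyl" and \<phi> :: "'a weyl \<Rightarrow> 'a poly"
  assumes "\<phi> 1 = 1"
    and add: "\<And>v w. v \<in> centralizer a \<Longrightarrow> w \<in> centralizer a \<Longrightarrow> \<phi> (v + w) = \<phi> v + \<phi> w"
    and "\<And>v w. v \<in> centralizer a \<Longrightarrow> w \<in> centralizer a \<Longrightarrow> \<phi> (v * w) = \<phi> v * \<phi> w"
    and smult: "\<And>c v. v \<in> centralizer a \<Longrightarrow> \<phi> (weyl_const c * v) = smult c (\<phi> v)"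
    and ker: "\<And>v. v \<in> centralizer a \<Longrightarrow> \<phi> v = 0 \<Longrightarrow> v = 0"
  shows "is_K_algebra_embedding (centralizer a) \<phi>"
proof -
  have "inj_on \<phi> (centralizer a)"
  proof (rule inj_onI)
    fix v w assume v: "v \<in> centralizer a" and w: "w \<in> centralizer a" and eq: "\<phi> v = \<phi> w"
    let ?u = "weyl_const (- 1) * w"
    have u: "?u \<in> centralizer a" by (intro centralizer_subalgebra w)
    have "\<phi> (v + ?u) = 0" using add[OF v u] smult[OF w, of "- 1"] eq by simp
    then have "v + ?u = 0" by (rule ker[OF centralizer_subalgebra(2)[OF v u]])
    moreover have "w + ?u = (weyl_const 1 + weyl_const (- 1)) * w" by (simp add: distrib_right)
    then have "w + ?u = 0" by (simp flip: weyl_const_add del: weyl_const_1)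
    ultimately show "v = w" by (metis add_right_imp_eq)
  qed
  with assms show ?thesis by (simp add: is_K_algebra_embedding_def)
qed

context rank_one_centralizer
begin

text \<open>
  At infinity \<open>x = 1/t\<close>, and \<open>\<kappa> \<partial> = -\<kappa> t\<^sup>2 d/dt\<close> has a double zero.
\<close>

lemma embedding_at_infinity:
  assumes deg_f: "degree f = 0"
  shows "\<exists>\<phi> :: 'a weyl \<Rightarrow> 'a poly. is_K_algebra_embedding (centralizer a) \<phi>"
proof -
  let ?C = "centralizer a"
  from deg_f obtain \<kappa> where \<kappa>: "f = [:\<kappa>:]" by (rule degree_eq_zeroE)
  with f have "\<kappa> \<noteq> 0" by simp
  let ?E = "fls_const (- \<kappa>) * fls_X ^ 2"
  have E: "laurent_derivation ?E 2"
    by unfold_locales (use \<open>\<kappa> \<noteq> 0\<close> in \<open>simp_all add: fls_X_power_nth\<close>)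
  have X: "fls_X ^ 2 * fls_X_inv ^ 2 = (1 :: 'a fls)"
    by (simp add: power_mult_distrib[symmetric] fls_X_times_conv_shift)
  have ev: "poly (map_poly (\<lambda>c. fls_const c) f) fls_X_inv = fls_const \<kappa>"
    by (simp add: \<kappa> map_poly_pCons)
  have "?E * fls_deriv fls_X_inv = fls_const \<kappa> * (fls_X ^ 2 * fls_X_inv ^ 2)"
    by (simp add: mult.assoc)
  then have xi: "?E * fls_deriv fls_X_inv = poly (map_poly (\<lambda>c. fls_const c) f) fls_X_inv"
    unfolding X ev by simp
  have fxi: "poly (map_poly (\<lambda>c. fls_const c) f) fls_X_inv \<noteq> 0"
    unfolding ev using \<open>\<kappa> \<noteq> 0\<close> by simp
  obtain \<phi> :: "'a weyl \<Rightarrow> 'a poly" where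
    \<phi>: "\<phi> 1 = 1" "\<And>v w. \<phi> (v + w) = \<phi> v + \<phi> w"
      "\<And>v w. v \<in> ?C \<Longrightarrow> w \<in> ?C \<Longrightarrow> \<phi> (v * w) = \<phi> v * \<phi> w"
      "\<And>c v. \<phi> (weyl_const c * v) = smult c (\<phi> v)"
    and deg: "\<And>b c. b \<in> ?C \<Longrightarrow> b \<noteq> 0 \<Longrightarrow> lead_coeff (std_sym b) = smult c (f ^ degree (std_sym b)) \<Longrightarrow>
      degree (\<phi> b) = degree (std_sym b) \<and> lead_coeff (\<phi> b) = c"
    by (rule local_embedding[OF _ _ _ E xi fxi]) blast+
  have "is_K_algebra_embedding ?C \<phi>"
  proof (rule is_K_algebra_embeddingI)
    fix v assume v: "v \<in> ?C" "\<phi> v = 0"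
    show "v = 0"
    proof (rule ccontr)
      assume "v \<noteq> 0"
      with lead_nonzero v deg[OF v(1)] show False by (metis coeff_0)
    qed
  qed (simp_all add: \<phi>)
  then show ?thesis by blast
qed

text \<open>
  At a root \<open>x\<close> of \<open>f\<close> the coordinate is \<open>x + t\<close>, and \<open>f \<partial> = f(x + t) d/dt\<close> vanishes at \<open>t = 0\<close>.
\<close>

lemma embedding_at_root:
  assumes deg_f: "degree f \<noteq> 0"
  shows "\<exists>\<phi> :: 'a weyl \<Rightarrow> 'a poly. is_K_algebra_embedding (centralizer a) \<phi>"
proof -
  let ?C = "centralizer a"
  have dm: "degree (map_poly to_ac f) = degree f" by (rule degree_map_poly) simp
  then obtain x where x: "aeval x f = 0"
    using alg_closed_imp_poly_has_root[of "map_poly to_ac f"] deg_f by (auto simp: aeval_def)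
  obtain \<pi> where "minimal_polynomial x \<pi>" using minimal_polynomial_exists[OF x f] by blast
  then interpret minimal_polynomial x \<pi> .
  let ?F = "map_poly to_ac f"
  let ?\<xi> = "fls_const x + fls_X"
  have mm: "map_poly (\<lambda>c. fls_const (to_ac c)) f = map_poly fls_const ?F"
    by (rule poly_eqI) (simp add: coeff_map_poly)
  define E where "E = poly (map_poly (\<lambda>c. fls_const (to_ac c)) f) ?\<xi>"
  have E_nth: "E $$ i = (if i < 0 then 0 else coeff (pcompose ?F [:x, 1:]) (nat i))" for i
    unfolding E_def mm by (rule nth_eval_at_shifted_X)
  have "?F \<noteq> 0" using deg_f dm by auto
  then have "pcompose ?F [:x, 1:] \<noteq> 0" by (simp add: pcompose_eq_0_iff)
  then have E0: "E \<noteq> 0" using E_nth[of "int (degree (pcompose ?F [:x, 1:]))"] by auto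
  have "coeff (pcompose ?F [:x, 1:]) 0 = 0" using x by (simp add: aeval_def coeff_pcompose_0)
  then have "E $$ i = 0" if "i < 1" for i using that by (cases "i = 0") (auto simp: E_nth)
  with E0 have "fls_subdegree E \<ge> 1" by (intro fls_subdegree_geI) auto
  with E0 have E: "laurent_derivation E (fls_subdegree E)"
    by unfold_locales (auto simp: nth_fls_subdegree_nonzero)
  have xi: "E * fls_deriv ?\<xi> = poly (map_poly (\<lambda>c. fls_const (to_ac c)) f) ?\<xi>"
    by (simp add: E_def)
  have fxi: "poly (map_poly (\<lambda>c. fls_const (to_ac c)) f) ?\<xi> \<noteq> 0"
    using E0 by (simp add: E_def)
  obtain \<phi> :: "'a weyl \<Rightarrow> 'a alg_closure poly" where
    \<phi>: "\<phi> 1 = 1" "\<And>v w. \<phi> (v + w) = \<phi> v + \<phi> w"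
      "\<And>v w. v \<in> ?C \<Longrightarrow> w \<in> ?C \<Longrightarrow> \<phi> (v * w) = \<phi> v * \<phi> w"
      "\<And>c v. \<phi> (weyl_const c * v) = smult (to_ac c) (\<phi> v)"
    and deg: "\<And>b c. b \<in> ?C \<Longrightarrow> b \<noteq> 0 \<Longrightarrow> lead_coeff (std_sym b) = smult c (f ^ degree (std_sym b)) \<Longrightarrow>
      degree (\<phi> b) = degree (std_sym b) \<and> lead_coeff (\<phi> b) = to_ac c"
    and norm: "coeff (\<phi> a) n = 0"
    and closed: "\<And>S b i. is_subfield S \<Longrightarrow> range to_ac \<subseteq> S \<Longrightarrow> (\<And>i. E $$ i \<in> S) \<Longrightarrow> (\<And>i. ?\<xi> $$ i \<in> S) \<Longrightarrow>
      coeff (\<phi> b) i \<in> S"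
    by (rule local_embedding[OF to_ac_add to_ac_mult to_ac_1 E xi fxi]) blast+
  have deg': "degree (\<phi> b) = degree (std_sym b) \<and> lead_coeff (\<phi> b) \<in> range to_ac \<and> lead_coeff (\<phi> b) \<noteq> 0"
    if b: "b \<in> ?C" "b \<noteq> 0" for b
  proof -
    obtain c where c: "c \<noteq> 0" "lead_coeff (std_sym b) = smult c (f ^ degree (std_sym b))"
      using lead_nonzero[OF b] by blast
    have "to_ac c \<in> range to_ac" "to_ac c \<noteq> 0" using c(1) by simp_all
    with deg[OF b c(2)] show ?thesis by metis
  qed
  define S where "S = range (aeval x)"
  have S: "is_subfield S" unfolding S_def by (rule is_subfield_range_aeval)
  note S' = is_subfieldD[OF S]
  have toS: "to_ac c \<in> S" for c
    unfolding S_def by (rule image_eqI[of _ _ "[:c:]"]) auto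
  have xS: "x \<in> S"
    unfolding S_def by (rule image_eqI[of _ _ "[:0, 1:]"]) auto
  have coeffS: "coeff (\<phi> b) i \<in> S" for b i
  proof (rule closed[OF S])
    show "range to_ac \<subseteq> S" using toS by auto
    have xi_S: "?\<xi> \<in> {u. \<forall>i. u $$ i \<in> S}" using xS by (auto simp: S')
    show "?\<xi> $$ i \<in> S" for i using xi_S by blast
    note T' = is_subfieldD[OF is_subfield_fls[OF S]]
    have "poly (map_poly (\<lambda>c. fls_const (to_ac c)) g) ?\<xi> \<in> {u. \<forall>i. u $$ i \<in> S}" for g :: "'a poly"
    proof (induction g)
      case 0
      show ?case unfolding map_poly_0 poly_0 by (rule T')
    next
      case (pCons c g)
      have "fls_const (to_ac c) \<in> {u. \<forall>i. u $$ i \<in> S}" using toS by (auto simp: S')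
      then have "fls_const (to_ac c) + ?\<xi> * poly (map_poly (\<lambda>c. fls_const (to_ac c)) g) ?\<xi>
          \<in> {u. \<forall>i. u $$ i \<in> S}"
        by (intro T' xi_S pCons.IH)
      then show ?case by (simp add: map_poly_pCons del: mem_Collect_eq)
    qed
    then show "E $$ i \<in> S" for i unfolding E_def by blast
  qed
  have aC: "a \<in> ?C" and a0: "a \<noteq> 0" using n by (auto simp: centralizer_def)
  have \<phi>_0: "\<phi> 0 = 0" using \<phi>(4)[of 0 0] by simp
  have rational: "coeff (\<phi> b) i \<in> range to_ac" if b: "b \<in> ?C" for b i
  proof (rule rational_coefficients[of "\<phi> ` ?C" "\<phi> a" n "\<phi> p" k "\<phi> q"])
    show "1 \<in> \<phi> ` ?C"
      by (rule image_eqI[of _ _ 1]) (use centralizer_subalgebra(1)[of 1 a] in \<open>auto simp: \<phi>(1)\<close>)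
    show "P + Q \<in> \<phi> ` ?C" if "P \<in> \<phi> ` ?C" "Q \<in> \<phi> ` ?C" for P Q
      using that by (force intro: centralizer_subalgebra(2) simp flip: \<phi>(2))
    show "P * Q \<in> \<phi> ` ?C" if "P \<in> \<phi> ` ?C" "Q \<in> \<phi> ` ?C" for P Q
      using that by (force intro: centralizer_subalgebra(3) simp flip: \<phi>(3))
    show "smult (to_ac c) P \<in> \<phi> ` ?C" if "P \<in> \<phi> ` ?C" for c P
      using that by (force intro: centralizer_subalgebra(1,3) simp flip: \<phi>(4))
    show "lead_coeff P \<in> range to_ac" if P: "P \<in> \<phi> ` ?C" for P
    proof (cases "P = 0")
      case True
      then show ?thesis by (metis coeff_0 rangeI to_ac_0)
    next
      case False
      with P deg' \<phi>_0 show ?thesis by (metis imageE)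
    qed
    show "coeff P i \<in> range (aeval x)" if "P \<in> \<phi> ` ?C" for P i
      using that coeffS by (auto simp: S_def)
    show "\<phi> q \<noteq> 0" using deg'[OF q(1,2)] by auto
  qed (use b aC deg'[OF aC a0] deg'[OF p(1,2)] deg'[OF q(1,2)] n p q norm in auto)
  define \<Phi> where "\<Phi> b = map_poly of_ac (\<phi> b)" for b
  have \<Phi>: "map_poly to_ac (\<Phi> b) = \<phi> b" if "b \<in> ?C" for b
    by (rule poly_eqI) (simp add: \<Phi>_def coeff_map_poly to_ac_of_ac rational[OF that])
  have inj: "P = Q" if "map_poly to_ac P = map_poly to_ac Q" for P Q :: "'a poly"
    using that by (simp add: poly_eq_iff coeff_map_poly)
  have "is_K_algebra_embedding ?C \<Phi>"
  proof (rule is_K_algebra_embeddingI)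
    have "1 \<in> ?C" using centralizer_subalgebra(1)[of 1 a] by simp
    then show "\<Phi> 1 = 1" by (intro inj) (simp add: \<Phi> \<phi>(1))
    fix v assume v: "v \<in> ?C"
    show "\<Phi> (weyl_const c * v) = smult c (\<Phi> v)" for c
    proof (rule inj)
      have "map_poly to_ac (smult c (\<Phi> v)) = smult (to_ac c) (map_poly to_ac (\<Phi> v))"
        by (rule poly_eqI) (simp add: coeff_map_poly)
      moreover have "weyl_const c * v \<in> ?C" by (intro centralizer_subalgebra v)
      ultimately show "map_poly to_ac (\<Phi> (weyl_const c * v)) = map_poly to_ac (smult c (\<Phi> v))"
        by (simp add: \<Phi> \<phi>(4) v)
    qed
    show "v = 0" if "\<Phi> v = 0"
      using \<Phi>[OF v] deg'[OF v] that by (metis leading_coeff_0_iff map_poly_0)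
    fix w assume w: "w \<in> ?C"
    show "\<Phi> (v + w) = \<Phi> v + \<Phi> w"
    proof (rule inj)
      have "map_poly to_ac (\<Phi> v + \<Phi> w) = map_poly to_ac (\<Phi> v) + map_poly to_ac (\<Phi> w)"
        by (rule poly_eqI) (simp add: coeff_map_poly)
      moreover have "v + w \<in> ?C" by (intro centralizer_subalgebra v w)
      ultimately show "map_poly to_ac (\<Phi> (v + w)) = map_poly to_ac (\<Phi> v + \<Phi> w)"
        by (simp add: \<Phi> \<phi>(2) v w)
    qed
    show "\<Phi> (v * w) = \<Phi> v * \<Phi> w"
    proof (rule inj)
      have "map_poly to_ac (\<Phi> v * \<Phi> w) = map_poly to_ac (\<Phi> v) * map_poly to_ac (\<Phi> w)"
        by (rule poly_eqI) (simp add: coeff_map_poly coeff_mult to_ac_sum)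
      moreover have "v * w \<in> ?C" by (intro centralizer_subalgebra v w)
      ultimately show "map_poly to_ac (\<Phi> (v * w)) = map_poly to_ac (\<Phi> v * \<Phi> w)"
        by (simp add: \<Phi> \<phi>(3) v w)
    qed
  qed
  then show ?thesis by blast
qed

end

theorem theorem1p1:
  fixes a :: "'a::field_char_0 weyl"
  assumes "a \<notin> range weyl_const"
    and "centralizer_rank a = 1"
  shows "\<exists>\<phi> :: 'a weyl \<Rightarrow> 'a poly. is_K_algebra_embedding (centralizer a) \<phi>"
proof -
  obtain f n k p q where "rank_one_centralizer a f n k p q"
    using rank_one_leading_coeffs[OF assms] by blast
  then interpret rank_one_centralizer a f n k p q .
  show ?thesis using embedding_at_infinity embedding_at_root by blast
qed

end
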